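(* Let $G=(V,E)$ be the $1$-skeleton of the Archimedean solid $(4,6,10)$, and let $\Delta=\{(x,y,z)\mid x,y,z\ge0,\ x+y+z=1\}$ be the simplex of $\mathrm{Aut}(G)$-invariant transition probabilities and $X_0=\frac{1}{14+5\varphi}(5,3+3\varphi,6+2\varphi)\in\Delta$, where $\varphi=\frac{1+\sqrt5}{2}$. Then there are three explicitly given curves $C_1,C_2,C_3\subset\Delta$, which meet in $X_0$ and have the following property: for every $X\in C_i$, the lengths of two of the three equivalence classes of Euclidean edges in the spectral representation of $P_X$ for the eigenvalue $\lambda_1(X)$ coincide. As $X_n$ converges to the corresponding vertex of the simplex $\Delta$ along the curve $C_i$, the spectral representations converge to equilateral realisations of the Archimedean solids $(3,10,10)$, $(5,6,6)$ and $(3,4,5,4)$, for $i=1,2,3$ respectively. For any sequence $X_n\in\mathrm{int}(\Delta)$ converging to an interior point of a boundary edge of the simplex $\Delta$, the spectral representations converge to the equilateral realisations of one of the solids $(3,3,3,3,3)$, $(5,5,5)$ and $(3,5,3,5)$.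
   Context: Solids are denoted by their vertex configuration: $(m,n,\dots)$ means that an $m$-gon, an $n$-gon, $\dots$ meet, in this order, at every vertex; so $(4,6,10)$ is the truncated icosidodecahedron, $(3,3,3,3,3)$ the icosahedron, $(5,5,5)$ the dodecahedron and $(3,5,3,5)$ the icosidodecahedron. $G$ has $120$ vertices of degree three, and $\mathrm{Aut}(G)$ (isomorphic to the Coxeter group $H_3$) acts simply transitively on $V$. There are three equivalence classes of edges under $\mathrm{Aut}(G)$: edges separating $4$- and $6$-gons, $4$- and $10$-gons, and $6$- and $10$-gons. For $X=(x,y,z)\in\Delta$, $P_X=(p_{ij})_{i,j\in V}$ is the symmetric stochastic matrix with $p_{ij}=x,y,z$ for edges $\{i,j\}$ in these classes, respectively, and $p_{ij}=0$ if $i=j$ or $\{i,j\}\notin E$. Its eigenvalues counted with multiplicity are $1=\lambda_0(X)\ge\lambda_1(X)\ge\cdots$. $\mathrm{int}(\Delta)$ is the subset where $x,y,z>0$; for $X\in\mathrm{int}(\Delta)$ the eigenvalue $\lambda_1(X)$ has multiplicity three. For an orthonormal basis $\phi_1,\phi_2,\phi_3$ of the $\lambda_1(X)$-eigenspace of $P_X$ (with respect to $\langle f,g\rangle=\sum_{i\in V}f(i)g(i)$), the spectral representation is $\Phi_X:V\to\mathbb{R}^3$, $\Phi_X(i)=(\phi_1(i),\phi_2(i),\phi_3(i))$; it is defined up to an orthogonal transformation of $\mathbb{R}^3$. The Euclidean edges are the segments joining $\Phi_X(i)$ and $\Phi_X(j)$ for $\{i,j\}\in E$; equivalent edges of $G$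 give segments of equal length. Equilateral means that all edges have the same Euclidean length. *)

theory Defs
  imports "HOL-Analysis.Analysis"
begin

section \<open>Convex solids and vertex configurations\<close>

definition extreme_points :: "(real^3) set \<Rightarrow> (real^3) set" where
  "extreme_points S = {v. v extreme_point_of S}"

text \<open>An \<open>n\<close>-gon is identified by its number of corners.\<close>

definition is_gon :: "nat \<Rightarrow> (real^3) set \<Rightarrow> bool" where
  "is_gon n F \<longleftrightarrow> card (extreme_points F) = n"

definition separates :: "nat \<Rightarrow> nat \<Rightarrow> (real^3) set \<Rightarrow> (real^3) set \<Rightarrow> bool" where
  "separates m n e S \<longleftrightarrow> e edge_of S \<and>
     (\<exists>F F'. F facet_of S \<and> F' facet_of S \<and> is_gon m F \<and> is_gon n F' \<and> F \<inter> F' = e)"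

text \<open>\<open>Fs\<close> lists the faces at \<open>v\<close> in their cyclic order: consecutive faces share an edge.\<close>

definition vertex_configuration :: "nat list \<Rightarrow> (real^3) set \<Rightarrow> real^3 \<Rightarrow> bool" where
  "vertex_configuration c S v \<longleftrightarrow>
     (\<exists>Fs. length Fs = length c \<and> distinct Fs \<and> set Fs = {F. F facet_of S \<and> v \<in> F} \<and>
        (\<forall>k < length c. is_gon (c ! k) (Fs ! k) \<and>
           (Fs ! k \<inter> Fs ! (Suc k mod length c)) edge_of S))"

definition equilateral :: "(real^3) set \<Rightarrow> bool" where
  "equilateral S \<longleftrightarrow> (\<exists>l. \<forall>u v. closed_segment u v edge_of S \<longrightarrow> dist u v = l)"

text \<open>A convex polygon is regular iff its sides have equal length and its corners are concyclic.
  The centre \<open>c\<close> below need not lie in the plane of \<open>F\<close>, but a sphere meets that plane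
  in a circle.\<close>

definition regular_polygon :: "(real^3) set \<Rightarrow> bool" where
  "regular_polygon F \<longleftrightarrow> polytope F \<and> aff_dim F = 2 \<and> equilateral F \<and>
     (\<exists>c r. \<forall>v \<in> extreme_points F. dist c v = r)"

definition archimedean_solid :: "nat list \<Rightarrow> (real^3) set \<Rightarrow> bool" where
  "archimedean_solid c S \<longleftrightarrow> polytope S \<and> aff_dim S = 3 \<and>
     (\<forall>F. F facet_of S \<longrightarrow> regular_polygon F) \<and>
     (\<forall>v \<in> extreme_points S. vertex_configuration c S v)"

section \<open>The truncated icosidodecahedron\<close>

definition golden :: real where
  "golden = (1 + sqrt 5) / 2"

text \<open>The standard coordinates, for edge length \<open>2 / golden\<close>: all changes of sign and all even
  (that is, cyclic) permutations of the coordinates of five points.\<close>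

definition ti_base :: "(real \<times> real \<times> real) set" where
  "ti_base =
    {(1 / golden, 1 / golden, 3 + golden),
     (2 / golden, golden, 1 + 2 * golden),
     (1 / golden, golden ^ 2, 3 * golden - 1),
     (2 * golden - 1, 2, 2 + golden),
     (golden, 3, 2 * golden)}"

definition ti_points :: "(real^3) set" where
  "ti_points = (\<Union>(a, b, c) \<in> ti_base. \<Union>r \<in> {-1, 1}. \<Union>s \<in> {-1, 1}. \<Union>t \<in> {-1, 1}.
     {vector [r * a, s * b, t * c], vector [s * b, t * c, r * a], vector [t * c, r * a, s * b]})"

definition truncated_icosidodecahedron :: "(real^3) set" where
  "truncated_icosidodecahedron = convex hull ti_points"

lemma finite_ti_points: "finite ti_points"
  unfolding ti_points_def ti_base_def by auto

lemma ti_points_nonempty: "ti_points \<noteq> {}"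
  unfolding ti_points_def ti_base_def by auto

lemma extreme_points_ti_subset: "extreme_points truncated_icosidodecahedron \<subseteq> ti_points"
  unfolding extreme_points_def truncated_icosidodecahedron_def
  using extreme_point_of_convex_hull by blast

lemma extreme_points_ti_nonempty: "extreme_points truncated_icosidodecahedron \<noteq> {}"
proof -
  have "compact truncated_icosidodecahedron"
    unfolding truncated_icosidodecahedron_def
    by (intro compact_convex_hull finite_imp_compact finite_ti_points)
  moreover have "convex truncated_icosidodecahedron" "truncated_icosidodecahedron \<noteq> {}"
    unfolding truncated_icosidodecahedron_def using ti_points_nonempty by auto
  ultimately show ?thesis
    unfolding extreme_points_def using extreme_point_exists_convex by blast
qed

typedef vertex = "extreme_points truncated_icosidodecahedron"
  morphisms pos Vertex
  using extreme_points_ti_nonempty by blast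

instance vertex :: finite
proof
  have "finite (range pos)"
    using finite_subset[OF extreme_points_ti_subset finite_ti_points]
      pos finite_subset by (metis image_subset_iff)
  then show "finite (UNIV :: vertex set)"
    by (rule finite_imageD) (simp add: inj_def pos_inject)
qed

definition adjacent :: "vertex \<Rightarrow> vertex \<Rightarrow> bool" where
  "adjacent i j \<longleftrightarrow> closed_segment (pos i) (pos j) edge_of truncated_icosidodecahedron"

text \<open>The three classes of edges are indexed by the elements 1, 2, 3 of the type \<open>3\<close> (where
  \<open>3 = 0\<close>): edges between 4- and 6-gons, 4- and 10-gons, 6- and 10-gons.\<close>

definition edge_in_class :: "3 \<Rightarrow> vertex \<Rightarrow> vertex \<Rightarrow> bool" where
  "edge_in_class k i j \<longleftrightarrow>
     (let e = closed_segment (pos i) (pos j); S = truncated_icosidodecahedron in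
      if k = 1 then separates 4 6 e S
      else if k = 2 then separates 4 10 e S
      else separates 6 10 e S)"

section \<open>Transition matrices and spectral representations\<close>

text \<open>A point \<open>(x, y, z)\<close> of the simplex is a vector \<open>X\<close> with \<open>x = X $ 1\<close>, \<open>y = X $ 2\<close>,
  \<open>z = X $ 3\<close>.\<close>

definition Delta :: "(real^3) set" where
  "Delta = {X. (\<forall>k. 0 \<le> X $ k) \<and> (\<Sum>k\<in>UNIV. X $ k) = 1}"

definition int_Delta :: "(real^3) set" where
  "int_Delta = {X \<in> Delta. \<forall>k. 0 < X $ k}"

definition X0 :: "real^3" where
  "X0 = (1 / (14 + 5 * golden)) *\<^sub>R vector [5, 3 + 3 * golden, 6 + 2 * golden]"

definition transition :: "real^3 \<Rightarrow> real^vertex^vertex" where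
  "transition X = (\<chi> i j.
     if edge_in_class 1 i j then X $ 1
     else if edge_in_class 2 i j then X $ 2
     else if edge_in_class 3 i j then X $ 3
     else 0)"

definition eigenspace :: "real^'n^'n \<Rightarrow> real \<Rightarrow> (real^'n) set" where
  "eigenspace A \<mu> = {f. A *v f = \<mu> *\<^sub>R f}"

definition eigenvalues :: "real^'n^'n \<Rightarrow> real set" where
  "eigenvalues A = {\<mu>. \<exists>f. f \<noteq> 0 \<and> A *v f = \<mu> *\<^sub>R f}"

text \<open>For symmetric \<open>A\<close> with eigenvalues \<open>\<lambda>\<^sub>0 \<ge> \<lambda>\<^sub>1 \<ge> \<dots>\<close>, repeated according to multiplicity,
  this is \<open>\<lambda>\<^sub>k\<close>: the largest eigenvalue \<open>\<mu>\<close> such that more than \<open>k\<close> members of the list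
  are at least \<open>\<mu>\<close>.\<close>

definition kth_eigenvalue :: "nat \<Rightarrow> real^'n^'n \<Rightarrow> real" where
  "kth_eigenvalue k A =
     Max {\<mu> \<in> eigenvalues A. k < (\<Sum>\<nu> \<in> {\<nu> \<in> eigenvalues A. \<mu> \<le> \<nu>}. dim (eigenspace A \<nu>))}"

definition lambda1 :: "real^3 \<Rightarrow> real" where
  "lambda1 X = kth_eigenvalue 1 (transition X)"

definition spectral_representation :: "real^3 \<Rightarrow> (vertex \<Rightarrow> real^3) \<Rightarrow> bool" where
  "spectral_representation X \<Phi> \<longleftrightarrow>
     (\<exists>\<phi> :: 3 \<Rightarrow> real^vertex.
        (\<forall>k l. \<phi> k \<bullet> \<phi> l = (if k = l then 1 else 0)) \<and>
        span (range \<phi>) = eigenspace (transition X) (lambda1 X) \<and>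
        \<Phi> = (\<lambda>i. \<chi> k. \<phi> k $ i))"

definition same_length :: "(vertex \<Rightarrow> real^3) \<Rightarrow> 3 \<Rightarrow> 3 \<Rightarrow> bool" where
  "same_length \<Phi> k l \<longleftrightarrow>
     (\<forall>i j i' j'. edge_in_class k i j \<and> edge_in_class l i' j' \<longrightarrow>
        dist (\<Phi> i) (\<Phi> j) = dist (\<Phi> i') (\<Phi> j'))"

text \<open>\<open>\<Psi>\<close> need not be injective: in a limit, edges may collapse to points.  The images of the
  vertices and the non-degenerate images of the edges are exactly the vertices and edges of
  the solid.\<close>

definition realises_solid :: "nat list \<Rightarrow> (vertex \<Rightarrow> real^3) \<Rightarrow> bool" where
  "realises_solid c \<Psi> \<longleftrightarrow>
     (\<exists>S. archimedean_solid c S \<and> equilateral S \<and>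
        range \<Psi> = extreme_points S \<and>
        {closed_segment (\<Psi> i) (\<Psi> j) | i j. adjacent i j \<and> \<Psi> i \<noteq> \<Psi> j} = {e. e edge_of S})"

text \<open>A spectral representation is only defined up to an orthogonal transformation, so
  convergence means convergence of suitable representatives.\<close>

definition spectral_representations_converge_to ::
    "(nat \<Rightarrow> real^3) \<Rightarrow> (vertex \<Rightarrow> real^3) \<Rightarrow> bool" where
  "spectral_representations_converge_to X \<Psi> \<longleftrightarrow>
     (\<exists>\<Phi>. (\<forall>n. spectral_representation (X n) (\<Phi> n)) \<and> (\<forall>i. (\<lambda>n. \<Phi> n i) \<longlonglongrightarrow> \<Psi> i))"

section \<open>The curves\<close>

text \<open>For \<open>X\<close> in the interior of the simplex, the points of the spectral representation form an
  orbit of the reflection group, and the eigenvalue equation determines \<open>X\<close> from the ratios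
  \<open>a\<^sub>1 : a\<^sub>2 : a\<^sub>3\<close> of the three edge lengths: \<open>X $ k\<close> is proportional to \<open>(M *v a) $ k / a $ k\<close>,
  where \<open>M\<close> has the rows \<open>[3 - golden, golden, 2]\<close>, \<open>[golden, 3, 2 * golden]\<close>,
  \<open>[2, 2 * golden, 4]\<close> and is a multiple of the inverse of the Gram matrix of the unit normals
  of the mirrors.  The curve with index \<open>k\<close> is given by \<open>a $ k = t\<close>, the other two entries
  of \<open>a\<close> being 1.\<close>

definition curve_weights :: "3 \<Rightarrow> real \<Rightarrow> real^3" where
  "curve_weights k t =
     (if k = 1 then
        vector [3 - golden + (2 + golden) / t, 3 + 2 * golden + golden * t, 4 + 2 * golden + 2 * t]
      else if k = 2 then
        vector [5 - golden + golden * t, 3 + 3 * golden / t, 6 + 2 * golden * t]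
      else
        vector [3 + 2 * t, 3 + golden + 2 * golden * t, 4 + (2 + 2 * golden) / t])"

definition curve_param :: "3 \<Rightarrow> real \<Rightarrow> real^3" where
  "curve_param k t = (1 / (\<Sum>l\<in>UNIV. curve_weights k t $ l)) *\<^sub>R curve_weights k t"

definition Curve :: "3 \<Rightarrow> (real^3) set" where
  "Curve k = curve_param k ` {0<..}"

definition corner :: "3 \<Rightarrow> real^3" where
  "corner k = axis k 1"

definition limit_solid :: "3 \<Rightarrow> nat list" where
  "limit_solid k = (if k = 1 then [3, 10, 10] else if k = 2 then [5, 6, 6] else [3, 4, 5, 4])"

text \<open>Points of the simplex at which exactly one coordinate vanishes.\<close>

definition boundary_edge_interior :: "(real^3) set" where
  "boundary_edge_interior = {X \<in> Delta. \<exists>k. X $ k = 0 \<and> (\<forall>l. l \<noteq> k \<longrightarrow> 0 < X $ l)}"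

end

theory Submission
  imports Defs
begin

text \<open>
  Identify the vertices with the elements of the reflection group \<open>W\<close> of type \<open>H\<^sub>3\<close>, so that a walk
  along an edge of class \<open>k\<close> is right multiplication by the simple reflection \<open>s\<^sub>k\<close> and
  \<open>P\<^sub>X = \<Sum> x\<^sub>k S\<^sub>k\<close> with the involutions \<open>S\<^sub>k f (w) = f (w s\<^sub>k)\<close>.  Put \<open>p\<^sub>k = (1 - S\<^sub>k) / 2\<close>.  As
  \<open>S\<^sub>k\<close> and \<open>S\<^sub>l\<close> generate a dihedral group of order \<open>2 m\<^sub>k\<^sub>l\<close>, the inner product of \<open>p\<^sub>k f\<close> and \<open>p\<^sub>l f\<close>
  is at least \<open>- cos (\<pi> / m\<^sub>k\<^sub>l)\<close> times the product of their norms.  Hence an eigenvalue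
  \<open>1 - 2 \<delta>\<close> of \<open>P\<^sub>X\<close> other than 1 satisfies \<open>\<delta> \<ge> \<mu>\<close>, where \<open>\<mu>\<close> is the least eigenvalue of the Gram
  matrix of the simple roots weighted by \<open>X\<close>.  In the case of equality the vectors \<open>p\<^sub>k f\<close>, rescaled,
  are reflected by the \<open>S\<^sub>l\<close> exactly as simple roots, so the eigenfunctions are \<open>w \<mapsto> u \<bullet> w v\<close> with
  \<open>v = \<Sum> b\<^sub>k \<omega>\<^sub>k\<close>, for the fundamental weights \<open>\<omega>\<^sub>k\<close> and the Perron vector \<open>b\<close> that belongs to \<open>\<mu>\<close>.
  The spectral representation is thus the orbit of \<open>v\<close>, with edge lengths proportional to the
  \<open>b\<^sub>k\<close>, and in the limits some of the \<open>b\<^sub>k\<close> tend to 0 and the others become equal.  Dominance of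
  weights describes the faces of the convex hull of every orbit: they are the images under \<open>W\<close> of the
  hulls of the orbits of the parabolic subgroups.
\<close>

section \<open>Computations in the golden integers\<close>

text \<open>Four finite checks on point lists stand in for the general theory of Coxeter groups. The
  orbits of the three fundamental weights are listed over Z[golden]; the lists are closed under the
  mirrors, and every weight has its largest product with each list at the fundamental weight in it.
  Finiteness of the group, free action on the open chamber, parabolic stabilisers and the faces of
  orbit hulls follow from these inequalities, without a length function. The spectral side uses no
  characters: the Coxeter diagram is the path 1 - 3 - 2 with labels 3 and 5, so the weighted Gram
  form minus \<mu> times the norm is a sum of two squares, one per edge of the diagram. That the
  eigenspace has dimension three is an outcome of the equality case. The dihedral estimate is
  separated from the graph: it concerns two symmetric involutions whose product has finite order,
  and the order enters only through a bound for ST + TS off the fixed space of ST. In the limits,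
  all products of \<open>X $ l\<close> and \<open>b $ l\<close> stay within a fixed factor of each
  other, which forces the behaviour of \<open>b\<close> where \<open>X\<close> degenerates.\<close>

type_synonym golden_int = "int \<times> int"
type_synonym golden_point = "golden_int \<times> golden_int \<times> golden_int"

definition gval :: "golden_int \<Rightarrow> real" where
  "gval = (\<lambda>(a, b). of_int a + of_int b * golden)"

definition gplus :: "golden_int \<Rightarrow> golden_int \<Rightarrow> golden_int" where
  "gplus = (\<lambda>(a, b) (c, d). (a + c, b + d))"

definition gneg :: "golden_int \<Rightarrow> golden_int" where
  "gneg = (\<lambda>(a, b). (- a, - b))"

definition gtimes :: "golden_int \<Rightarrow> golden_int \<Rightarrow> golden_int" where
  "gtimes = (\<lambda>(a, b) (c, d). (a * c + b * d, a * d + b * c + b * d))"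

text \<open>The bounds \<open>1.618 < golden < 1.619\<close> suffice for all comparisons below.\<close>

definition gnonneg :: "golden_int \<Rightarrow> bool" where
  "gnonneg = (\<lambda>(a, b). 0 \<le> 1000 * a + 1618 * b \<and> 0 \<le> 1000 * a + 1619 * b)"

definition gless0 :: "golden_int \<Rightarrow> bool" where
  "gless0 = (\<lambda>(a, b). 1000 * a + 1618 * b < 0 \<and> 1000 * a + 1619 * b < 0)"

definition gvec :: "golden_point \<Rightarrow> real^3" where
  "gvec = (\<lambda>(p, q, r). vector [gval p, gval q, gval r])"

definition ginner :: "golden_point \<Rightarrow> golden_point \<Rightarrow> golden_int" where
  "ginner = (\<lambda>(p, q, r) (p', q', r'). gplus (gtimes p p') (gplus (gtimes q q') (gtimes r r')))"

definition gdouble :: "golden_point \<Rightarrow> golden_point" where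
  "gdouble = (\<lambda>(p, q, r). (gplus p p, gplus q q, gplus r r))"

text \<open>Roots and reflected points are doubled because simple roots have coordinates in
  \<open>\<int>[golden] / 2\<close>.\<close>

definition double_roots :: "golden_point list" where
  "double_roots = [((2, 0), (0, 0), (0, 0)), ((0, 0), (2, 0), (0, 0)), ((-1, 0), (0, -1), (-1, 1))]"

text \<open>For \<open>r\<close> twice a unit root, 2p - (r . p) r is twice the reflection of
  \<open>p\<close>, so no halves arise.\<close>

definition double_mirror :: "golden_point \<Rightarrow> golden_point \<Rightarrow> golden_point" where
  "double_mirror r p = (case (r, p, ginner r p) of ((r1, r2, r3), (p1, p2, p3), t) \<Rightarrow>
     (gplus (gplus p1 p1) (gneg (gtimes t r1)), gplus (gplus p2 p2) (gneg (gtimes t r2)),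
      gplus (gplus p3 p3) (gneg (gtimes t r3))))"

definition signs :: "golden_point \<Rightarrow> golden_point list" where
  "signs = (\<lambda>(p, q, r). [(p, q, r), (gneg p, q, r), (p, gneg q, r), (gneg p, gneg q, r),
     (p, q, gneg r), (gneg p, q, gneg r), (p, gneg q, gneg r), (gneg p, gneg q, gneg r)])"

definition rotations :: "golden_point \<Rightarrow> golden_point list" where
  "rotations = (\<lambda>(p, q, r). [(p, q, r), (q, r, p), (r, p, q)])"

definition symmetric_points :: "golden_point list \<Rightarrow> golden_point list" where
  "symmetric_points B = concat (map rotations (concat (map signs B)))"

definition mirror_closed :: "golden_point list \<Rightarrow> bool" where
  "mirror_closed L \<longleftrightarrow> list_all (\<lambda>p. list_all (\<lambda>r.
     list_ex (\<lambda>q. gdouble q = double_mirror r p) L) double_roots) L"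

text \<open>The heads are the fundamental weights; the entries of a list represent the orbit of its
  head up to sign changes and cyclic rotations. The orbits are the vertex sets of the icosahedron
  (12 points), the dodecahedron (12 + 8) and the icosidodecahedron (6 + 24).\<close>

definition weight_base :: "golden_point list list" where
  "weight_base = [[((1, 0), (0, 0), (0, 1))],
     [((0, 0), (1, 0), (1, 1)), ((0, 1), (0, 1), (0, 1))],
     [((0, 0), (0, 0), (0, 2)), ((0, 1), (1, 1), (1, 0))]]"

definition weight_points :: "golden_point list" where
  "weight_points = map hd weight_base"

text \<open>These are the points of \<open>ti_base\<close>, rewritten with 1 / golden = golden - 1
  and golden^2 = golden + 1. The head is the one that lies in the fundamental chamber.\<close>

definition ti_list :: "golden_point list" where
  "ti_list = [((-1, 1), (-1, 1), (3, 1)), ((-2, 2), (0, 1), (1, 2)), ((-1, 1), (1, 1), (-1, 3)),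
     ((-1, 2), (2, 0), (2, 1)), ((0, 1), (3, 0), (0, 2))]"

lemma mirror_closed_weights: "list_all (\<lambda>B. mirror_closed (symmetric_points B)) weight_base"
  by code_simp

text \<open>It is enough to compare the weights with each other's orbits: dominant vectors are
  nonnegative combinations of weights, and the inequality is linear in both arguments.\<close>

lemma weights_dominate: "list_all (\<lambda>B. list_all (\<lambda>p. list_all (\<lambda>u.
    gnonneg (gplus (ginner u (hd B)) (gneg (ginner u p)))) weight_points) (symmetric_points B))
    weight_base"
  by code_simp

lemma mirror_closed_ti: "mirror_closed (symmetric_points ti_list)"
  by code_simp

text \<open>A point outside the closed chamber is exposed by a simple root with negative product.
  Every orbit inside the list meets the chamber, hence contains the head, so the list is a single
  orbit.\<close>

lemma ti_dominant: "list_all (\<lambda>p. p = hd ti_list \<or> list_ex (\<lambda>r. gless0 (ginner r p)) double_roots)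
    (symmetric_points ti_list)"
  by code_simp

section \<open>Roots, weights and the reflection group\<close>

lemma golden_square: "golden * golden = golden + 1"
  unfolding golden_def by (simp add: field_simps)

lemma golden_lower: "1618 / 1000 < golden" and golden_upper: "golden < 1619 / 1000"
proof -
  have "2236 / 1000 < sqrt 5" by (rule real_less_rsqrt) (simp add: power2_eq_square)
  then show "1618 / 1000 < golden" by (simp add: golden_def)
  have "sqrt 5 < 2238 / 1000" by (rule real_less_lsqrt) (simp_all add: power2_eq_square)
  then show "golden < 1619 / 1000" by (simp add: golden_def)
qed

lemma golden_pos: "0 < golden"
  using golden_lower by linarith

lemma inverse_golden: "1 / golden = golden - 1"
  using golden_square golden_pos by (simp add: field_simps)

lemma golden_square_left: "golden * (golden * x) = golden * x + x"
  using golden_square by (simp add: mult.assoc[symmetric] distrib_right)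

lemmas golden_simps = golden_square golden_square_left

text \<open>Unit normals to the walls of one chamber: two coordinate planes and a third plane that
  meets them at the angles \<pi>/3 and \<pi>/5.\<close>

definition simple_root :: "3 \<Rightarrow> real^3" where
  "simple_root k = (if k = 1 then vector [1, 0, 0] else if k = 2 then vector [0, 1, 0]
     else vector [- 1 / 2, - golden / 2, (golden - 1) / 2])"

definition weight :: "3 \<Rightarrow> real^3" where
  "weight k = (if k = 1 then vector [1, 0, golden] else if k = 2 then vector [0, 1, golden + 1]
     else vector [0, 0, 2 * golden])"

definition gram :: "3 \<Rightarrow> 3 \<Rightarrow> real" where
  "gram k l = simple_root k \<bullet> simple_root l"

lemma inner_3: "(x :: real^3) \<bullet> y = x $ 1 * y $ 1 + x $ 2 * y $ 2 + x $ 3 * y $ 3"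
  by (simp add: inner_vec_def sum_3)

lemma distinct_indices [simp]: "(1::3) \<noteq> 2" "(1::3) \<noteq> 3" "(2::3) \<noteq> 1" "(2::3) \<noteq> 3"
  "(3::3) \<noteq> 1" "(3::3) \<noteq> 2"
  by auto

text \<open>The off-diagonal entries are - cos (\<pi> / m) with m = 2, 3, 5, where cos (\<pi> / 5) =
  golden / 2. In the Coxeter diagram node 3 is the middle one: it is joined to 1 with label 3 and to
  2 with label 5.\<close>

lemma gram_simps: "gram 1 1 = 1" "gram 2 2 = 1" "gram 3 3 = 1" "gram 1 2 = 0" "gram 2 1 = 0"
  "gram 1 3 = - 1 / 2" "gram 3 1 = - 1 / 2" "gram 2 3 = - golden / 2" "gram 3 2 = - golden / 2"
  by (simp_all add: gram_def simple_root_def inner_3 vector_3 field_simps golden_simps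
      power2_eq_square)

lemma gram_self [simp]: "gram k k = 1"
  using exhaust_3[of k] by (auto simp: gram_simps)

lemma root_weight [simp]: "simple_root k \<bullet> weight l = (if k = l then 1 else 0)"
  using exhaust_3[of k] exhaust_3[of l]
  by (auto simp: simple_root_def weight_def inner_3 vector_3 field_simps golden_simps)

lemma weight_root [simp]: "weight k \<bullet> simple_root l = (if k = l then 1 else 0)"
  by (simp add: inner_commute)

lemma root_expansion: "x = (\<Sum>k\<in>UNIV. (weight k \<bullet> x) *\<^sub>R simple_root k)"
  by (simp add: vec_eq_iff forall_3 sum_3 simple_root_def weight_def inner_3 vector_3 field_simps
      golden_simps)

lemma weight_expansion: "x = (\<Sum>k\<in>UNIV. (simple_root k \<bullet> x) *\<^sub>R weight k)"
  by (simp add: vec_eq_iff forall_3 sum_3 simple_root_def weight_def inner_3 vector_3 field_simps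
      golden_simps)

lemma inner_expansion: "x \<bullet> y = (\<Sum>k\<in>UNIV. (simple_root k \<bullet> x) * (weight k \<bullet> y))"
  by (subst weight_expansion[of x]) (simp add: inner_sum_left)

lemma inner_expansion': "x \<bullet> y = (\<Sum>k\<in>UNIV. (weight k \<bullet> x) * (simple_root k \<bullet> y))"
  by (subst inner_commute, subst inner_expansion) (simp add: mult.commute)

lemma eq_by_weights: "(\<And>k. weight k \<bullet> x = weight k \<bullet> y) \<Longrightarrow> x = y"
  using root_expansion[of x] root_expansion[of y] by simp

definition mirror :: "3 \<Rightarrow> real^3 \<Rightarrow> real^3" where
  "mirror k x = x - (2 * (simple_root k \<bullet> x)) *\<^sub>R simple_root k"

lemma root_norm [simp]: "simple_root k \<bullet> simple_root k = 1"
  by (rule gram_self[unfolded gram_def])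

lemma linear_mirror: "linear (mirror k)"
  by (rule linearI) (simp_all add: mirror_def algebra_simps inner_right_distrib)

lemma mirror_mirror [simp]: "mirror k (mirror k x) = x"
  by (simp add: mirror_def inner_diff_right)

lemma inner_mirror: "mirror k x \<bullet> mirror k y = x \<bullet> y"
  by (simp add: mirror_def inner_diff_right inner_diff_left inner_commute)

lemma mirror_root: "mirror k (simple_root l) = simple_root l - (2 * gram k l) *\<^sub>R simple_root k"
  by (simp add: mirror_def gram_def)

lemma weight_mirror: "l \<noteq> k \<Longrightarrow> weight l \<bullet> mirror k x = weight l \<bullet> x"
  by (simp add: mirror_def inner_diff_right)

lemma mirror_fixes: "simple_root k \<bullet> x = 0 \<Longrightarrow> mirror k x = x"
  by (simp add: mirror_def)

text \<open>The parabolic subgroup generated by the mirrors in \<open>J\<close>. No inverses have to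
  be adjoined, as every mirror is an involution.\<close>

inductive_set refl_group :: "3 set \<Rightarrow> (real^3 \<Rightarrow> real^3) set" for J where
  refl_id: "(\<lambda>x. x) \<in> refl_group J"
| refl_step: "w \<in> refl_group J \<Longrightarrow> k \<in> J \<Longrightarrow> (\<lambda>x. mirror k (w x)) \<in> refl_group J"

abbreviation "W \<equiv> refl_group UNIV"

lemma mirror_in_group: "k \<in> J \<Longrightarrow> mirror k \<in> refl_group J"
  using refl_step[OF refl_id, of k J] by simp

lemma group_comp:
  assumes "w \<in> refl_group J" "w' \<in> refl_group J"
  shows "(\<lambda>x. w (w' x)) \<in> refl_group J"
  using assms(1) by induction (auto intro: assms(2) refl_step)

lemma group_mono: "w \<in> refl_group J \<Longrightarrow> J \<subseteq> K \<Longrightarrow> w \<in> refl_group K"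
proof (induction rule: refl_group.induct)
  case (refl_step w k)
  then show ?case by (intro refl_group.refl_step) auto
qed (rule refl_group.refl_id)

lemma group_W: "w \<in> refl_group J \<Longrightarrow> w \<in> W"
  by (rule group_mono) auto

lemma group_linear: "w \<in> refl_group J \<Longrightarrow> linear w"
proof (induction rule: refl_group.induct)
  case (refl_step w k)
  then show ?case using linear_compose[OF refl_step.IH linear_mirror, of k] by (simp add: o_def)
qed (rule linear_ident)

lemma group_inner: "w \<in> refl_group J \<Longrightarrow> w x \<bullet> w y = x \<bullet> y"
  by (induction rule: refl_group.induct) (auto simp: inner_mirror)

lemma group_norm: "w \<in> refl_group J \<Longrightarrow> norm (w x) = norm x"
  by (simp add: norm_eq_sqrt_inner group_inner)

lemma group_inverse:
  assumes "w \<in> refl_group J"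
  shows "\<exists>w'\<in>refl_group J. (\<forall>x. w' (w x) = x) \<and> (\<forall>x. w (w' x) = x)"
  using assms
proof induction
  case refl_id
  then show ?case by (auto intro!: bexI[of _ "\<lambda>x. x"] refl_group.refl_id)
next
  case (refl_step w k)
  then obtain w' where w': "w' \<in> refl_group J" "\<forall>x. w' (w x) = x" "\<forall>x. w (w' x) = x"
    by auto
  show ?case
    using w' group_comp[OF w'(1) mirror_in_group[OF refl_step.hyps(2)]]
    by (intro bexI[of _ "\<lambda>x. w' (mirror k x)"]) auto
qed

lemma group_inj: "w \<in> refl_group J \<Longrightarrow> inj w"
  by (metis group_inverse injI)

lemma group_right_step: "w \<in> refl_group J \<Longrightarrow> k \<in> J \<Longrightarrow> (\<lambda>x. w (mirror k x)) \<in> refl_group J"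
  using group_comp[OF _ mirror_in_group] .

text \<open>The inductive definition multiplies on the left, but walking along edges of the graph
  multiplies on the right.\<close>

lemma group_right_induct [consumes 1, case_names id step]:
  assumes "w \<in> refl_group J" and "P (\<lambda>x. x)"
    and "\<And>w k. w \<in> refl_group J \<Longrightarrow> k \<in> J \<Longrightarrow> P w \<Longrightarrow> P (\<lambda>x. w (mirror k x))"
  shows "P w"
proof -
  \<comment> \<open>Generalising over a left factor \<open>u\<close> lets each left step on
    \<open>w\<close> be absorbed as a right step on \<open>u\<close>.\<close>
  have "u \<in> refl_group J \<and> P u \<longrightarrow> (\<lambda>x. u (w x)) \<in> refl_group J \<and> P (\<lambda>x. u (w x))" for u
    using assms(1)
  proof (induction arbitrary: u)
    case (refl_step w k)
    have "u \<in> refl_group J \<and> P u \<longrightarrow>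
        (\<lambda>x. u (mirror k x)) \<in> refl_group J \<and> P (\<lambda>x. u (mirror k x))"
      using assms(3)[of u k] group_right_step[of u J k] refl_step.hyps by auto
    with refl_step.IH[of "\<lambda>x. u (mirror k x)"] show ?case by auto
  qed auto
  from this[of "\<lambda>x. x"] show ?thesis using assms(2) refl_id by auto
qed

lemma weight_group: "w \<in> refl_group J \<Longrightarrow> l \<notin> J \<Longrightarrow> weight l \<bullet> w x = weight l \<bullet> x"
  by (induction rule: refl_group.induct) (simp_all, metis weight_mirror)

lemma group_fixes: "w \<in> refl_group J \<Longrightarrow> (\<And>k. k \<in> J \<Longrightarrow> simple_root k \<bullet> x = 0) \<Longrightarrow> w x = x"
  by (induction rule: refl_group.induct) (auto simp: mirror_fixes)

section \<open>Dominance\<close>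

lemma gval_simps: "gval (gplus a b) = gval a + gval b" "gval (gneg a) = - gval a"
  "gval (gtimes a b) = gval a * gval b"
  by (cases a; cases b; simp add: gval_def gplus_def gneg_def gtimes_def algebra_simps golden_simps)+

text \<open>As golden lies between 1.618 and 1.619, an affine function of it is a convex combination
  of the values at these two ends, with the weights 1619 - 1000 golden and 1000 golden - 1618. Two
  integer tests therefore certify a sign.\<close>

lemma gval_interpolate:
  "gval (a, b) = (1619 - 1000 * golden) * ((1000 * of_int a + 1618 * of_int b) / 1000)
     + (1000 * golden - 1618) * ((1000 * of_int a + 1619 * of_int b) / 1000)"
  by (simp add: gval_def field_simps)

lemma gnonneg: "gnonneg a \<Longrightarrow> 0 \<le> gval a"
proof (cases a)
  case (Pair c d)
  assume "gnonneg a"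
  then have "0 \<le> 1000 * c + 1618 * d" "0 \<le> 1000 * c + 1619 * d"
    by (simp_all add: gnonneg_def Pair)
  then have "0 \<le> (of_int (1000 * c + 1618 * d) :: real)" "0 \<le> (of_int (1000 * c + 1619 * d) :: real)"
    by (simp_all only: of_int_0_le_iff)
  then show ?thesis
    unfolding Pair gval_interpolate using golden_lower golden_upper
    by (intro add_nonneg_nonneg mult_nonneg_nonneg) auto
qed

lemma gless0: "gless0 a \<Longrightarrow> gval a < 0"
proof (cases a)
  case (Pair c d)
  assume "gless0 a"
  then have "1000 * c + 1618 * d < 0" "1000 * c + 1619 * d < 0"
    by (simp_all add: gless0_def Pair)
  then have "(of_int (1000 * c + 1618 * d) :: real) < 0" "(of_int (1000 * c + 1619 * d) :: real) < 0"
    by (simp_all only: of_int_less_0_iff)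
  then show ?thesis
    unfolding Pair gval_interpolate using golden_lower golden_upper
    by (intro add_neg_neg mult_pos_neg) auto
qed

lemma ginner: "gval (ginner p q) = gvec p \<bullet> gvec q"
  by (simp add: ginner_def gvec_def inner_3 vector_3 gval_simps case_prod_beta)

lemma gdouble: "gvec (gdouble p) = 2 *\<^sub>R gvec p"
  by (simp add: gdouble_def gvec_def gval_simps vec_eq_iff forall_3 vector_3 case_prod_beta)

lemma double_mirror: "gvec (double_mirror r p) = 2 *\<^sub>R gvec p - (gvec r \<bullet> gvec p) *\<^sub>R gvec r"
  by (simp add: double_mirror_def ginner[symmetric])
    (simp add: gvec_def gval_simps vec_eq_iff forall_3 vector_3 algebra_simps case_prod_beta)

lemma double_root: "\<exists>r\<in>set double_roots. gvec r = 2 *\<^sub>R simple_root k"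
  using exhaust_3[of k]
  by (auto simp: double_roots_def gvec_def gval_def simple_root_def vec_eq_iff forall_3 vector_3)

lemma double_root': "r \<in> set double_roots \<Longrightarrow> \<exists>k. gvec r = 2 *\<^sub>R simple_root k"
proof -
  assume "r \<in> set double_roots"
  then have "\<exists>k\<in>{1, 2, 3}. gvec r = 2 *\<^sub>R simple_root k"
    by (auto simp: double_roots_def gvec_def gval_def simple_root_def vec_eq_iff forall_3 vector_3)
  then show ?thesis by blast
qed

lemma mirror_closed:
  assumes "mirror_closed L" "x \<in> gvec ` set L"
  shows "mirror k x \<in> gvec ` set L"
proof -
  obtain p where p: "p \<in> set L" "x = gvec p" using assms(2) by auto
  obtain r where r: "r \<in> set double_roots" "gvec r = 2 *\<^sub>R simple_root k"
    using double_root by blast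
  obtain q where q: "q \<in> set L" "gdouble q = double_mirror r p"
    using assms(1) p(1) r(1) by (fastforce simp: mirror_closed_def list_all_iff list_ex_iff)
  have "2 *\<^sub>R gvec q = 2 *\<^sub>R mirror k x"
    using arg_cong[OF q(2), of gvec] by (simp add: gdouble double_mirror r p mirror_def algebra_simps)
  then have "mirror k x = gvec q" by simp
  then show ?thesis using q(1) by blast
qed

lemma group_closed:
  assumes "w \<in> refl_group J" "mirror_closed L" "x \<in> gvec ` set L"
  shows "w x \<in> gvec ` set L"
  using assms by induction (simp_all add: mirror_closed)

lemma hd_symmetric_points: "B \<noteq> [] \<Longrightarrow> hd B \<in> set (symmetric_points B)"
proof (cases B)
  case (Cons p C)
  have "p \<in> set (rotations p)" "p \<in> set (signs p)"
    by (cases p rule: prod_cases3; simp add: rotations_def signs_def)+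
  then show ?thesis by (auto simp: symmetric_points_def Cons)
qed simp

lemma weight_base_ex:
  "\<exists>B\<in>set weight_base. hd B \<in> set weight_points \<and> B \<noteq> [] \<and> weight k = gvec (hd B)"
  using exhaust_3[of k]
  by (auto simp: weight_base_def weight_points_def gvec_def gval_def weight_def vec_eq_iff forall_3
      vector_3)

lemma weight_orbit:
  obtains L where "finite (gvec ` set L)" "\<And>w. w \<in> W \<Longrightarrow> w (weight k) \<in> gvec ` set L"
    "\<And>w l. w \<in> W \<Longrightarrow> weight l \<bullet> w (weight k) \<le> weight l \<bullet> weight k"
proof -
  obtain B where B: "B \<in> set weight_base" "B \<noteq> []" "weight k = gvec (hd B)"
    using weight_base_ex by blast
  let ?L = "symmetric_points B"
  have orb: "w (weight k) \<in> gvec ` set ?L" if "w \<in> W" for w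
    using group_closed[OF that, of ?L] mirror_closed_weights B hd_symmetric_points[of B]
    by (auto simp: list_all_iff)
  have "weight l \<bullet> w (weight k) \<le> weight l \<bullet> weight k" if w: "w \<in> W" for w l
  proof -
    obtain p where p: "p \<in> set ?L" "w (weight k) = gvec p" using orb[OF w] by auto
    obtain u where u: "u \<in> set weight_points" "weight l = gvec u"
      using weight_base_ex by blast
    have "gnonneg (gplus (ginner u (hd B)) (gneg (ginner u p)))"
      using weights_dominate B(1) p(1) u(1) by (auto simp: list_all_iff)
    from gnonneg[OF this] have "weight l \<bullet> gvec p \<le> weight l \<bullet> weight k"
      by (simp add: gval_simps ginner u B)
    then show ?thesis by (simp add: p)
  qed
  then show ?thesis using that[of ?L] orb by auto
qed

lemma weight_dominates: "w \<in> W \<Longrightarrow> weight l \<bullet> w (weight k) \<le> weight l \<bullet> weight k"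
  using weight_orbit by metis

lemma group_eqI:
  assumes "w \<in> refl_group J" "w' \<in> refl_group K" "\<And>k. w (weight k) = w' (weight k)"
  shows "w = w'"
proof
  fix x
  note lin = group_linear[OF assms(1)] group_linear[OF assms(2)]
  have "w x = w (\<Sum>k\<in>UNIV. (simple_root k \<bullet> x) *\<^sub>R weight k)"
    using weight_expansion[of x] by simp
  also have "\<dots> = w' (\<Sum>k\<in>UNIV. (simple_root k \<bullet> x) *\<^sub>R weight k)"
    by (simp add: linear_sum[OF lin(1)] linear_sum[OF lin(2)] linear_cmul[OF lin(1)]
        linear_cmul[OF lin(2)] assms(3))
  finally show "w x = w' x" using weight_expansion[of x] by simp
qed

text \<open>A linear map is known from the images of the three fundamental weights, and each of
  these images lies in a finite list.\<close>

lemma finite_W: "finite W"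
proof -
  have "\<exists>S. finite S \<and> (\<forall>w\<in>W. w (weight k) \<in> S)" for k
    using weight_orbit[of k] by metis
  then obtain S where S: "\<And>k. finite (S k)" "\<And>k w. w \<in> W \<Longrightarrow> w (weight k) \<in> S k" by metis
  have "inj_on (\<lambda>w. (w (weight 1), w (weight 2), w (weight 3))) W"
  proof (rule inj_onI)
    fix w w' assume "w \<in> W" "w' \<in> W"
      and eq: "(w (weight 1), w (weight 2), w (weight 3)) = (w' (weight 1), w' (weight 2), w' (weight 3))"
    then show "w = w'"
      using exhaust_3 by (intro group_eqI) (auto, metis)
  qed
  moreover have "(\<lambda>w. (w (weight 1), w (weight 2), w (weight 3))) ` W \<subseteq> S 1 \<times> S 2 \<times> S 3"
    using S(2) by auto
  ultimately show ?thesis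
    using S(1) by (meson finite_SigmaI finite_subset inj_on_finite)
qed

lemma finite_group: "finite (refl_group J)"
  using finite_W group_W by (meson finite_subset subsetI)

section \<open>Dominant vectors and their orbits\<close>

definition dominant :: "real^3 \<Rightarrow> bool" where
  "dominant v \<longleftrightarrow> (\<forall>k. 0 \<le> simple_root k \<bullet> v)"

definition orbit :: "3 set \<Rightarrow> real^3 \<Rightarrow> (real^3) set" where
  "orbit J v = (\<lambda>w. w v) ` refl_group J"

lemma finite_orbit: "finite (orbit J v)"
  by (simp add: orbit_def finite_group)

lemma orbit_self: "v \<in> orbit J v"
  unfolding orbit_def using refl_id by force

lemma orbit_norm: "x \<in> orbit J v \<Longrightarrow> norm x = norm v"
  by (auto simp: orbit_def group_norm)

lemma orbit_mono: "J \<subseteq> K \<Longrightarrow> orbit J v \<subseteq> orbit K v"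
  using group_mono unfolding orbit_def by blast

lemma group_orbit: "w \<in> refl_group J \<Longrightarrow> w ` orbit J v = orbit J v"
proof -
  have sub: "w ` orbit J v \<subseteq> orbit J v" if "w \<in> refl_group J" for w
    using group_comp[OF that] by (fastforce simp: orbit_def)
  assume w: "w \<in> refl_group J"
  obtain w' where w': "w' \<in> refl_group J" "\<forall>x. w' (w x) = x" "\<forall>x. w (w' x) = x"
    using group_inverse[OF w] by blast
  have "orbit J v = w ` w' ` orbit J v" by (simp add: image_image w')
  also have "\<dots> \<subseteq> w ` orbit J v" using sub[OF w'(1)] by blast
  finally show ?thesis using sub[OF w] by blast
qed

lemma dominant_inner_weight: "dominant v \<Longrightarrow> w \<in> W \<Longrightarrow> weight l \<bullet> w v \<le> weight l \<bullet> v"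
proof -
  assume v: "dominant v" and w: "w \<in> W"
  have "weight l \<bullet> w v = weight l \<bullet> w (\<Sum>k\<in>UNIV. (simple_root k \<bullet> v) *\<^sub>R weight k)"
    using weight_expansion[of v] by simp
  also have "\<dots> = (\<Sum>k\<in>UNIV. (simple_root k \<bullet> v) * (weight l \<bullet> w (weight k)))"
    by (simp add: linear_sum[OF group_linear[OF w]] linear_cmul[OF group_linear[OF w]] inner_sum_right)
  also have "\<dots> \<le> (\<Sum>k\<in>UNIV. (simple_root k \<bullet> v) * (weight l \<bullet> weight k))"
    using v w by (intro sum_mono mult_left_mono weight_dominates) (auto simp: dominant_def)
  also have "\<dots> = weight l \<bullet> v"
    by (subst (2) weight_expansion[of v]) (simp add: inner_sum_right)
  finally show ?thesis .
qed

lemma dominant_inner_le: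
  assumes "dominant u" "dominant v" "w \<in> W"
  shows "u \<bullet> w v \<le> u \<bullet> v"
  unfolding inner_expansion[of u]
  using assms by (intro sum_mono mult_left_mono dominant_inner_weight) (auto simp: dominant_def)

text \<open>Among the finitely many images of \<open>x\<close>, take one with the largest product
  with \<rho>, which has product 1 with every simple root. A negative product with root
  \<open>k\<close> could be improved by mirror \<open>k\<close>.\<close>

lemma exists_dominant: "\<exists>w\<in>refl_group J. \<forall>k\<in>J. 0 \<le> simple_root k \<bullet> w x"
proof -
  define \<rho> where "\<rho> = (\<Sum>k\<in>UNIV. weight k)"
  have \<rho>: "simple_root k \<bullet> \<rho> = 1" for k
    by (simp add: \<rho>_def inner_sum_right)
  have ne: "refl_group J \<noteq> {}" by (metis empty_iff refl_id)
  define f where "f w = w x \<bullet> \<rho>" for w :: "real^3 \<Rightarrow> real^3"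
  have fin: "finite (f ` refl_group J)" by (simp add: finite_group)
  then have "Max (f ` refl_group J) \<in> f ` refl_group J" using ne by (intro Max_in) auto
  then obtain w where w: "w \<in> refl_group J" "f w = Max (f ` refl_group J)" by auto
  have max: "w' x \<bullet> \<rho> \<le> w x \<bullet> \<rho>" if "w' \<in> refl_group J" for w'
    using Max_ge[OF fin imageI[OF that]] w(2) by (simp add: f_def)
  have "0 \<le> simple_root k \<bullet> w x" if "k \<in> J" for k
    using max[OF refl_step[OF w(1) that]] by (simp add: mirror_def inner_diff_left \<rho>)
  then show ?thesis using w(1) by blast
qed

text \<open>This governs all faces: an orbit point of \<open>v\<close> on the supporting hyperplane
  with normal \<open>u\<close> is reached from \<open>v\<close> by the mirrors that contain
  \<open>u\<close>. The point is first moved by those mirrors to a \<open>z\<close> that is dominant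
  for them; then \<open>z\<close> is shown to equal \<open>v\<close>.\<close>

lemma dominant_inner_eq:
  assumes u: "dominant u" and v: "dominant v" and w: "w \<in> W" and eq: "u \<bullet> w v = u \<bullet> v"
  shows "w v \<in> orbit {k. simple_root k \<bullet> u = 0} v"
proof -
  define J where "J = {k. simple_root k \<bullet> u = 0}"
  obtain h where h: "h \<in> refl_group J" "\<forall>k\<in>J. 0 \<le> simple_root k \<bullet> h (w v)"
    using exists_dominant[of J "w v"] by blast
  define z where "z = h (w v)"
  have hw: "(\<lambda>x. h (w x)) \<in> W" using group_comp[OF group_W[OF h(1)] w] .
  have c: "0 \<le> weight k \<bullet> (v - z)" for k
    using dominant_inner_weight[OF v hw] by (simp add: z_def inner_diff_right)
  have "u \<bullet> z = u \<bullet> w v"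
    using weight_group[OF h(1)] unfolding z_def inner_expansion[of u]
    by (intro sum.cong refl) (auto simp: J_def)
  then have "(\<Sum>k\<in>UNIV. (simple_root k \<bullet> u) * (weight k \<bullet> (v - z))) = 0"
    unfolding inner_expansion[symmetric] using eq by (simp add: inner_diff_right)
  \<comment> \<open>All terms are nonnegative by dominance, so v - z has no component along the
    roots outside \<open>J\<close>.\<close>
  then have prod0: "(simple_root k \<bullet> u) * (weight k \<bullet> (v - z)) = 0" for k
    using u c by (subst (asm) sum_nonneg_eq_0_iff) (auto simp: dominant_def)
  have out: "weight k \<bullet> (v - z) = 0" if "k \<notin> J" for k
    using that prod0[of k] by (simp add: J_def)
  \<comment> \<open>Equal norms make v - z orthogonal to v + z. Expanded in roots this is again a
    sum of nonnegative terms, so wherever v - z has a component along root \<open>k\<close>, both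
    \<open>v\<close> and \<open>z\<close> lie on mirror \<open>k\<close>.\<close>
  have "(v - z) \<bullet> (v + z) = v \<bullet> v - z \<bullet> z"
    by (simp add: inner_diff_left inner_add_right inner_commute[of z v])
  then have "(v - z) \<bullet> (v + z) = 0" using group_inner[OF hw, of v v] by (simp add: z_def)
  then have "(\<Sum>k\<in>UNIV. (weight k \<bullet> (v - z)) * (simple_root k \<bullet> (v + z))) = 0"
    by (simp only: inner_expansion'[symmetric])
  moreover have nn: "0 \<le> (weight k \<bullet> (v - z)) * (simple_root k \<bullet> (v + z))" for k
    using out[of k] c[of k] h(2) v
    by (cases "k \<in> J") (auto simp: inner_add_right dominant_def z_def)
  ultimately have prod0: "(weight k \<bullet> (v - z)) * (simple_root k \<bullet> (v + z)) = 0" for k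
    by (subst (asm) sum_nonneg_eq_0_iff) auto
  have "(weight k \<bullet> (v - z)) * (simple_root k \<bullet> (v - z)) = 0" for k
  proof (cases "k \<in> J \<and> simple_root k \<bullet> (v + z) = 0")
    case True
    moreover have "0 \<le> simple_root k \<bullet> v" "0 \<le> simple_root k \<bullet> z"
      using v h(2) True by (auto simp: dominant_def z_def)
    ultimately show ?thesis by (simp add: inner_add_right inner_diff_right)
  next
    case False
    then show ?thesis using out[of k] prod0[of k] by auto
  qed
  then have "(v - z) \<bullet> (v - z) = 0"
    by (subst inner_expansion') (simp add: sum.neutral)
  then have "z = v" by simp
  obtain h' where "h' \<in> refl_group J" "\<forall>x. h' (h x) = x" "\<forall>x. h (h' x) = x"
    using group_inverse[OF h(1)] by blast
  then have "w v = h' v" "h' \<in> refl_group J" using \<open>z = v\<close> by (metis z_def)+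
  then show ?thesis by (auto simp: orbit_def J_def)
qed

text \<open>If an element fixes \<open>v\<close>, then \<open>v\<close> has equal products with each
  weight and its image. With strictly positive coefficients, every dominance inequality between
  weights in this comparison is sharp, so all weights are fixed.\<close>

lemma strictly_dominant_inj:
  assumes v: "\<And>k. 0 < simple_root k \<bullet> v" and w: "w \<in> W" "w' \<in> W" and eq: "w v = w' v"
  shows "w = w'"
proof -
  obtain h where h: "h \<in> W" "\<forall>x. h (w' x) = x" "\<forall>x. w' (h x) = x"
    using group_inverse[OF w(2)] by blast
  have hw: "(\<lambda>x. h (w x)) \<in> W" using group_comp[OF h(1) w(1)] .
  have dv: "dominant v" using v by (simp add: dominant_def less_imp_le)
  have "h (w (weight k)) = weight k" for k
  proof -
    have fixed: "h (w v) = v" by (simp add: eq h)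
    have "weight k \<bullet> v = h (w (weight k)) \<bullet> v"
      using group_inner[OF hw, of "weight k" v] by (simp add: fixed)
    also have "\<dots> = (\<Sum>l\<in>UNIV. (simple_root l \<bullet> v) * (weight l \<bullet> h (w (weight k))))"
      by (subst inner_commute, subst inner_expansion) simp
    finally have "(\<Sum>l\<in>UNIV. (simple_root l \<bullet> v) * (weight l \<bullet> weight k - weight l \<bullet> h (w (weight k)))) = 0"
      by (subst (asm) inner_commute, subst (asm) inner_expansion)
        (simp add: sum_subtractf algebra_simps)
    then have prod0: "(simple_root l \<bullet> v) * (weight l \<bullet> weight k - weight l \<bullet> h (w (weight k))) = 0" for l
      using v weight_dominates[OF hw]
      by (subst (asm) sum_nonneg_eq_0_iff) (auto intro!: mult_nonneg_nonneg simp: less_imp_le)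
    have "weight l \<bullet> h (w (weight k)) = weight l \<bullet> weight k" for l
      using v[of l] prod0[of l] by auto
    then show ?thesis by (rule eq_by_weights)
  qed
  then have "w (weight k) = w' (weight k)" for k using h(3) by metis
  then show ?thesis by (rule group_eqI[OF w])
qed

text \<open>The product of \<open>v\<close> with \<rho> is unchanged when \<open>w\<close> is
  applied to \<rho>, so the equality case of dominance places that image in the parabolic orbit of
  \<rho>. Since \<rho> is strictly dominant, this identifies \<open>w\<close> itself.\<close>

lemma stabilizer:
  assumes v: "dominant v" and w: "w \<in> W" and fixed: "w v = v"
  shows "w \<in> refl_group {k. simple_root k \<bullet> v = 0}"
proof -
  define \<rho> where "\<rho> = (\<Sum>k\<in>UNIV. weight k)"
  have \<rho>: "simple_root k \<bullet> \<rho> = 1" for k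
    by (simp add: \<rho>_def inner_sum_right)
  have "v \<bullet> w \<rho> = v \<bullet> \<rho>" using group_inner[OF w, of v \<rho>] fixed by simp
  then have "w \<rho> \<in> orbit {k. simple_root k \<bullet> v = 0} \<rho>"
    by (intro dominant_inner_eq v w) (auto simp: dominant_def \<rho>)
  then obtain h where h: "h \<in> refl_group {k. simple_root k \<bullet> v = 0}" "w \<rho> = h \<rho>"
    by (auto simp: orbit_def)
  have "w = h"
    by (rule strictly_dominant_inj[OF _ w group_W[OF h(1)] h(2)]) (simp add: \<rho>)
  then show ?thesis using h(1) by simp
qed

section \<open>The vertices of the truncated icosidodecahedron as one orbit\<close>

definition ti_vertex :: "real^3" where
  "ti_vertex = vector [golden - 1, golden - 1, 3 + golden]"

lemma root_ti_vertex: "simple_root k \<bullet> ti_vertex = golden - 1"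
  using exhaust_3[of k]
  by (auto simp: simple_root_def ti_vertex_def inner_3 vector_3 field_simps golden_simps)

lemma union_signs:
  "(\<Union>r\<in>{-1, 1::real}. \<Union>s\<in>{-1, 1::real}. \<Union>t\<in>{-1, 1::real}. g r s t) =
    g 1 1 1 \<union> g (-1) 1 1 \<union> g 1 (-1) 1 \<union> g (-1) (-1) 1 \<union>
    g 1 1 (-1) \<union> g (-1) 1 (-1) \<union> g 1 (-1) (-1) \<union> g (-1) (-1) (-1)"
  by auto

lemma ti_points_list: "ti_points = gvec ` set (symmetric_points ti_list)"
proof -
  have "1 / golden = golden - 1" "2 / golden = 2 * golden - 2" "golden ^ 2 = golden + 1"
    using inverse_golden golden_square golden_pos by (simp_all add: power2_eq_square field_simps)
  then have base: "ti_base = (\<lambda>(p, q, r). (gval p, gval q, gval r)) ` set ti_list"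
    unfolding ti_base_def \<open>1 / golden = golden - 1\<close> \<open>2 / golden = 2 * golden - 2\<close> \<open>golden ^ 2 = golden + 1\<close>
    by (simp add: ti_list_def gval_def algebra_simps)
  have "(\<Union>r \<in> {-1, 1}. \<Union>s \<in> {-1, 1}. \<Union>t \<in> {-1, 1}. {vector [r * gval p, s * gval q, t * gval r'],
      vector [s * gval q, t * gval r', r * gval p], vector [t * gval r', r * gval p, s * gval q] :: real^3})
     = gvec ` set (concat (map rotations (signs (p, q, r'))))" for p q r'
    by (subst union_signs) (simp add: signs_def rotations_def gvec_def gval_simps Un_assoc del: Un_insert_right)
  moreover have "gvec ` set (symmetric_points ti_list) =
      (\<Union>p\<in>set ti_list. gvec ` set (concat (map rotations (signs p))))"
    by (auto simp: symmetric_points_def)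
  ultimately show ?thesis
    unfolding ti_points_def base by (simp only: image_UN UN_simps case_prod_beta fst_conv snd_conv prod.collapse)
qed

lemma ti_points_orbit: "ti_points = orbit UNIV ti_vertex"
proof -
  let ?L = "symmetric_points ti_list"
  have hd: "gvec (hd ti_list) = ti_vertex"
    by (simp add: ti_list_def gvec_def gval_def ti_vertex_def vec_eq_iff forall_3 vector_3)
  have "ti_vertex \<in> gvec ` set ?L"
    using hd_symmetric_points[of ti_list] hd by (force simp: ti_list_def)
  then have "orbit UNIV ti_vertex \<subseteq> gvec ` set ?L"
    using group_closed[OF _ mirror_closed_ti] by (auto simp: orbit_def)
  moreover have "gvec ` set ?L \<subseteq> orbit UNIV ti_vertex"
  proof
    fix x assume x: "x \<in> gvec ` set ?L"
    obtain w where w: "w \<in> W" "\<forall>k. 0 \<le> simple_root k \<bullet> w x"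
      using exists_dominant[of UNIV x] by blast
    obtain p where p: "p \<in> set ?L" "w x = gvec p"
      using group_closed[OF w(1) mirror_closed_ti x] by auto
    have "\<not> gless0 (ginner r p)" if r: "r \<in> set double_roots" for r
    proof -
      obtain k where "gvec r = 2 *\<^sub>R simple_root k" using double_root'[OF r] by blast
      then have "gval (ginner r p) = 2 * (simple_root k \<bullet> w x)" by (simp add: ginner p)
      then show ?thesis using gless0[of "ginner r p"] w(2)[rule_format, of k] by auto
    qed
    then have "p = hd ti_list"
      using ti_dominant p(1) by (auto simp: list_all_iff list_ex_iff)
    then have "w x = ti_vertex" using p hd by simp
    moreover obtain w' where w': "w' \<in> W" "\<forall>x. w' (w x) = x" "\<forall>x. w (w' x) = x"
    using group_inverse[OF w(1)] by blast
    ultimately have "x = w' ti_vertex" by metis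
    then show "x \<in> orbit UNIV ti_vertex" unfolding orbit_def using w'(1) by blast
  qed
  ultimately show ?thesis by (simp add: ti_points_list)
qed

section \<open>Faces of orbit polytopes\<close>

definition orbit_poly :: "3 set \<Rightarrow> real^3 \<Rightarrow> (real^3) set" where
  "orbit_poly J v = convex hull (orbit J v)"

lemma orbit_empty [simp]: "orbit {} v = {v}"
proof -
  have "w v = v" if "w \<in> refl_group {}" for w
    using that by (rule group_fixes) simp
  then show ?thesis using orbit_self by (auto simp: orbit_def)
qed

lemma orbit_poly_empty [simp]: "orbit_poly {} v = {v}"
  by (simp add: orbit_poly_def)

lemma orbit_mirror: "x \<in> orbit J v \<Longrightarrow> k \<in> J \<Longrightarrow> mirror k x \<in> orbit J v"
  using group_orbit[OF mirror_in_group] by blast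

lemma orbitE [consumes 1, case_names self mirror]:
  assumes "x \<in> orbit J v" "P v" "\<And>x k. x \<in> orbit J v \<Longrightarrow> k \<in> J \<Longrightarrow> P x \<Longrightarrow> P (mirror k x)"
  shows "P x"
proof -
  have "w v \<in> orbit J v \<and> P (w v)" if "w \<in> refl_group J" for w
    using that by induction (use assms(2,3) orbit_self orbit_mirror in auto)
  then show ?thesis using assms(1) by (auto simp: orbit_def)
qed

lemma orbit_poly_self: "v \<in> orbit_poly J v"
  by (simp add: orbit_poly_def hull_inc orbit_self)

lemma orbit_subset_poly: "orbit J v \<subseteq> orbit_poly J v"
  by (simp add: orbit_poly_def hull_subset)

lemma orbit_poly_mono: "J \<subseteq> K \<Longrightarrow> orbit_poly J v \<subseteq> orbit_poly K v"
  by (simp add: orbit_poly_def hull_mono orbit_mono)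

lemma group_orbit_poly: "w \<in> refl_group J \<Longrightarrow> w ` orbit_poly J v = orbit_poly J v"
  unfolding orbit_poly_def using convex_hull_linear_image[OF group_linear, of w J "orbit J v"]
  by (simp add: group_orbit)

lemma polytope_orbit_poly: "polytope (orbit_poly J v)"
  by (simp add: orbit_poly_def polytope_convex_hull finite_orbit)

lemma convex_orbit_poly: "convex (orbit_poly J v)"
  by (simp add: orbit_poly_def)

lemma hull_supporting:
  fixes S :: "'a::euclidean_space set"
  assumes "finite S" "\<And>x. x \<in> S \<Longrightarrow> u \<bullet> x \<le> b"
  shows "convex hull S \<inter> {x. u \<bullet> x = b} = convex hull (S \<inter> {x. u \<bullet> x = b})"
    and "(convex hull S \<inter> {x. u \<bullet> x = b}) face_of (convex hull S)"
proof -
  have "convex hull S \<subseteq> {x. u \<bullet> x \<le> b}"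
    using assms(2) by (intro hull_minimal) (auto simp: convex_halfspace_le)
  then show face: "(convex hull S \<inter> {x. u \<bullet> x = b}) face_of (convex hull S)"
    by (intro face_of_Int_supporting_hyperplane_le) auto
  from face_of_convex_hull_subset[OF finite_imp_compact[OF assms(1)] face]
  obtain T where T: "T \<subseteq> S" "convex hull S \<inter> {x. u \<bullet> x = b} = convex hull T" by metis
  then have "T \<subseteq> {x. u \<bullet> x = b}" using hull_subset[of T convex] by auto
  then have "convex hull T \<subseteq> convex hull (S \<inter> {x. u \<bullet> x = b})"
    using T(1) by (intro hull_mono) auto
  moreover have "convex hull (S \<inter> {x. u \<bullet> x = b}) \<subseteq> {x. u \<bullet> x = b}"
    by (intro hull_minimal) (auto simp: convex_hyperplane)
  moreover have "convex hull (S \<inter> {x. u \<bullet> x = b}) \<subseteq> convex hull S"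
    by (intro hull_mono) auto
  ultimately show "convex hull S \<inter> {x. u \<bullet> x = b} = convex hull (S \<inter> {x. u \<bullet> x = b})"
    using T(2) by blast
qed

lemma orbit_supporting:
  assumes "dominant u" "dominant v"
  shows "orbit UNIV v \<inter> {x. u \<bullet> x = u \<bullet> v} = orbit {k. simple_root k \<bullet> u = 0} v" (is "?L = orbit ?J v")
proof
  show "?L \<subseteq> orbit ?J v"
  proof
    fix x assume x: "x \<in> ?L"
    then obtain w where "w \<in> W" "x = w v" by (auto simp: orbit_def)
    then show "x \<in> orbit ?J v" using dominant_inner_eq[OF assms, of w] x by auto
  qed
  show "orbit ?J v \<subseteq> ?L"
  proof
    fix x assume x: "x \<in> orbit ?J v"
    then obtain w where w: "w \<in> refl_group ?J" "x = w v" by (auto simp: orbit_def)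
    have "w u = u" using group_fixes[OF w(1)] by auto
    then have "u \<bullet> x = u \<bullet> v" using group_inner[OF w(1), of u v] w(2) by simp
    then show "x \<in> ?L" using x orbit_mono[of ?J UNIV v] by auto
  qed
qed

lemma orbit_poly_supporting:
  assumes "dominant u" "dominant v"
  shows "orbit_poly UNIV v \<inter> {x. u \<bullet> x = u \<bullet> v} = orbit_poly {k. simple_root k \<bullet> u = 0} v"
    and "orbit_poly {k. simple_root k \<bullet> u = 0} v face_of orbit_poly UNIV v"
proof -
  have le: "u \<bullet> x \<le> u \<bullet> v" if "x \<in> orbit UNIV v" for x
    using that dominant_inner_le[OF assms] by (auto simp: orbit_def)
  note h = hull_supporting[OF finite_orbit[of UNIV v] le]
  show eq: "orbit_poly UNIV v \<inter> {x. u \<bullet> x = u \<bullet> v} = orbit_poly {k. simple_root k \<bullet> u = 0} v"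
    unfolding orbit_poly_def using h(1) orbit_supporting[OF assms] by simp
  show "orbit_poly {k. simple_root k \<bullet> u = 0} v face_of orbit_poly UNIV v"
    unfolding eq[symmetric] using h(2) by (simp add: orbit_poly_def)
qed

lemma root_weight_sum: "simple_root k \<bullet> (\<Sum>l\<in>K. weight l) = (if k \<in> K then 1 else 0)"
  by (simp add: inner_sum_right)

text \<open>The sum of the weights with index outside \<open>J\<close> is dominant and orthogonal to
  exactly the roots in \<open>J\<close>, so it exposes this face.\<close>

lemma orbit_poly_face: "dominant v \<Longrightarrow> orbit_poly J v face_of orbit_poly UNIV v"
proof -
  assume v: "dominant v"
  have "{k. simple_root k \<bullet> (\<Sum>l\<in>-J. weight l) = 0} = J"
    by (auto simp: root_weight_sum)
  then show ?thesis
    using orbit_poly_supporting(2)[of "\<Sum>l\<in>-J. weight l" v] v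
    by (simp add: dominant_def root_weight_sum)
qed

lemma facet_hyperplane:
  "dominant v \<Longrightarrow> orbit_poly UNIV v \<inter> {x. weight l \<bullet> x = weight l \<bullet> v} = orbit_poly (-{l}) v"
  using orbit_poly_supporting(1)[of "weight l" v]
  by (auto simp: dominant_def Compl_eq)

lemma face_image:
  assumes "w \<in> W" "F face_of orbit_poly UNIV v"
  shows "w ` F face_of orbit_poly UNIV v"
  using face_of_linear_image[OF group_linear[OF assms(1)] group_inj[OF assms(1)], of F "orbit_poly UNIV v"]
    assms(2) by (simp add: group_orbit_poly[OF assms(1)])

lemma aff_dim_image:
  assumes "w \<in> W"
  shows "aff_dim (w ` F) = aff_dim F"
  using group_linear[OF assms] group_inj[OF assms] by (rule aff_dim_injective_linear_image)

text \<open>Faces of a polytope are exposed. An element of the group moves the exposing normal into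
  the chamber, where the face is parabolic.\<close>

lemma face_cases:
  assumes v: "dominant v" and F: "F face_of orbit_poly UNIV v" "F \<noteq> {}"
  shows "\<exists>w\<in>W. \<exists>J. F = w ` orbit_poly J v"
proof -
  let ?P = "orbit_poly UNIV v"
  have "F exposed_face_of ?P"
    using F(1) polytope_orbit_poly by (simp add: exposed_face_of_polyhedron polytope_imp_polyhedron)
  then obtain a b where ab: "?P \<subseteq> {x. a \<bullet> x \<le> b}" "F = ?P \<inter> {x. a \<bullet> x = b}"
    by (auto simp: exposed_face_of_def)
  obtain w where w: "w \<in> W" "\<forall>k. 0 \<le> simple_root k \<bullet> w a"
    using exists_dominant[of UNIV a] by blast
  obtain w' where w': "w' \<in> W" "\<forall>x. w' (w x) = x" "\<forall>x. w (w' x) = x"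
    using group_inverse[OF w(1)] by blast
  have dom: "dominant (w a)" using w(2) by (simp add: dominant_def)
  have inner: "w a \<bullet> w x = a \<bullet> x" for x by (rule group_inner[OF w(1)])
  have wP: "w ` ?P = ?P" "w' ` ?P = ?P"
    using group_orbit_poly w(1) w'(1) by blast+
  have "w' v \<in> ?P" using wP(2) orbit_poly_self by blast
  then have le: "w a \<bullet> v \<le> b" using ab(1) inner[of "w' v"] w'(3) by auto
  obtain x where x: "x \<in> ?P" "a \<bullet> x = b" using F(2) ab(2) by auto
  have "?P \<subseteq> {y. w a \<bullet> y \<le> w a \<bullet> v}"
    unfolding orbit_poly_def using dominant_inner_le[OF dom v]
    by (intro hull_minimal) (auto simp: orbit_def convex_halfspace_le)
  moreover have "w x \<in> ?P" using x(1) wP(1) by blast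
  ultimately have "b \<le> w a \<bullet> v" using x(2) inner[of x] by auto
  with le have b: "b = w a \<bullet> v" by simp
  have "w ` F = ?P \<inter> {y. w a \<bullet> y = w a \<bullet> v}"
  proof (intro equalityI subsetI)
    fix y assume "y \<in> w ` F"
    then show "y \<in> ?P \<inter> {y. w a \<bullet> y = w a \<bullet> v}" using ab(2) inner b wP(1) by auto
  next
    fix y assume y: "y \<in> ?P \<inter> {y. w a \<bullet> y = w a \<bullet> v}"
    then have "w' y \<in> ?P" using wP(2) by auto
    moreover have "a \<bullet> w' y = b" using inner[of "w' y"] w'(3) y b by auto
    ultimately have "w' y \<in> F" using ab(2) by auto
    then show "y \<in> w ` F" using w'(3) by (metis imageI)
  qed
  then have eq: "w ` F = orbit_poly {k. simple_root k \<bullet> w a = 0} v"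
    using orbit_poly_supporting(1)[OF dom v] by simp
  have "F = w' ` w ` F" using w'(2) by (simp add: image_image)
  then have "F = w' ` orbit_poly {k. simple_root k \<bullet> w a = 0} v" by (simp only: eq)
  with w'(1) show ?thesis by (intro bexI exI)
qed

lemma extreme_orbit:
  assumes "dominant v" "x \<in> orbit UNIV v"
  shows "x extreme_point_of orbit_poly UNIV v"
proof -
  obtain w where w: "w \<in> W" "x = w v" using assms(2) by (auto simp: orbit_def)
  have "w ` orbit_poly {} v face_of orbit_poly UNIV v"
    by (rule face_image[OF w(1) orbit_poly_face[OF assms(1)]])
  then show ?thesis by (simp add: w(2) face_of_singleton)
qed

lemma extreme_points_image:
  assumes v: "dominant v" and w: "w \<in> W"
  shows "extreme_points (w ` orbit_poly J v) = w ` orbit J v"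
proof -
  have hull: "w ` orbit_poly J v = convex hull (w ` orbit J v)"
    by (simp add: orbit_poly_def convex_hull_linear_image group_linear[OF w])
  have face: "w ` orbit_poly J v face_of orbit_poly UNIV v"
    by (rule face_image[OF w orbit_poly_face[OF v]])
  have sub: "w ` orbit J v \<subseteq> orbit UNIV v"
    using group_orbit[OF w, of v] orbit_mono[of J UNIV v] by blast
  show ?thesis
  proof (intro equalityI subsetI)
    fix x assume "x \<in> extreme_points (w ` orbit_poly J v)"
    then show "x \<in> w ` orbit J v"
      unfolding extreme_points_def hull using extreme_point_of_convex_hull by blast
  next
    fix x assume x: "x \<in> w ` orbit J v"
    then have "x extreme_point_of orbit_poly UNIV v" using extreme_orbit[OF v] sub by blast
    moreover have "x \<in> w ` orbit_poly J v" using x orbit_subset_poly by blast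
    ultimately show "x \<in> extreme_points (w ` orbit_poly J v)"
      using extreme_point_of_face[OF face] by (simp add: extreme_points_def)
  qed
qed

lemma extreme_points_orbit_poly: "dominant v \<Longrightarrow> extreme_points (orbit_poly J v) = orbit J v"
  using extreme_points_image[OF _ refl_id, of v J] by simp

lemma is_gon_image:
  assumes "dominant v" "w \<in> W"
  shows "is_gon n (w ` orbit_poly J v) \<longleftrightarrow> card (orbit J v) = n"
  using group_inj[OF assms(2)]
  by (simp add: is_gon_def extreme_points_image[OF assms] card_image inj_on_subset)

section \<open>Dimensions of faces; edges and facets\<close>

definition directions :: "3 set \<Rightarrow> real^3 \<Rightarrow> (real^3) set" where
  "directions J v = span ((\<lambda>x. x - v) ` orbit J v)"

lemma aff_dim_orbit_poly: "aff_dim (orbit_poly J v) = int (dim (directions J v))"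
  unfolding orbit_poly_def aff_dim_convex_hull directions_def dim_span
  by (rule aff_dim_eq_dim_subtract) (simp add: hull_inc orbit_self)

lemma directions_mirror:
  assumes "d \<in> directions J v" "k \<in> J"
  shows "mirror k d \<in> directions J v"
proof -
  have "mirror k ` directions J v = span (mirror k ` (\<lambda>x. x - v) ` orbit J v)"
    unfolding directions_def by (simp add: linear_span_image linear_mirror)
  also have "\<dots> \<subseteq> directions J v"
    unfolding directions_def
  proof (rule span_minimal)
    show "mirror k ` (\<lambda>x. x - v) ` orbit J v \<subseteq> span ((\<lambda>x. x - v) ` orbit J v)"
    proof clarify
      fix x assume x: "x \<in> orbit J v"
      have "mirror k (x - v) = (mirror k x - v) - (mirror k v - v)"
        by (simp add: linear_diff[OF linear_mirror])
      also have "\<dots> \<in> span ((\<lambda>x. x - v) ` orbit J v)"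
        using x assms(2) orbit_self by (intro span_diff span_base) (auto intro: orbit_mirror)
      finally show "mirror k (x - v) \<in> span ((\<lambda>x. x - v) ` orbit J v)" .
    qed
  qed simp
  finally show ?thesis using assms(1) by blast
qed

lemma root_in_directions:
  assumes "k \<in> J" "simple_root k \<bullet> v \<noteq> 0"
  shows "simple_root k \<in> directions J v"
proof -
  have "mirror k v - v \<in> directions J v"
    unfolding directions_def using orbit_mirror[OF orbit_self assms(1)] by (intro span_base) auto
  then have "(- (2 * (simple_root k \<bullet> v))) *\<^sub>R simple_root k \<in> directions J v"
    by (simp add: mirror_def)
  then have "(1 / (- (2 * (simple_root k \<bullet> v)))) *\<^sub>R ((- (2 * (simple_root k \<bullet> v))) *\<^sub>R simple_root k)
      \<in> directions J v"
    unfolding directions_def by (rule span_scale)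
  then show ?thesis using assms(2) by simp
qed

text \<open>Directions spread along the Coxeter diagram: reflecting root \<open>l\<close> in mirror
  \<open>k\<close> changes it by a nonzero multiple of root \<open>k\<close> when the two are not
  orthogonal.\<close>

lemma root_in_directions_neighbour:
  assumes "k \<in> J" "simple_root l \<in> directions J v" "gram k l \<noteq> 0"
  shows "simple_root k \<in> directions J v"
proof -
  have "mirror k (simple_root l) - simple_root l \<in> directions J v"
    using directions_mirror[OF assms(2,1)] assms(2) unfolding directions_def by (intro span_diff)
  then have "(- (2 * gram k l)) *\<^sub>R simple_root k \<in> directions J v"
    by (simp add: mirror_root)
  then have "(1 / (- (2 * gram k l))) *\<^sub>R ((- (2 * gram k l)) *\<^sub>R simple_root k) \<in> directions J v"
    unfolding directions_def by (rule span_scale)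
  then show ?thesis using assms(3) by simp
qed

lemma directions_subset: "directions J v \<subseteq> span (simple_root ` J)"
  unfolding directions_def
proof (rule span_minimal)
  show "(\<lambda>x. x - v) ` orbit J v \<subseteq> span (simple_root ` J)"
  proof clarify
    fix x assume "x \<in> orbit J v"
    then show "x - v \<in> span (simple_root ` J)"
    proof (induction rule: orbitE)
      case (mirror x k)
      have eq: "mirror k x - v = (x - v) - (2 * (simple_root k \<bullet> x)) *\<^sub>R simple_root k"
        by (simp add: mirror_def)
      show ?case
        unfolding eq using mirror(2) by (intro span_diff[OF mirror(3)] span_scale span_base) auto
    qed (simp add: span_zero)
  qed
qed simp

lemma inj_simple_root: "inj simple_root"
  by (rule injI, rule ccontr) (metis root_weight zero_neq_one)

lemma dim_roots: "dim (simple_root ` J) = card J"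
proof -
  have "x \<in> span (range simple_root)" for x
    by (subst root_expansion) (intro span_sum span_scale span_base, simp)
  then have "independent (range simple_root)"
    by (intro card_le_dim_spanning[of _ UNIV]) (auto simp: card_image inj_simple_root)
  then have "independent (simple_root ` J)"
    by (rule independent_mono) auto
  then show ?thesis
    by (simp add: dim_eq_card_independent card_image inj_on_subset[OF inj_simple_root])
qed

lemma aff_dim_orbit_poly_le: "aff_dim (orbit_poly J v) \<le> int (card J)"
  using dim_subset[OF directions_subset] by (simp add: aff_dim_orbit_poly dim_roots)

lemma aff_dim_orbit_poly_eq:
  assumes "\<And>k. k \<in> J \<Longrightarrow> simple_root k \<in> directions J v"
  shows "aff_dim (orbit_poly J v) = int (card J)"
proof -
  have "span (simple_root ` J) \<subseteq> directions J v"
    using assms unfolding directions_def by (intro span_minimal) auto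
  then have "directions J v = span (simple_root ` J)" using directions_subset by blast
  then show ?thesis by (simp add: aff_dim_orbit_poly dim_roots)
qed

lemma gram_nonzero: "gram 1 3 \<noteq> 0" "gram 3 1 \<noteq> 0" "gram 2 3 \<noteq> 0" "gram 3 2 \<noteq> 0"
  using golden_pos by (auto simp: gram_simps)

lemma aff_dim_orbit_poly_UNIV:
  assumes "simple_root k \<bullet> v \<noteq> 0"
  shows "aff_dim (orbit_poly UNIV v) = 3"
proof -
  have k: "simple_root k \<in> directions UNIV v" by (rule root_in_directions[OF _ assms]) simp
  then have 3: "simple_root 3 \<in> directions UNIV v"
    using exhaust_3[of k] root_in_directions_neighbour[of 3 UNIV k] gram_nonzero by auto
  have "simple_root l \<in> directions UNIV v" for l
    using exhaust_3[of l] 3 root_in_directions_neighbour[OF _ 3, of l] gram_nonzero by auto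
  then show ?thesis using aff_dim_orbit_poly_eq[of UNIV v] by simp
qed

lemma edge_segment: "orbit_poly {k} v = closed_segment v (mirror k v)"
proof -
  have "x \<in> {v, mirror k v}" if "x \<in> orbit {k} v" for x
    using that by (induction rule: orbitE) auto
  then have "orbit {k} v = {v, mirror k v}" using orbit_self[of v "{k}"] orbit_mirror[of v "{k}" v k] by auto
  then show ?thesis by (simp add: orbit_poly_def segment_convex_hull)
qed

lemma edge_image: "w \<in> W \<Longrightarrow> w ` orbit_poly {k} v = closed_segment (w v) (w (mirror k v))"
  by (simp add: edge_segment closed_segment_linear_image group_linear)

text \<open>The set \<open>J\<close> of a face is not unique, because mirrors through
  \<open>v\<close> contribute nothing. In a one-dimensional face some generator moves
  \<open>v\<close>; the segment it produces is a face of the same dimension and hence the whole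
  edge.\<close>

lemma edge_of_orbit_poly:
  assumes v: "dominant v"
  shows "e edge_of orbit_poly UNIV v \<longleftrightarrow>
    (\<exists>w\<in>W. \<exists>k. simple_root k \<bullet> v \<noteq> 0 \<and> e = w ` orbit_poly {k} v)"
proof
  assume "\<exists>w\<in>W. \<exists>k. simple_root k \<bullet> v \<noteq> 0 \<and> e = w ` orbit_poly {k} v"
  then obtain w k where w: "w \<in> W" "simple_root k \<bullet> v \<noteq> 0" "e = w ` orbit_poly {k} v" by blast
  have "aff_dim (orbit_poly {k} v) = 1"
    using aff_dim_orbit_poly_eq[of "{k}" v] root_in_directions[OF _ w(2)] by auto
  then show "e edge_of orbit_poly UNIV v"
    unfolding edge_of_def w(3)
    using face_image[OF w(1) orbit_poly_face[OF v]] by (simp add: aff_dim_image[OF w(1)])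
next
  assume e: "e edge_of orbit_poly UNIV v"
  then have ne: "e \<noteq> {}" by (auto simp: edge_of_def)
  then obtain w J where w: "w \<in> W" "e = w ` orbit_poly J v"
    using face_cases[OF v _ ne] e unfolding edge_of_def by blast
  then have dim: "aff_dim (orbit_poly J v) = 1"
    using e by (simp add: edge_of_def aff_dim_image)
  have "\<exists>k\<in>J. simple_root k \<bullet> v \<noteq> 0"
  proof (rule ccontr)
    assume "\<not> ?thesis"
    then have "h v = v" if "h \<in> refl_group J" for h using group_fixes[OF that] by blast
    then have "orbit J v = {v}" using orbit_self by (auto simp: orbit_def)
    then show False using dim by (simp add: orbit_poly_def)
  qed
  then obtain k where k: "k \<in> J" "simple_root k \<bullet> v \<noteq> 0" by blast
  have "aff_dim (orbit_poly {k} v) = 1"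
    using aff_dim_orbit_poly_eq[of "{k}" v] root_in_directions[OF _ k(2)] by auto
  moreover have "orbit_poly {k} v face_of orbit_poly J v"
    using k(1) by (intro face_of_subset[OF orbit_poly_face[OF v] orbit_poly_mono orbit_poly_mono]) auto
  ultimately have "orbit_poly {k} v = orbit_poly J v"
    using face_of_aff_dim_lt[OF convex_orbit_poly] dim by fastforce
  then show "\<exists>w\<in>W. \<exists>k. simple_root k \<bullet> v \<noteq> 0 \<and> e = w ` orbit_poly {k} v"
    using w k(2) by metis
qed

lemma facet_of_orbit_poly:
  assumes v: "dominant v" and dim3: "aff_dim (orbit_poly UNIV v) = 3"
  shows "F facet_of orbit_poly UNIV v \<longleftrightarrow>
    (\<exists>w\<in>W. \<exists>l. aff_dim (orbit_poly (-{l}) v) = 2 \<and> F = w ` orbit_poly (-{l}) v)"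
proof
  assume "\<exists>w\<in>W. \<exists>l. aff_dim (orbit_poly (-{l}) v) = 2 \<and> F = w ` orbit_poly (-{l}) v"
  then obtain w l where w: "w \<in> W" "aff_dim (orbit_poly (-{l}) v) = 2" "F = w ` orbit_poly (-{l}) v"
    by blast
  then show "F facet_of orbit_poly UNIV v"
    using face_image[OF w(1) orbit_poly_face[OF v]] orbit_poly_self[of v "-{l}"]
    by (auto simp: facet_of_def dim3 aff_dim_image[OF w(1)])
next
  assume F: "F facet_of orbit_poly UNIV v"
  then have dimF: "aff_dim F = 2" "F \<noteq> {}" by (auto simp: facet_of_def dim3)
  obtain w J where w: "w \<in> W" "F = w ` orbit_poly J v"
    using face_cases[OF v _ dimF(2)] F unfolding facet_of_def by blast
  have dim: "aff_dim (orbit_poly J v) = 2"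
    using dimF(1) w by (simp add: aff_dim_image)
  then have "J \<noteq> UNIV" using dim3 by auto
  then obtain l where l: "J \<subseteq> -{l}" by auto
  have "card (-{l}) = 2" by (simp add: Compl_eq_Diff_UNIV card_Diff_singleton)
  then have "aff_dim (orbit_poly (-{l}) v) = 2"
    using aff_dim_orbit_poly_le[of "-{l}" v] aff_dim_subset[OF orbit_poly_mono[OF l, of v]] dim
    by simp
  moreover have "orbit_poly J v face_of orbit_poly (-{l}) v"
    by (rule face_of_subset[OF orbit_poly_face[OF v] orbit_poly_mono[OF l] orbit_poly_mono[OF subset_UNIV]])
  ultimately have "orbit_poly J v = orbit_poly (-{l}) v"
    using face_of_aff_dim_lt[OF convex_orbit_poly] dim by fastforce
  then show "\<exists>w\<in>W. \<exists>l. aff_dim (orbit_poly (-{l}) v) = 2 \<and> F = w ` orbit_poly (-{l}) v"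
    using w \<open>aff_dim (orbit_poly (-{l}) v) = 2\<close> by metis
qed

text \<open>The dimension is squeezed: the intersection is a proper face of a facet, hence of
  dimension below 2, and it has \<open>e\<close> as a face of dimension 1.\<close>

lemma facets_Int_edge:
  fixes P :: "(real^3) set"
  assumes "aff_dim P = 3" "F facet_of P" "F' facet_of P" "F \<noteq> F'" "e edge_of P" "e \<subseteq> F" "e \<subseteq> F'"
  shows "F \<inter> F' = e"
proof (rule ccontr)
  assume ne: "F \<inter> F' \<noteq> e"
  have dims: "aff_dim F = 2" "aff_dim F' = 2" "aff_dim e = 1"
    and faces: "F face_of P" "F' face_of P" "e face_of P"
    using assms by (auto simp: facet_of_def edge_of_def)
  have conv: "convex F" "convex F'" "convex (F \<inter> F')"
    using faces face_of_imp_convex convex_Int by blast+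
  have int: "F \<inter> F' face_of P" by (rule face_of_Int[OF faces(1,2)])
  have "e face_of F \<inter> F'"
    using face_of_face[OF int] faces(3) assms(6,7) by blast
  then have "aff_dim (F \<inter> F') > 1"
    using face_of_aff_dim_lt[OF conv(3), of e] ne dims(3) by metis
  moreover have "F \<inter> F' face_of F" "F \<inter> F' face_of F'"
    using face_of_face[OF faces(1)] face_of_face[OF faces(2)] int by blast+
  then have "aff_dim (F \<inter> F') < 2"
    using face_of_aff_dim_lt[OF conv(1)] face_of_aff_dim_lt[OF conv(2)] dims assms(4)
    by (metis Int_absorb2 inf_le1 inf_le2)
  ultimately show False by simp
qed

lemma dominant_orbit_unique:
  assumes "dominant x" "dominant (w x)" "w \<in> W"
  shows "w x = x"
proof (rule eq_by_weights)
  fix k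
  obtain w' where w': "w' \<in> W" "\<forall>x. w' (w x) = x" "\<forall>x. w (w' x) = x"
    using group_inverse[OF assms(3)] by blast
  show "weight k \<bullet> w x = weight k \<bullet> x"
    using dominant_inner_weight[OF assms(1,3)] dominant_inner_weight[OF assms(2) w'(1)] w'(2)
    by (simp add: antisym)
qed

text \<open>The sum of the corners is fixed by all mirrors except \<open>l\<close>, hence orthogonal
  to their roots, which leaves the line of \<open>weight l\<close>. In this way a facet, given only
  as a set, yields its normal.\<close>

lemma orbit_sum:
  assumes "0 < weight l \<bullet> v"
  shows "\<exists>\<tau>>0. (\<Sum>x\<in>orbit (-{l}) v. x) = \<tau> *\<^sub>R weight l"
proof -
  let ?O = "orbit (-{l}) v" and ?s = "\<Sum>x\<in>orbit (-{l}) v. x"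
  have root: "simple_root k \<bullet> ?s = 0" if "k \<noteq> l" for k
  proof -
    have k: "k \<in> -{l}" using that by simp
    have "mirror k ?s = (\<Sum>x\<in>?O. mirror k x)"
      by (rule linear_sum[OF linear_mirror])
    also have "\<dots> = (\<Sum>x\<in>mirror k ` ?O. x)"
      using group_inj[OF mirror_in_group[OF k]] by (subst sum.reindex) (auto simp: inj_on_def)
    also have "\<dots> = ?s" by (simp add: group_orbit[OF mirror_in_group[OF k]])
    finally have "(2 * (simple_root k \<bullet> ?s)) *\<^sub>R simple_root k = 0" by (simp add: mirror_def)
    moreover have "simple_root k \<noteq> 0" using root_norm[of k] by force
    ultimately show ?thesis by simp
  qed
  have "weight l \<bullet> ?s = (\<Sum>x\<in>?O. weight l \<bullet> v)"
    unfolding inner_sum_right by (rule sum.cong) (auto simp: orbit_def weight_group)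
  also have "\<dots> > 0"
    using assms orbit_self[of v] finite_orbit by (intro sum_pos) auto
  finally have pos: "0 < weight l \<bullet> ?s" .
  have s: "?s = (simple_root l \<bullet> ?s) *\<^sub>R weight l"
  proof -
    have "?s = (\<Sum>k\<in>UNIV. (simple_root k \<bullet> ?s) *\<^sub>R weight k)" by (rule weight_expansion)
    also have "\<dots> = (\<Sum>k\<in>UNIV. if k = l then (simple_root l \<bullet> ?s) *\<^sub>R weight l else 0)"
      using root by (intro sum.cong) auto
    finally show ?thesis by simp
  qed
  have "weight l \<bullet> ?s = (simple_root l \<bullet> ?s) * (weight l \<bullet> weight l)"
    by (subst s) simp
  then have "0 < simple_root l \<bullet> ?s"
    using pos by (metis inner_ge_zero mult_nonpos_nonneg not_le)
  then show ?thesis using s by blast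
qed

lemma weight_inner_pos: "0 < weight k \<bullet> weight l"
  using exhaust_3[of k] exhaust_3[of l] golden_pos
  by (auto simp: weight_def inner_3 vector_3 intro!: add_pos_pos mult_pos_pos)

lemma weight_dominant_pos:
  assumes "dominant v" "v \<noteq> 0"
  shows "0 < weight l \<bullet> v"
proof -
  have "\<exists>k. simple_root k \<bullet> v \<noteq> 0"
  proof (rule ccontr)
    assume "\<not> ?thesis"
    then have "(\<Sum>k\<in>UNIV. (simple_root k \<bullet> v) *\<^sub>R weight k) = 0" by simp
    then show False using assms(2) weight_expansion[of v] by metis
  qed
  then obtain k where "simple_root k \<bullet> v > 0"
    using assms(1) by (metis dominant_def less_eq_real_def)
  moreover have "weight l \<bullet> v = (\<Sum>k\<in>UNIV. (simple_root k \<bullet> v) * (weight l \<bullet> weight k))"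
    by (subst weight_expansion[of v]) (simp add: inner_sum_right)
  ultimately show ?thesis
    using assms(1) weight_inner_pos[of l]
    by (simp only:, intro sum_pos2[of _ k])
      (auto simp: dominant_def less_imp_le intro!: mult_nonneg_nonneg mult_pos_pos)
qed

lemma facet_normal:
  assumes v: "dominant v" "v \<noteq> 0" and w: "w \<in> W" "w' \<in> W"
    and eq: "w ` orbit_poly (-{l}) v = w' ` orbit_poly (-{l'}) v"
  shows "l = l'" "w (weight l) = w' (weight l')"
proof -
  have ext: "w ` orbit (-{l}) v = w' ` orbit (-{l'}) v"
    using extreme_points_image[OF v(1) w(1), of "-{l}"] extreme_points_image[OF v(1) w(2), of "-{l'}"] eq
    by simp
  have s: "(\<Sum>x\<in>h ` A. x) = h (\<Sum>x\<in>A. x)" if h: "h \<in> W" for h A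
    using group_inj[OF h] by (subst sum.reindex) (auto simp: inj_on_def linear_sum[OF group_linear[OF h]])
  obtain \<tau> \<tau>' where \<tau>: "\<tau> > 0" "(\<Sum>x\<in>orbit (-{l}) v. x) = \<tau> *\<^sub>R weight l"
    "\<tau>' > 0" "(\<Sum>x\<in>orbit (-{l'}) v. x) = \<tau>' *\<^sub>R weight l'"
    using orbit_sum weight_dominant_pos[OF v] by metis
  have "w (\<tau> *\<^sub>R weight l) = w' (\<tau>' *\<^sub>R weight l')"
    using s[OF w(1), of "orbit (-{l}) v"] s[OF w(2), of "orbit (-{l'}) v"] ext \<tau> by simp
  then have eq1: "\<tau> *\<^sub>R w (weight l) = \<tau>' *\<^sub>R w' (weight l')"
    by (simp add: linear_cmul group_linear[OF w(1)] group_linear[OF w(2)])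
  obtain h where h: "h \<in> W" "\<forall>x. h (w' x) = x" "\<forall>x. w' (h x) = x"
    using group_inverse[OF w(2)] by blast
  have hw: "(\<lambda>x. h (w x)) \<in> W" using group_comp[OF h(1) w(1)] .
  have "h (w (\<tau> *\<^sub>R weight l)) = \<tau>' *\<^sub>R weight l'"
    using \<open>w (\<tau> *\<^sub>R weight l) = w' (\<tau>' *\<^sub>R weight l')\<close> h(2) by simp
  moreover have "dominant (\<tau> *\<^sub>R weight l)" "dominant (\<tau>' *\<^sub>R weight l')"
    using \<tau>(1,3) by (auto simp: dominant_def)
  ultimately have eq2: "\<tau> *\<^sub>R weight l = \<tau>' *\<^sub>R weight l'"
    using dominant_orbit_unique[OF _ _ hw, of "\<tau> *\<^sub>R weight l"] by simp
  then have "simple_root l \<bullet> (\<tau> *\<^sub>R weight l) = simple_root l \<bullet> (\<tau>' *\<^sub>R weight l')" by simp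
  then show l: "l = l'" using \<tau>(1) by (auto split: if_splits)
  then have "\<tau> = \<tau>'"
    using \<open>simple_root l \<bullet> (\<tau> *\<^sub>R weight l) = simple_root l \<bullet> (\<tau>' *\<^sub>R weight l')\<close> by simp
  then show "w (weight l) = w' (weight l')" using eq1 \<tau>(1) by simp
qed

section \<open>Facets with few vertices\<close>

lemma golden_numeral: "golden * (numeral n * golden) = numeral n * golden + numeral n"
  using golden_square by (metis distrib_left mult.left_commute mult.right_neutral)

lemma compl_index: "-{1} = {2, 3::3}" "-{2} = {1, 3::3}" "-{3} = {1, 2::3}"
proof -
  have "x \<in> -{1} \<longleftrightarrow> x \<in> {2, 3}" "x \<in> -{2} \<longleftrightarrow> x \<in> {1, 3}" "x \<in> -{3} \<longleftrightarrow> x \<in> {1, 2}" for x :: 3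
    using exhaust_3[of x] by auto
  then show "-{1} = {2, 3::3}" "-{2} = {1, 3::3}" "-{3} = {1, 2::3}" by blast+
qed

lemma orbit_fixed: "(\<And>k. k \<in> J \<Longrightarrow> simple_root k \<bullet> v = 0) \<Longrightarrow> orbit J v = {v}"
proof -
  assume fixed: "\<And>k. k \<in> J \<Longrightarrow> simple_root k \<bullet> v = 0"
  have "x = v" if "x \<in> orbit J v" for x
    using that by (induction rule: orbitE) (auto simp: mirror_fixes fixed)
  then show ?thesis using orbit_self by blast
qed

text \<open>Mirror \<open>i\<close> fixes \<open>v\<close>, and reflecting in the orthogonal mirror
  \<open>j\<close> keeps the point on mirror \<open>i\<close>.\<close>

lemma orbit_commuting:
  assumes "simple_root i \<bullet> v = 0" "gram i j = 0"
  shows "orbit {i, j} v \<subseteq> orbit {j} v"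
proof
  fix x assume "x \<in> orbit {i, j} v"
  then have "x \<in> orbit {j} v \<and> simple_root i \<bullet> x = 0"
  proof (induction rule: orbitE)
    case (mirror x k)
    then show ?case
      using assms(2) by (auto simp: mirror_fixes orbit_mirror mirror_def[of j] inner_diff_right gram_def
          intro: orbit_mirror[of x "{j}" v j, unfolded mirror_def])
  qed (simp add: orbit_self assms)
  then show "x \<in> orbit {j} v" by simp
qed

text \<open>Non-orthogonal mirrors span a plane as soon as one of them moves \<open>v\<close>.
  Mirrors 1 and 2 are orthogonal, so for l = 3 both have to move it; otherwise the square
  degenerates to a segment or a point.\<close>

lemma aff_dim_facet:
  "aff_dim (orbit_poly (-{l}) v) = 2 \<longleftrightarrow>
    (if l = 1 then simple_root 2 \<bullet> v \<noteq> 0 \<or> simple_root 3 \<bullet> v \<noteq> 0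
     else if l = 2 then simple_root 1 \<bullet> v \<noteq> 0 \<or> simple_root 3 \<bullet> v \<noteq> 0
     else simple_root 1 \<bullet> v \<noteq> 0 \<and> simple_root 2 \<bullet> v \<noteq> 0)"
proof -
  have pair: "aff_dim (orbit_poly {i, j} v) = 2"
    if "i \<noteq> j" "simple_root i \<bullet> v \<noteq> 0" "simple_root j \<bullet> v \<noteq> 0 \<or> gram j i \<noteq> 0" for i j
  proof -
    have i: "simple_root i \<in> directions {i, j} v" by (rule root_in_directions) (use that in auto)
    have "simple_root j \<in> directions {i, j} v"
      using that(3) root_in_directions[of j "{i, j}" v] root_in_directions_neighbour[OF _ i, of j]
      by auto
    then show ?thesis using aff_dim_orbit_poly_eq[of "{i, j}" v] i that(1) by auto
  qed
  have fixed: "aff_dim (orbit_poly {i, j} v) \<noteq> 2"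
    if "simple_root i \<bullet> v = 0" "simple_root j \<bullet> v = 0" for i j
  proof -
    have "orbit {i, j} v = {v}" by (rule orbit_fixed) (use that in auto)
    then show ?thesis by (simp add: orbit_poly_def)
  qed
  have commuting: "aff_dim (orbit_poly {i, j} v) \<noteq> 2" if "simple_root i \<bullet> v = 0" "gram i j = 0" for i j
  proof -
    have "orbit_poly {i, j} v \<subseteq> orbit_poly {j} v"
      unfolding orbit_poly_def by (rule hull_mono[OF orbit_commuting[OF that]])
    then show ?thesis
      using aff_dim_subset[of "orbit_poly {i, j} v" "orbit_poly {j} v"] aff_dim_orbit_poly_le[of "{j}" v]
      by simp
  qed
  consider "l = 1" | "l = 2" | "l = 3" using exhaust_3 by blast
  then show ?thesis
  proof cases
    case 1
    then show ?thesis
      using pair[of 2 3] pair[of 3 2] fixed[of 2 3] gram_nonzero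
      by (auto simp: compl_index insert_commute)
  next
    case 2
    then show ?thesis
      using pair[of 1 3] pair[of 3 1] fixed[of 1 3] gram_nonzero
      by (auto simp: compl_index insert_commute)
  next
    case 3
    then show ?thesis
      using pair[of 1 2] commuting[of 1 2] commuting[of 2 1] gram_simps
      by (auto simp: compl_index insert_commute)
  qed
qed

text \<open>The list \<open>xs\<close> runs once around the polygon.\<close>

lemma card_dihedral_orbit:
  fixes xs :: "(real \<times> real) list" and v :: "real^3" and i j :: 3
  defines "P \<equiv> \<lambda>v i j (p, q). v - (2 * p) *\<^sub>R simple_root i - (2 * q) *\<^sub>R simple_root j"
  defines "s \<equiv> \<lambda>(p, q). (simple_root i \<bullet> v - p - 2 * gram i j * q, q)"
    and "t \<equiv> \<lambda>(p, q). (p, simple_root j \<bullet> v - q - 2 * gram i j * p)"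
  assumes "i \<noteq> j" "distinct ((0, 0) # xs)"
    and closed: "(s ` set ((0, 0) # xs)) \<union> (t ` set ((0, 0) # xs)) \<subseteq> set ((0, 0) # xs)"
    and path: "successively (\<lambda>x y. y = s x \<or> y = t x) ((0, 0) # xs)"
  shows "card (orbit {i, j} v) = Suc (length xs)"
proof -
  \<comment> \<open>The pair (p, q) records the point reached from \<open>v\<close> by subtracting
    2p times root \<open>i\<close> and 2q times root \<open>j\<close>; in these coordinates
    \<open>s\<close> and \<open>t\<close> are the two mirrors.\<close>
  have mi: "mirror i (P v i j (p, q)) = P v i j (s (p, q))" for p q
  proof -
    have "simple_root i \<bullet> P v i j (p, q) = simple_root i \<bullet> v - 2 * p - 2 * gram i j * q"
      by (simp add: P_def inner_diff_right gram_def)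
    then show ?thesis
      by (simp add: vec_eq_iff mirror_def) (simp add: P_def s_def t_def algebra_simps)
  qed
  have mj: "mirror j (P v i j (p, q)) = P v i j (t (p, q))" for p q
  proof -
    have "simple_root j \<bullet> P v i j (p, q) = simple_root j \<bullet> v - 2 * q - 2 * gram i j * p"
      by (simp add: P_def inner_diff_right gram_def inner_commute[of "simple_root j" "simple_root i"])
    then show ?thesis
      by (simp add: vec_eq_iff mirror_def) (simp add: P_def s_def t_def algebra_simps)
  qed
  have step: "P v i j y \<in> orbit {i, j} v" if "P v i j x \<in> orbit {i, j} v" "y = s x \<or> y = t x" for x y
    using that orbit_mirror[of "P v i j x" "{i, j}" v i] orbit_mirror[of "P v i j x" "{i, j}" v j]
      mi[of "fst x" "snd x"] mj[of "fst x" "snd x"] by auto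
  have path_orbit: "P v i j ` set ys \<subseteq> orbit {i, j} v"
    if "successively (\<lambda>x y. y = s x \<or> y = t x) ys" "ys \<noteq> []" "P v i j (hd ys) \<in> orbit {i, j} v" for ys
    using that
  proof (induction ys rule: induct_list012)
    case (3 x y zs)
    then have "P v i j y \<in> orbit {i, j} v" using step[of x y] by simp
    then show ?case using 3 by simp
  qed auto
  have "orbit {i, j} v = P v i j ` set ((0, 0) # xs)"
  proof (intro equalityI subsetI)
    fix x assume "x \<in> orbit {i, j} v"
    then show "x \<in> P v i j ` set ((0, 0) # xs)"
    proof (induction rule: orbitE)
      case (mirror x k)
      then obtain p q where pq: "(p, q) \<in> set ((0, 0) # xs)" "x = P v i j (p, q)" by auto
      then have "s (p, q) \<in> set ((0, 0) # xs)" "t (p, q) \<in> set ((0, 0) # xs)" using closed by blast+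
      then show ?case using mirror(2) mi[of p q] mj[of p q] pq(2) by blast
    qed (simp add: P_def)
  next
    fix x assume "x \<in> P v i j ` set ((0, 0) # xs)"
    then show "x \<in> orbit {i, j} v"
      using path_orbit[OF path] by (auto simp: P_def orbit_self)
  qed
  moreover have "inj (P v i j)"
  proof (rule injI)
    fix a b assume eq: "P v i j a = P v i j b"
    have "weight i \<bullet> P v i j c = weight i \<bullet> v - 2 * fst c \<and> weight j \<bullet> P v i j c = weight j \<bullet> v - 2 * snd c" for c
      using \<open>i \<noteq> j\<close> by (cases c) (simp add: P_def inner_diff_right)
    then show "a = b" using eq by (metis add_diff_cancel_left' diff_add_cancel mult_cancel_left prod_eqI zero_neq_numeral)
  qed
  ultimately show ?thesis
    using \<open>distinct ((0, 0) # xs)\<close>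
    by (metis card_image inj_on_subset subset_UNIV distinct_card length_Cons)
qed

lemma group_scaleR: "w \<in> refl_group J \<Longrightarrow> w (a *\<^sub>R x) = a *\<^sub>R w x"
  by (simp add: group_linear linear_cmul)

lemma card_orbit_scaleR: "a \<noteq> 0 \<Longrightarrow> card (orbit J (a *\<^sub>R v)) = card (orbit J v)"
proof -
  assume a: "a \<noteq> 0"
  have "orbit J (a *\<^sub>R v) = (\<lambda>x. a *\<^sub>R x) ` orbit J v"
    unfolding orbit_def by (auto simp: group_scaleR image_iff)
  then show ?thesis using a by (simp add: card_image inj_on_def)
qed

text \<open>The seed of the Wythoff construction with the nodes in \<open>R\<close> ringed: at
  distance 1 from the mirrors in \<open>R\<close> and on all other mirrors.\<close>

definition ring_vector :: "3 set \<Rightarrow> real^3" where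
  "ring_vector R = (\<Sum>k\<in>R. weight k)"

lemma root_ring_vector [simp]: "simple_root k \<bullet> ring_vector R = (if k \<in> R then 1 else 0)"
  by (simp add: ring_vector_def root_weight_sum)

lemma card_square:
  assumes "i \<noteq> j" "simple_root i \<bullet> v = 1" "simple_root j \<bullet> v = 1" "gram i j = 0"
  shows "card (orbit {i, j} v) = 4"
  using card_dihedral_orbit[of i j "[(1, 0), (1, 1), (0, 1)]" v] by (simp add: assms)

lemma card_triangle:
  assumes "i \<noteq> j" "simple_root i \<bullet> v = 1" "simple_root j \<bullet> v = 0" "gram i j = - 1 / 2"
  shows "card (orbit {i, j} v) = 3"
  using card_dihedral_orbit[of i j "[(1, 0), (1, 1)]" v] by (simp add: assms)

lemma card_hexagon:
  assumes "i \<noteq> j" "simple_root i \<bullet> v = 1" "simple_root j \<bullet> v = 1" "gram i j = - 1 / 2"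
  shows "card (orbit {i, j} v) = 6"
  using card_dihedral_orbit[of i j "[(1, 0), (1, 2), (2, 2), (2, 1), (0, 1)]" v] by (simp add: assms)

text \<open>The coordinates arise by applying mirrors \<open>i\<close> and \<open>j\<close>
  alternately, starting with \<open>i\<close>. Mirror \<open>j\<close> fixes the first corner and
  mirror \<open>i\<close> fixes the last one, so the path closes up after five points.\<close>

lemma card_pentagon:
  assumes "i \<noteq> j" "simple_root i \<bullet> v = 1" "simple_root j \<bullet> v = 0" "gram i j = - golden / 2"
  shows "card (orbit {i, j} v) = 5"
  using card_dihedral_orbit[of i j "[(1, 0), (1, golden), (golden + 1, golden), (golden + 1, golden + 1)]" v]
    golden_pos by (simp add: assms golden_simps distrib_left)

lemma card_decagon:
  assumes "i \<noteq> j" "simple_root i \<bullet> v = 1" "simple_root j \<bullet> v = 1" "gram i j = - golden / 2"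
  shows "card (orbit {i, j} v) = 10"
  using card_dihedral_orbit[of i j "[(1, 0), (1, golden + 1), (2 * golden + 1, golden + 1),
      (2 * golden + 1, 2 * golden + 2), (2 * golden + 2, 2 * golden + 2),
      (2 * golden + 2, 2 * golden + 1), (golden + 1, 2 * golden + 1), (golden + 1, 1), (0, 1)]" v]
    golden_lower by (simp add: assms golden_simps golden_numeral distrib_left)

section \<open>Six Archimedean solids\<close>

lemma facet_image:
  assumes "dominant v" "w \<in> W"
  shows "w ` orbit_poly (-{l}) v = orbit_poly UNIV v \<inter> {y. w (weight l) \<bullet> y = weight l \<bullet> v}"
proof -
  have P: "w ` orbit_poly UNIV v = orbit_poly UNIV v" using group_orbit_poly[OF assms(2)] .
  have inner: "w (weight l) \<bullet> w x = weight l \<bullet> x" for x using group_inner[OF assms(2)] .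
  have "w ` (orbit_poly UNIV v \<inter> {x. weight l \<bullet> x = weight l \<bullet> v}) =
      w ` orbit_poly UNIV v \<inter> {y. w (weight l) \<bullet> y = weight l \<bullet> v}"
    using inner by auto
  then show ?thesis by (simp add: P facet_hyperplane[OF assms(1)])
qed

lemma dist_group: "w \<in> W \<Longrightarrow> dist (w x) (w y) = dist x y"
  by (simp add: dist_norm group_norm linear_diff[OF group_linear, symmetric])

lemma dist_mirror: "dist x (mirror k x) = 2 * \<bar>simple_root k \<bullet> x\<bar>"
proof -
  have "norm (simple_root k) = 1" by (simp add: norm_eq_1)
  then show ?thesis by (simp add: dist_norm mirror_def)
qed

lemma equilateral_orbit_poly:
  assumes v: "dominant v" and eq: "\<And>k. simple_root k \<bullet> v = 0 \<or> simple_root k \<bullet> v = a"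
  shows "equilateral (orbit_poly UNIV v)"
  unfolding equilateral_def
proof (intro exI allI impI)
  fix x y assume "closed_segment x y edge_of orbit_poly UNIV v"
  then obtain w k where w: "w \<in> W" "simple_root k \<bullet> v \<noteq> 0" "closed_segment x y = w ` orbit_poly {k} v"
    by (auto simp: edge_of_orbit_poly[OF v])
  then have "{x, y} = {w v, w (mirror k v)}"
    by (simp add: edge_image closed_segment_eq)
  then have "dist x y = dist (w v) (w (mirror k v))"
    by (auto simp: doubleton_eq_iff dist_commute)
  also have "\<dots> = 2 * \<bar>a\<bar>"
    using eq[of k] w(2) by (simp add: dist_group[OF w(1)] dist_mirror)
  finally show "dist x y = 2 * \<bar>a\<bar>" .
qed

text \<open>All corners have the norm of \<open>v\<close>, so the sphere around the origin serves as
  the witness for concyclic corners.\<close>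

lemma regular_facet:
  assumes v: "dominant v" and eq: "equilateral (orbit_poly UNIV v)"
    and dim3: "aff_dim (orbit_poly UNIV v) = 3" and F: "F facet_of orbit_poly UNIV v"
  shows "regular_polygon F"
proof -
  obtain w l where w: "w \<in> W" "aff_dim (orbit_poly (-{l}) v) = 2" "F = w ` orbit_poly (-{l}) v"
    using F facet_of_orbit_poly[OF v dim3] by metis
  have face: "F face_of orbit_poly UNIV v" using F by (simp add: facet_of_def)
  have "polytope F" using face face_of_polytope_polytope polytope_orbit_poly by blast
  moreover have "aff_dim F = 2" using w aff_dim_image by simp
  moreover have "equilateral F"
    using eq face_of_trans[OF _ face] unfolding equilateral_def edge_of_def by metis
  moreover have "\<forall>x\<in>extreme_points F. dist 0 x = norm v"
    using extreme_points_image[OF v w(1)] w(3) group_norm[OF w(1)] by (auto simp: orbit_norm)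
  ultimately show ?thesis unfolding regular_polygon_def by blast
qed

text \<open>\<open>Z\<close> generates the stabiliser of \<open>v\<close>, and the facets at
  \<open>v\<close> are the images under it of the standard facets. They are listed by normal and
  type in \<open>ns\<close>, in cyclic order; \<open>es\<close> certifies the order by giving the
  direction of the edge shared by each facet and its successor. Everything is transported to
  \<open>x\<close> by \<open>h\<close>.\<close>

lemma vertex_configuration_orbit:
  fixes ns :: "((real^3) \<times> 3) list" and es :: "(real^3) list"
  assumes v: "dominant v" "v \<noteq> 0" and dim3: "aff_dim (orbit_poly UNIV v) = 3"
    and Z: "Z = {k. simple_root k \<bullet> v = 0}"
    and len: "length ns = length es" "2 \<le> length es"
    and normals: "\<And>n l. (n, l) \<in> set ns \<Longrightarrow> n \<in> orbit Z (weight l) \<and> aff_dim (orbit_poly (-{l}) v) = 2"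
    and facets: "\<And>l. aff_dim (orbit_poly (-{l}) v) = 2 \<Longrightarrow> (weight l, l) \<in> set ns"
    and closed: "\<And>n l k. (n, l) \<in> set ns \<Longrightarrow> k \<in> Z \<Longrightarrow> (mirror k n, l) \<in> set ns"
    and "distinct ns"
    and gons: "c = map (\<lambda>(n, l). card (orbit (-{l}) v)) ns"
    and edges: "\<And>n l n' l' e. ((n, l), (n', l'), e) \<in> set (zip ns (zip (rotate1 ns) es)) \<Longrightarrow>
      \<exists>k. k \<notin> Z \<and> e \<in> orbit Z (simple_root k) \<and> n \<bullet> e = 0 \<and> n' \<bullet> e = 0"
    and x: "x \<in> orbit UNIV v"
  shows "vertex_configuration c (orbit_poly UNIV v) x"
proof -
  let ?P = "orbit_poly UNIV v"
  define facet where "facet = (\<lambda>(n, l). ?P \<inter> {y. n \<bullet> y = weight l \<bullet> v})"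
  obtain h where h: "h \<in> W" "x = h v" using x by (auto simp: orbit_def)
  obtain h' where h': "h' \<in> W" "\<forall>x. h' (h x) = x" "\<forall>x. h (h' x) = x"
    using group_inverse[OF h(1)] by blast
  define Fs where "Fs = map (\<lambda>p. h ` facet p) ns"
  have fixv: "w v = v" if "w \<in> refl_group Z" for w
    using group_fixes[OF that] Z by blast
  have facet: "facet (w (weight l), l) = w ` orbit_poly (-{l}) v" if "w \<in> W" for w l
    using facet_image[OF v(1) that] by (simp add: facet_def)
  have ns_ex: "\<exists>w\<in>refl_group Z. n = w (weight l) \<and> facet (n, l) = w ` orbit_poly (-{l}) v \<and>
      aff_dim (orbit_poly (-{l}) v) = 2"
    if nl: "(n, l) \<in> set ns" for n l
  proof -
    obtain w where w: "w \<in> refl_group Z" "n = w (weight l)"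
      using normals[OF nl] by (auto simp: orbit_def)
    then show ?thesis using facet[OF group_W[OF w(1)]] normals[OF nl] by auto
  qed
  have inj_facet: "(n, l) = (n', l')"
    if eq: "facet (n, l) = facet (n', l')" and mem: "(n, l) \<in> set ns" "(n', l') \<in> set ns" for n l n' l'
  proof -
    obtain w where w: "w \<in> refl_group Z" "n = w (weight l)" "facet (n, l) = w ` orbit_poly (-{l}) v"
      using ns_ex[OF mem(1)] by auto
    obtain w' where w': "w' \<in> refl_group Z" "n' = w' (weight l')" "facet (n', l') = w' ` orbit_poly (-{l'}) v"
      using ns_ex[OF mem(2)] by auto
    have "w ` orbit_poly (-{l}) v = w' ` orbit_poly (-{l'}) v" using eq w w' by simp
    from facet_normal[OF v group_W[OF w(1)] group_W[OF w'(1)] this] show ?thesis using w w' by simp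
  qed
  have inj: "inj_on (\<lambda>p. h ` facet p) (set ns)"
  proof (rule inj_onI)
    fix p q assume "p \<in> set ns" "q \<in> set ns" "h ` facet p = h ` facet q"
    then show "p = q"
      using inj_facet[of "fst p" "snd p" "fst q" "snd q"] inj_image_eq_iff[OF group_inj[OF h(1)]] by simp
  qed
  have "distinct Fs" using \<open>distinct ns\<close> inj by (simp add: Fs_def distinct_map)
  have h_facet: "h ` facet (n, l) facet_of ?P \<and> is_gon (card (orbit (-{l}) v)) (h ` facet (n, l))"
    if nl: "(n, l) \<in> set ns" for n l
  proof -
    obtain w where w: "w \<in> refl_group Z" "facet (n, l) = w ` orbit_poly (-{l}) v"
      "aff_dim (orbit_poly (-{l}) v) = 2"
      using ns_ex[OF nl] by auto
    have hw: "(\<lambda>x. h (w x)) \<in> W" using group_comp[OF h(1) group_W[OF w(1)]] .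
    have "h ` facet (n, l) = (\<lambda>x. h (w x)) ` orbit_poly (-{l}) v" using w(2) by (simp add: image_image)
    then show ?thesis
      using facet_of_orbit_poly[OF v(1) dim3] is_gon_image[OF v(1) hw] hw w(3) by metis
  qed
  have v_facet: "v \<in> facet (n, l)" if "(n, l) \<in> set ns" for n l
  proof -
    obtain w where w: "w \<in> refl_group Z" "facet (n, l) = w ` orbit_poly (-{l}) v"
      using ns_ex[OF \<open>(n, l) \<in> set ns\<close>] by auto
    then show ?thesis using fixv[OF w(1)] orbit_poly_self[of v "-{l}"] by force
  qed
  have orbit_ns: "(w (weight l), l) \<in> set ns"
    if "w \<in> refl_group Z" "aff_dim (orbit_poly (-{l}) v) = 2" for w l
    using that(1) by induction (use facets[OF that(2)] closed in auto)
  have "set Fs = {F. F facet_of ?P \<and> x \<in> F}"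
  proof (intro equalityI subsetI)
    fix F assume "F \<in> set Fs"
    then obtain n l where "(n, l) \<in> set ns" "F = h ` facet (n, l)" by (auto simp: Fs_def)
    then show "F \<in> {F. F facet_of ?P \<and> x \<in> F}"
      using h_facet v_facet h(2) by auto
  next
    fix F assume F: "F \<in> {F. F facet_of ?P \<and> x \<in> F}"
    then obtain w l where w: "w \<in> W" "aff_dim (orbit_poly (-{l}) v) = 2" "F = w ` orbit_poly (-{l}) v"
      using facet_of_orbit_poly[OF v(1) dim3] by auto
    have "F face_of ?P" "x \<in> F" using F by (auto simp: facet_of_def)
    moreover have "x extreme_point_of ?P" using extreme_orbit[OF v(1) x] .
    ultimately have "x \<in> extreme_points F"
      by (simp add: extreme_points_def extreme_point_of_face[of F ?P])
    then have "x \<in> w ` orbit (-{l}) v" by (simp add: w(3) extreme_points_image[OF v(1) w(1)])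
    then obtain g where g: "g \<in> refl_group (-{l})" "h v = w (g v)"
      using h(2) by (auto simp: orbit_def)
    \<comment> \<open>A facet through \<open>x\<close> has \<open>x\<close> as a corner, reached by
      some \<open>g\<close> in its own parabolic subgroup. Correcting by \<open>g\<close> gives an
      element that fixes \<open>v\<close>, so the facet is an image of a standard one under the
      stabiliser.\<close>
    define u where "u = (\<lambda>y. h' (w (g y)))"
    have "u \<in> W"
      unfolding u_def using group_comp[OF h'(1) group_comp[OF w(1) group_W[OF g(1)]]] .
    moreover have "u v = v" using g(2) h'(2) by (metis u_def)
    ultimately have u: "u \<in> refl_group Z" using stabilizer[OF v(1)] Z by blast
    have "h (u y) = w (g y)" for y using h'(3) by (simp add: u_def)
    then have "h ` u ` orbit_poly (-{l}) v = w ` g ` orbit_poly (-{l}) v" by (simp add: image_image)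
    then have "F = h ` facet (u (weight l), l)"
      using w(3) facet[OF group_W[OF u]] group_orbit_poly[OF g(1)] by simp
    then show "F \<in> set Fs" using orbit_ns[OF u w(2)] by (auto simp: Fs_def)
  qed
  moreover have "is_gon (c ! k) (Fs ! k) \<and> (Fs ! k \<inter> Fs ! (Suc k mod length c)) edge_of ?P"
    if k: "k < length c" for k
  proof
    have len_c: "length c = length ns" by (simp add: gons)
    let ?k' = "Suc k mod length ns"
    have k': "k < length ns" "?k' < length ns" "?k' \<noteq> k"
      using k len len_c by (auto simp: mod_Suc)
    obtain n l where nl: "ns ! k = (n, l)" by (cases "ns ! k")
    obtain n' l' where nl': "ns ! ?k' = (n', l')" by (cases "ns ! ?k'")
    have mem: "(n, l) \<in> set ns" "(n', l') \<in> set ns"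
      using nl nl' k' nth_mem by metis+
    show "is_gon (c ! k) (Fs ! k)"
      using h_facet[OF mem(1)] k'(1) nl by (simp add: gons Fs_def)
    have zip_k: "((n, l), (n', l'), es ! k) = zip ns (zip (rotate1 ns) es) ! k"
      using k' len nl nl' by (simp add: nth_rotate1)
    have "((n, l), (n', l'), es ! k) \<in> set (zip ns (zip (rotate1 ns) es))"
      unfolding zip_k by (rule nth_mem) (use k' len in simp)
    from edges[OF this] obtain j u where e: "j \<notin> Z" "u \<in> refl_group Z" "es ! k = u (simple_root j)"
      "n \<bullet> es ! k = 0" "n' \<bullet> es ! k = 0"
      by (auto simp: orbit_def)
    have hu: "(\<lambda>x. h (u x)) \<in> W" using group_comp[OF h(1) group_W[OF e(2)]] .
    define E where "E = h ` u ` orbit_poly {j} v"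
    have "E edge_of ?P"
      unfolding edge_of_orbit_poly[OF v(1)] E_def image_image using hu e(1) Z by blast
    \<comment> \<open>The edge starts at \<open>v\<close> along \<open>es ! k\<close>; as this
      direction is orthogonal to the normal, the other end lies in the hyperplane of the facet
      too.\<close>
    moreover have "u ` orbit_poly {j} v \<subseteq> facet (m, i)" if m: "(m, i) \<in> set ns" "m \<bullet> es ! k = 0" for m i
    proof -
      have seg: "u ` orbit_poly {j} v = closed_segment v (u (mirror j v))"
        by (simp add: edge_image[OF group_W[OF e(2)]] fixv[OF e(2)])
      have "u (mirror j v) = v - (2 * (simple_root j \<bullet> v)) *\<^sub>R es ! k"
        using e(2,3) fixv[OF e(2)]
        by (simp add: mirror_def linear_diff[OF group_linear[OF e(2)]] linear_cmul[OF group_linear[OF e(2)]])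
      then have "m \<bullet> u (mirror j v) = m \<bullet> v" using m(2) by (simp add: inner_diff_right)
      moreover have "u (mirror j v) \<in> ?P"
        using group_orbit_poly[OF group_W[OF e(2)], of v] group_orbit_poly[OF mirror_in_group[of j UNIV], of v]
          orbit_poly_self[of v UNIV] by (metis UNIV_I imageI)
      ultimately have "u (mirror j v) \<in> facet (m, i)"
        using v_facet[OF m(1)] by (simp add: facet_def)
      moreover have "convex (facet (m, i))"
        by (simp add: facet_def convex_Int convex_hyperplane convex_orbit_poly)
      ultimately show ?thesis using seg v_facet[OF m(1)] closed_segment_subset by metis
    qed
    then have "E \<subseteq> h ` facet (n, l)" "E \<subseteq> h ` facet (n', l')"
      using mem e(4,5) unfolding E_def by blast+
    moreover have "h ` facet (n, l) \<noteq> h ` facet (n', l')"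
      using \<open>distinct Fs\<close> k' nl nl' by (simp add: Fs_def nth_eq_iff_index_eq distinct_conv_nth) metis
    ultimately have "h ` facet (n, l) \<inter> h ` facet (n', l') = E"
      using facets_Int_edge[OF dim3] h_facet mem by metis
    then show "(Fs ! k \<inter> Fs ! (Suc k mod length c)) edge_of ?P"
      using \<open>E edge_of ?P\<close> k' nl nl' by (simp add: Fs_def len_c)
  qed
  ultimately show ?thesis
    unfolding vertex_configuration_def
    using \<open>distinct Fs\<close> by (intro exI[of _ Fs]) (auto simp: Fs_def gons)
qed

lemma mirror_vector:
  "mirror 1 (vector [x, y, z]) = vector [- x, y, z]"
  "mirror 2 (vector [x, y, z]) = vector [x, - y, z]"
  "mirror 3 (vector [x, y, z]) = (let t = (golden - 1) * z - x - golden * y in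
     vector [x + t / 2, y + golden * t / 2, z - (golden - 1) * t / 2])"
  by (simp_all add: mirror_def simple_root_def inner_3 vector_3 vec_eq_iff forall_3 Let_def field_simps)

lemma vector_3_eq: "(vector [x, y, z] :: real^3) = vector [x', y', z'] \<longleftrightarrow> x = x' \<and> y = y' \<and> z = z'"
  by (auto simp: vec_eq_iff forall_3 vector_3)

lemma archimedean_orbit_poly:
  assumes "0 < a" "k \<in> R"
    and "\<And>x. x \<in> orbit UNIV (a *\<^sub>R ring_vector R) \<Longrightarrow>
      vertex_configuration c (orbit_poly UNIV (a *\<^sub>R ring_vector R)) x"
  shows "archimedean_solid c (orbit_poly UNIV (a *\<^sub>R ring_vector R)) \<and>
    equilateral (orbit_poly UNIV (a *\<^sub>R ring_vector R))"
proof -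
  let ?v = "a *\<^sub>R ring_vector R"
  have v: "dominant ?v" using assms(1) by (simp add: dominant_def)
  have dim3: "aff_dim (orbit_poly UNIV ?v) = 3"
    by (rule aff_dim_orbit_poly_UNIV[of k]) (use assms in auto)
  have eq: "equilateral (orbit_poly UNIV ?v)"
    by (rule equilateral_orbit_poly[OF v, of a]) auto
  show ?thesis
    unfolding archimedean_solid_def
    using polytope_orbit_poly dim3 eq regular_facet[OF v eq dim3] extreme_points_orbit_poly[OF v] assms(3)
    by simp
qed

lemma ring_vector_nonzero: "0 < a \<Longrightarrow> k \<in> R \<Longrightarrow> a *\<^sub>R ring_vector R \<noteq> 0"
proof -
  assume "0 < a" "k \<in> R"
  then have "simple_root k \<bullet> (a *\<^sub>R ring_vector R) \<noteq> 0" by simp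
  then show ?thesis by (metis inner_zero_right)
qed

lemma ring_cards:
  "card (orbit {1, 2} (ring_vector {1, 2})) = 4"
  "card (orbit {1, 3} (ring_vector {1})) = 3"
  "card (orbit {1, 3} (ring_vector {1, 2})) = 3"
  "card (orbit {1, 3} (ring_vector {3})) = 3"
  "card (orbit {1, 3} (ring_vector {2, 3})) = 3"
  "card (orbit {1, 3} (ring_vector {1, 3})) = 6"
  "card (orbit {2, 3} (ring_vector {2})) = 5"
  "card (orbit {2, 3} (ring_vector {1, 2})) = 5"
  "card (orbit {2, 3} (ring_vector {3})) = 5"
  "card (orbit {2, 3} (ring_vector {1, 3})) = 5"
  "card (orbit {2, 3} (ring_vector {2, 3})) = 10"
  using card_square[of 1 2 "ring_vector {1, 2}"] card_triangle[of 1 3] card_triangle[of 3 1]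
    card_hexagon[of 1 3] card_pentagon[of 2 3] card_pentagon[of 3 2] card_decagon[of 2 3]
  by (simp_all add: gram_simps insert_commute)

text \<open>Facet normals and edge directions at the vertex \<open>v\<close> are given by words in the mirrors through
  \<open>v\<close>; a facet is a pair of a word and the index of the weight it is applied to.\<close>

definition word :: "3 list \<Rightarrow> real^3 \<Rightarrow> real^3" where
  "word ws x = foldr mirror ws x"

lemma word_orbit: "set ws \<subseteq> J \<Longrightarrow> word ws x \<in> orbit J x"
  by (induction ws) (auto simp: word_def orbit_self intro: orbit_mirror)

definition ring_facet :: "3 set \<Rightarrow> 3 \<Rightarrow> bool" where
  "ring_facet R l \<longleftrightarrow> (if l = 1 then 2 \<in> R \<or> 3 \<in> R else if l = 2 then 1 \<in> R \<or> 3 \<in> R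
     else 1 \<in> R \<and> 2 \<in> R)"

text \<open>All hypotheses concern explicit words, so that for each solid they become identities and
  inequalities in golden that simplification settles.\<close>

lemma ring_configuration:
  fixes ns es :: "(3 list \<times> 3) list"
  assumes a: "0 < a" and R: "R \<noteq> {}"
    and len: "length ns = length es" "2 \<le> length es"
    and words: "\<forall>(ws, l)\<in>set ns. set ws \<inter> R = {} \<and> ring_facet R l"
    and facets: "\<forall>l. ring_facet R l \<longrightarrow> ([], l) \<in> set ns"
    and closed: "\<forall>(ws, l)\<in>set ns. \<forall>k. k \<notin> R \<longrightarrow>
      (\<exists>(ws', l')\<in>set ns. l' = l \<and> word ws' (weight l) = mirror k (word ws (weight l)))"
    and dist: "distinct (map (\<lambda>(ws, l). (word ws (weight l), l)) ns)"
    and gons: "c = map (\<lambda>(ws, l). card (orbit (-{l}) (ring_vector R))) ns"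
    and edges: "\<forall>((ws, l), (ws', l'), (us, k))\<in>set (zip ns (zip (rotate1 ns) es)).
      k \<in> R \<and> set us \<inter> R = {} \<and> word ws (weight l) \<bullet> word us (simple_root k) = 0 \<and>
      word ws' (weight l') \<bullet> word us (simple_root k) = 0"
    and x: "x \<in> orbit UNIV (a *\<^sub>R ring_vector R)"
  shows "vertex_configuration c (orbit_poly UNIV (a *\<^sub>R ring_vector R)) x"
proof -
  let ?v = "a *\<^sub>R ring_vector R" and ?n = "\<lambda>(ws, l). (word ws (weight l), l)"
    and ?e = "\<lambda>(us, k). word us (simple_root k)"
  have facet: "aff_dim (orbit_poly (-{l}) ?v) = 2 \<longleftrightarrow> ring_facet R l" for l
    using a by (simp add: aff_dim_facet ring_facet_def)
  have R: "\<exists>k. k \<in> R" using R by blast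
  show ?thesis
  proof (rule vertex_configuration_orbit[where Z = "-R" and ns = "map ?n ns" and es = "map ?e es"])
    show "?v \<noteq> 0" "aff_dim (orbit_poly UNIV ?v) = 3"
      using R a ring_vector_nonzero aff_dim_orbit_poly_UNIV[of _ ?v] by auto
    fix n l assume "(n, l) \<in> set (map ?n ns)"
    then obtain ws where ws: "(ws, l) \<in> set ns" "n = word ws (weight l)" by auto
    then show "n \<in> orbit (-R) (weight l) \<and> aff_dim (orbit_poly (-{l}) ?v) = 2"
      using words facet word_orbit[of ws "-R"] by blast
    fix k assume "k \<in> -R"
    then obtain ws' where "(ws', l) \<in> set ns" "word ws' (weight l) = mirror k (word ws (weight l))"
      using closed ws(1) by fastforce
    then show "(mirror k n, l) \<in> set (map ?n ns)" using ws(2) by force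
  next
    fix l assume "aff_dim (orbit_poly (-{l}) ?v) = 2"
    then have "([], l) \<in> set ns" using facets facet by blast
    then show "(weight l, l) \<in> set (map ?n ns)" by (force simp: word_def)
  next
    show "c = map (\<lambda>(n, l). card (orbit (-{l}) ?v)) (map ?n ns)"
      using a by (simp add: gons card_orbit_scaleR case_prod_beta comp_def)
    fix n l n' l' e
    assume "((n, l), (n', l'), e) \<in> set (zip (map ?n ns) (zip (rotate1 (map ?n ns)) (map ?e es)))"
    then obtain ws ws' us k where mem: "((ws, l), (ws', l'), (us, k)) \<in> set (zip ns (zip (rotate1 ns) es))"
      and eq: "n = word ws (weight l)" "n' = word ws' (weight l')" "e = word us (simple_root k)"
      by (auto simp: rotate1_map zip_map_map zip_map1 zip_map2)
    have "k \<in> R \<and> set us \<inter> R = {} \<and> n \<bullet> e = 0 \<and> n' \<bullet> e = 0" using bspec[OF edges mem] eq by auto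
    then show "\<exists>k. k \<notin> -R \<and> e \<in> orbit (-R) (simple_root k) \<and> n \<bullet> e = 0 \<and> n' \<bullet> e = 0"
      unfolding eq using word_orbit[of us "-R"] by blast
  qed (use a len dist x in \<open>auto simp: dominant_def\<close>)
qed

lemmas word_simps = word_def ring_facet_def weight_def simple_root_def mirror_vector Let_def inner_3
  vector_3 vector_3_eq golden_simps golden_numeral compl_index ring_cards forall_3 field_simps

text \<open>Mirrors 2 and 3 generate the stabiliser of the vertex; the five words carry weight 2
  through its orbit under them, ordered so that neighbouring triangles share an edge. The later
  lists are built likewise, with the smaller stabilisers of their vertices.\<close>

lemma icosahedron:
  assumes "0 < a" "x \<in> orbit UNIV (a *\<^sub>R ring_vector {1})"
  shows "vertex_configuration [3, 3, 3, 3, 3] (orbit_poly UNIV (a *\<^sub>R ring_vector {1})) x"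
  by (rule ring_configuration[OF assms(1) _ _ _ _ _ _ _ _ _ assms(2),
        where ns = "[([], 2), ([2], 2), ([2, 3, 2], 2), ([3, 2, 3, 2], 2), ([3, 2], 2)]"
          and es = "[([], 1), ([2, 3], 1), ([2, 3, 2, 3], 1), ([3, 2, 3], 1), ([3], 1)]"])
    (use golden_lower in \<open>simp_all add: word_simps\<close>)

lemma dodecahedron:
  assumes "0 < a" "x \<in> orbit UNIV (a *\<^sub>R ring_vector {2})"
  shows "vertex_configuration [5, 5, 5] (orbit_poly UNIV (a *\<^sub>R ring_vector {2})) x"
  by (rule ring_configuration[OF assms(1) _ _ _ _ _ _ _ _ _ assms(2),
        where ns = "[([], 1), ([1], 1), ([3, 1], 1)]"
          and es = "[([], 2), ([1, 3], 2), ([3], 2)]"])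
    (use golden_lower in \<open>simp_all add: word_simps\<close>)

lemma icosidodecahedron:
  assumes "0 < a" "x \<in> orbit UNIV (a *\<^sub>R ring_vector {3})"
  shows "vertex_configuration [3, 5, 3, 5] (orbit_poly UNIV (a *\<^sub>R ring_vector {3})) x"
  by (rule ring_configuration[OF assms(1) _ _ _ _ _ _ _ _ _ assms(2),
        where ns = "[([], 2), ([], 1), ([2], 2), ([1], 1)]"
          and es = "[([], 3), ([2], 3), ([1, 2], 3), ([1], 3)]"])
    (use golden_lower in \<open>simp_all add: word_simps\<close>)

lemma truncated_dodecahedron:
  assumes "0 < a" "x \<in> orbit UNIV (a *\<^sub>R ring_vector {2, 3})"
  shows "vertex_configuration [3, 10, 10] (orbit_poly UNIV (a *\<^sub>R ring_vector {2, 3})) x"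
  by (rule ring_configuration[OF assms(1) _ _ _ _ _ _ _ _ _ assms(2),
        where ns = "[([], 2), ([], 1), ([1], 1)]"
          and es = "[([], 3), ([], 2), ([1], 3)]"])
    (use golden_lower in \<open>simp_all add: word_simps\<close>)

lemma truncated_icosahedron:
  assumes "0 < a" "x \<in> orbit UNIV (a *\<^sub>R ring_vector {1, 3})"
  shows "vertex_configuration [5, 6, 6] (orbit_poly UNIV (a *\<^sub>R ring_vector {1, 3})) x"
  by (rule ring_configuration[OF assms(1) _ _ _ _ _ _ _ _ _ assms(2),
        where ns = "[([], 1), ([], 2), ([2], 2)]"
          and es = "[([], 3), ([], 1), ([2], 3)]"])
    (use golden_lower in \<open>simp_all add: word_simps\<close>)

lemma rhombicosidodecahedron:
  assumes "0 < a" "x \<in> orbit UNIV (a *\<^sub>R ring_vector {1, 2})"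
  shows "vertex_configuration [3, 4, 5, 4] (orbit_poly UNIV (a *\<^sub>R ring_vector {1, 2})) x"
  by (rule ring_configuration[OF assms(1) _ _ _ _ _ _ _ _ _ assms(2),
        where ns = "[([], 2), ([], 3), ([], 1), ([3], 3)]"
          and es = "[([], 1), ([], 2), ([3], 2), ([3], 1)]"])
    (use golden_lower in \<open>simp_all add: word_simps\<close>)

section \<open>Vertices as group elements\<close>

lemma root_ti_vertex_pos: "0 < simple_root k \<bullet> ti_vertex"
  using root_ti_vertex golden_lower by simp

lemma dominant_ti_vertex: "dominant ti_vertex"
  using root_ti_vertex_pos by (simp add: dominant_def less_imp_le)

lemma ti_vertex_nonzero: "ti_vertex \<noteq> 0"
  using root_ti_vertex_pos[of 1] by auto

lemma ti_orbit_poly: "truncated_icosidodecahedron = orbit_poly UNIV ti_vertex"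
  by (simp add: truncated_icosidodecahedron_def orbit_poly_def ti_points_orbit)

lemma ti_extreme_points: "extreme_points truncated_icosidodecahedron = orbit UNIV ti_vertex"
  by (simp add: ti_orbit_poly extreme_points_orbit_poly dominant_ti_vertex)

lemma aff_dim_ti: "aff_dim (orbit_poly UNIV ti_vertex) = 3"
  by (rule aff_dim_orbit_poly_UNIV[of 1]) (use root_ti_vertex_pos[of 1] in simp)

lemma pos_in_orbit: "pos i \<in> orbit UNIV ti_vertex"
  using pos[of i] by (simp add: ti_extreme_points)

text \<open>The element is unique because \<open>ti_vertex\<close> lies strictly inside the
  chamber.\<close>

definition elt :: "vertex \<Rightarrow> real^3 \<Rightarrow> real^3" where
  "elt i = (THE w. w \<in> W \<and> w ti_vertex = pos i)"

lemma ti_vertex_inj: "w \<in> W \<Longrightarrow> w' \<in> W \<Longrightarrow> w ti_vertex = w' ti_vertex \<Longrightarrow> w = w'"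
  using strictly_dominant_inj[OF root_ti_vertex_pos] .

lemma elt_eqI: "w \<in> W \<Longrightarrow> w ti_vertex = pos i \<Longrightarrow> elt i = w"
  unfolding elt_def by (rule the_equality) (auto intro: ti_vertex_inj)

lemma elt: "elt i \<in> W" "elt i ti_vertex = pos i"
proof -
  obtain w where "w \<in> W" "w ti_vertex = pos i" using pos_in_orbit[of i] by (auto simp: orbit_def)
  then show "elt i \<in> W" "elt i ti_vertex = pos i" using elt_eqI by auto
qed

lemmas elt_linear = linear_sum[OF group_linear[OF elt(1)]] linear_cmul[OF group_linear[OF elt(1)]]
  linear_diff[OF group_linear[OF elt(1)]]

lemma inj_elt: "elt i = elt j \<Longrightarrow> i = j"
  by (metis elt(2) pos_inject)

lemma elt_surj: "w \<in> W \<Longrightarrow> \<exists>i. elt i = w"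
proof -
  assume w: "w \<in> W"
  then have "w ti_vertex \<in> extreme_points truncated_icosidodecahedron"
    by (simp add: ti_extreme_points orbit_def)
  then have "pos (Vertex (w ti_vertex)) = w ti_vertex" by (rule Vertex_inverse)
  then have "elt (Vertex (w ti_vertex)) = w" using w by (intro elt_eqI) auto
  then show ?thesis ..
qed

lemma range_elt: "range elt = W"
proof (intro equalityI subsetI)
  fix w assume w: "w \<in> W"
  obtain i where "elt i = w" using elt_surj[OF w] ..
  then show "w \<in> range elt" by (metis rangeI)
next
  fix w assume "w \<in> range elt"
  then obtain i where "w = elt i" ..
  then show "w \<in> W" by (simp only: elt(1))
qed

text \<open>The edges at the base vertex join it to its mirror images, and an element carries them
  to the edges at its own vertex; hence the mirror is applied before the element.\<close>

definition nb :: "3 \<Rightarrow> vertex \<Rightarrow> vertex" where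
  "nb k i = (THE j. elt j = (\<lambda>x. elt i (mirror k x)))"

lemma elt_nb: "elt (nb k i) = (\<lambda>x. elt i (mirror k x))"
proof -
  have "(\<lambda>x. elt i (mirror k x)) \<in> W" by (rule group_right_step[OF elt(1)]) simp
  then obtain j where j: "elt j = (\<lambda>x. elt i (mirror k x))" using elt_surj by blast
  show ?thesis unfolding nb_def by (rule theI[of _ j]) (use j inj_elt in auto)
qed

lemma nb_nb [simp]: "nb k (nb k i) = i"
  by (rule inj_elt) (simp add: elt_nb)

lemma pos_nb: "pos (nb k i) = elt i (mirror k ti_vertex)"
  by (simp add: elt(2)[symmetric] elt_nb)

lemma mirror_inj_index:
  assumes "mirror k v = mirror l v" "simple_root k \<bullet> v \<noteq> 0"
  shows "k = l"
proof (rule ccontr)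
  assume "k \<noteq> l"
  then have "weight k \<bullet> mirror k v = weight k \<bullet> v" using assms(1) weight_mirror by metis
  then show False using assms(2) by (simp add: mirror_def inner_diff_right)
qed

lemma nb_inj: "nb k i = nb l i \<Longrightarrow> k = l"
proof -
  assume "nb k i = nb l i"
  then have "elt i (mirror k ti_vertex) = elt i (mirror l ti_vertex)" using pos_nb by metis
  then have "mirror k ti_vertex = mirror l ti_vertex" using group_inj[OF elt(1)] by (simp add: inj_eq)
  then show ?thesis using root_ti_vertex_pos[of k] by (intro mirror_inj_index) auto
qed

lemma edge_nb: "closed_segment (pos i) (pos (nb k i)) = elt i ` orbit_poly {k} ti_vertex"
  by (simp add: edge_image[OF elt(1)] elt(2) pos_nb)

lemma ti_edge: "closed_segment (pos i) (pos j) edge_of truncated_icosidodecahedron \<longleftrightarrow> (\<exists>k. j = nb k i)"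
proof
  assume "closed_segment (pos i) (pos j) edge_of truncated_icosidodecahedron"
  then obtain w k where w: "w \<in> W" "closed_segment (pos i) (pos j) = w ` orbit_poly {k} ti_vertex"
    unfolding ti_orbit_poly edge_of_orbit_poly[OF dominant_ti_vertex] by blast
  then have "{pos i, pos j} = {w ti_vertex, w (mirror k ti_vertex)}"
    by (simp add: edge_image closed_segment_eq)
  then consider "pos i = w ti_vertex" "pos j = w (mirror k ti_vertex)"
    | "pos i = w (mirror k ti_vertex)" "pos j = w ti_vertex"
    by (auto simp: doubleton_eq_iff)
  then have "pos j = elt i (mirror k ti_vertex)"
  proof cases
    case 1
    then show ?thesis using elt_eqI[OF w(1)] by simp
  next
    case 2
    have "elt i = (\<lambda>x. w (mirror k x))" by (rule elt_eqI[OF group_right_step[OF w(1)]]) (use 2 in simp_all)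
    then show ?thesis using 2 by simp
  qed
  then show "\<exists>k. j = nb k i" using pos_nb pos_inject by metis
next
  assume "\<exists>k. j = nb k i"
  then obtain k where "j = nb k i" ..
  then show "closed_segment (pos i) (pos j) edge_of truncated_icosidodecahedron"
    unfolding ti_orbit_poly edge_of_orbit_poly[OF dominant_ti_vertex] using edge_nb elt(1)
      root_ti_vertex_pos[of k] by (metis less_irrefl)
qed

lemma adjacent_iff: "adjacent i j \<longleftrightarrow> (\<exists>k. j = nb k i)"
  by (simp add: adjacent_def ti_edge)

text \<open>The number of corners of the facets orthogonal to the images of \<open>weight l\<close>.
  The three numbers differ, so the type of a facet can be read off from its corners.\<close>

definition gon :: "3 \<Rightarrow> nat" where
  "gon l = (if l = 1 then 10 else if l = 2 then 6 else 4)"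

lemma gon_inj: "gon l = gon l' \<Longrightarrow> l = l'"
  using exhaust_3[of l] exhaust_3[of l'] by (auto simp: gon_def)

lemma card_ti_facet: "card (orbit (-{l}) ti_vertex) = gon l"
proof -
  have v: "ti_vertex = (golden - 1) *\<^sub>R ring_vector UNIV"
  proof -
    have "ti_vertex = (\<Sum>k\<in>UNIV. (golden - 1) *\<^sub>R weight k)"
      using weight_expansion[of ti_vertex] by (simp add: root_ti_vertex)
    then show ?thesis by (simp add: ring_vector_def scaleR_right.sum)
  qed
  have "card (orbit (-{l}) ti_vertex) = card (orbit (-{l}) (ring_vector UNIV))"
    unfolding v by (rule card_orbit_scaleR) (use golden_lower in simp)
  also have "\<dots> = gon l"
    using exhaust_3[of l] card_square[of 1 2 "ring_vector UNIV"] card_hexagon[of 1 3 "ring_vector UNIV"]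
      card_decagon[of 2 3 "ring_vector UNIV"]
    by (auto simp: compl_index gram_simps gon_def)
  finally show ?thesis .
qed

lemma ti_facet: "F facet_of truncated_icosidodecahedron \<and> is_gon (gon l) F \<longleftrightarrow>
    (\<exists>w\<in>W. F = w ` orbit_poly (-{l}) ti_vertex)"
proof -
  have dim: "aff_dim (orbit_poly (-{l}) ti_vertex) = 2" for l
    using root_ti_vertex_pos less_irrefl unfolding aff_dim_facet by metis
  show ?thesis
    unfolding ti_orbit_poly facet_of_orbit_poly[OF dominant_ti_vertex aff_dim_ti]
    using dim is_gon_image[OF dominant_ti_vertex] card_ti_facet gon_inj by metis
qed

text \<open>At every vertex there is exactly one facet of each type, the image of the standard one
  under the element of that vertex.\<close>

lemma ti_facet_at:
  assumes "w \<in> W" "pos i \<in> w ` orbit_poly (-{l}) ti_vertex"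
  shows "w ` orbit_poly (-{l}) ti_vertex = elt i ` orbit_poly (-{l}) ti_vertex"
proof -
  let ?F = "w ` orbit_poly (-{l}) ti_vertex"
  have "?F face_of orbit_poly UNIV ti_vertex"
    by (rule face_image[OF assms(1) orbit_poly_face[OF dominant_ti_vertex]])
  then have "pos i extreme_point_of ?F"
    using assms(2) extreme_orbit[OF dominant_ti_vertex pos_in_orbit[of i]]
    by (simp add: extreme_point_of_face[of ?F])
  then have "pos i \<in> w ` orbit (-{l}) ti_vertex"
    using extreme_points_image[OF dominant_ti_vertex assms(1), of "-{l}"]
    by (auto simp: extreme_points_def)
  then obtain g where g: "g \<in> refl_group (-{l})" "pos i = w (g ti_vertex)"
    by (auto simp: orbit_def)
  have "elt i = (\<lambda>x. w (g x))"
    by (rule elt_eqI[OF group_comp[OF assms(1) group_W[OF g(1)]]]) (simp add: g(2))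
  then have "elt i ` orbit_poly (-{l}) ti_vertex = w ` g ` orbit_poly (-{l}) ti_vertex"
    by (simp add: image_image)
  then show ?thesis using group_orbit_poly[OF g(1)] by simp
qed

lemma nb_in_facet: "pos (nb k i) \<in> elt i ` orbit_poly (-{l}) ti_vertex \<Longrightarrow> k \<noteq> l"
proof -
  assume "pos (nb k i) \<in> elt i ` orbit_poly (-{l}) ti_vertex"
  then have "mirror k ti_vertex \<in> orbit_poly (-{l}) ti_vertex"
    using group_inj[OF elt(1)[of i]] by (simp add: pos_nb inj_image_mem_iff)
  then have "weight l \<bullet> mirror k ti_vertex = weight l \<bullet> ti_vertex"
    unfolding facet_hyperplane[OF dominant_ti_vertex, symmetric] by simp
  then show ?thesis using root_ti_vertex_pos[of k] by (auto simp: mirror_def inner_diff_right)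
qed

text \<open>Mirror \<open>k\<close> belongs to the parabolic subgroup of a facet exactly when the
  type of the facet is not \<open>k\<close>. So an edge of class \<open>k\<close> lies in the facets
  of the two other types at its ends.\<close>

lemma separates_gons:
  assumes "k \<noteq> l" "k \<noteq> l'" "l \<noteq> l'"
  shows "separates (gon l) (gon l') (closed_segment (pos i) (pos j)) truncated_icosidodecahedron
    \<longleftrightarrow> j = nb k i"
proof
  let ?e = "closed_segment (pos i) (pos j)"
  assume sep: "separates (gon l) (gon l') ?e truncated_icosidodecahedron"
  then obtain k' where k': "j = nb k' i" using ti_edge by (auto simp: separates_def)
  obtain w w' where w: "w \<in> W" "w' \<in> W"
    "w ` orbit_poly (-{l}) ti_vertex \<inter> w' ` orbit_poly (-{l'}) ti_vertex = ?e"
    using sep ti_facet unfolding separates_def by metis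
  then have "pos i \<in> w ` orbit_poly (-{l}) ti_vertex" "pos i \<in> w' ` orbit_poly (-{l'}) ti_vertex"
    "pos j \<in> w ` orbit_poly (-{l}) ti_vertex" "pos j \<in> w' ` orbit_poly (-{l'}) ti_vertex"
    using ends_in_segment by blast+
  then have "k' \<noteq> l" "k' \<noteq> l'"
    using ti_facet_at[OF w(1)] ti_facet_at[OF w(2)] nb_in_facet k' by metis+
  then have "k' = k" using assms exhaust_3[of k] exhaust_3[of l] exhaust_3[of l'] exhaust_3[of k'] by metis
  then show "j = nb k i" using k' by simp
next
  assume j: "j = nb k i"
  let ?P = "truncated_icosidodecahedron"
  let ?e = "closed_segment (pos i) (pos j)" and ?F = "\<lambda>l. elt i ` orbit_poly (-{l}) ti_vertex"
  have e: "?e edge_of ?P" using j ti_edge by blast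
  have F: "?F l facet_of ?P \<and> is_gon (gon l) (?F l)" for l
    using ti_facet elt(1) by blast
  have ne: "?F l \<noteq> ?F l'"
    using facet_normal(1)[OF dominant_ti_vertex ti_vertex_nonzero elt(1) elt(1), of i l i l'] assms(3) by blast
  have "?e \<subseteq> ?F m" if "m \<noteq> k" for m
    unfolding j edge_nb by (intro image_mono orbit_poly_mono) (use that in auto)
  then have "?F l \<inter> ?F l' = ?e"
    using F e ne assms(1,2) aff_dim_ti by (intro facets_Int_edge[of ?P]) (auto simp: ti_orbit_poly)
  then show "separates (gon l) (gon l') ?e ?P"
    unfolding separates_def using e F by blast
qed

lemma edge_in_class_iff: "edge_in_class k i j \<longleftrightarrow> j = nb k i"
  using exhaust_3[of k] separates_gons[of 1 3 2 i j] separates_gons[of 2 3 1 i j]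
    separates_gons[of 3 2 1 i j]
  by (auto simp: edge_in_class_def Let_def gon_def)

lemma transition_entry: "transition X $ i $ j = (\<Sum>k\<in>UNIV. if j = nb k i then X $ k else 0)"
  using nb_inj[of 1 i 2] nb_inj[of 1 i 3] nb_inj[of 2 i 3]
  by (auto simp: transition_def edge_in_class_iff sum_3)

lemma transition_mult: "(transition X *v f) $ i = (\<Sum>k\<in>UNIV. X $ k * f $ nb k i)"
proof -
  have "(transition X *v f) $ i = (\<Sum>j\<in>UNIV. (\<Sum>k\<in>UNIV. (if j = nb k i then X $ k else 0) * f $ j))"
    by (simp add: matrix_vector_mult_def transition_entry sum_distrib_right)
  also have "\<dots> = (\<Sum>k\<in>UNIV. \<Sum>j\<in>UNIV. (if j = nb k i then X $ k else 0) * f $ j)"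
    by (rule sum.swap)
  also have "\<dots> = (\<Sum>k\<in>UNIV. \<Sum>j\<in>UNIV. if j = nb k i then X $ k * f $ j else 0)"
    by (intro sum.cong refl) auto
  finally show ?thesis by simp
qed

text \<open>Graph edges of a class outside \<open>R\<close> shrink to points, since the seed lies on
  their mirrors; the remaining classes give all edges of the orbit polytope.\<close>

lemma realises_orbit_poly:
  assumes "0 < a" "archimedean_solid c (orbit_poly UNIV (a *\<^sub>R ring_vector R)) \<and>
    equilateral (orbit_poly UNIV (a *\<^sub>R ring_vector R))"
  shows "realises_solid c (\<lambda>i. elt i (a *\<^sub>R ring_vector R))"
proof -
  let ?v = "a *\<^sub>R ring_vector R"
  let ?\<Psi> = "\<lambda>i. elt i ?v"
  have v: "dominant ?v" using assms(1) by (simp add: dominant_def)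
  have "range ?\<Psi> = (\<lambda>w. w ?v) ` range elt" by (simp add: image_image)
  then have "range ?\<Psi> = extreme_points (orbit_poly UNIV ?v)"
    by (simp add: extreme_points_orbit_poly[OF v] orbit_def range_elt)
  moreover have "{closed_segment (?\<Psi> i) (?\<Psi> j) | i j. adjacent i j \<and> ?\<Psi> i \<noteq> ?\<Psi> j} =
      {e. e edge_of orbit_poly UNIV ?v}" (is "?L = ?R")
  proof (intro equalityI subsetI)
    fix e assume "e \<in> ?L"
    then obtain i k where e: "e = closed_segment (?\<Psi> i) (?\<Psi> (nb k i))" "?\<Psi> i \<noteq> ?\<Psi> (nb k i)"
      by (auto simp: adjacent_iff)
    then have "simple_root k \<bullet> ?v \<noteq> 0"
      using mirror_fixes[of k ?v] by (auto simp: elt_nb simp del: root_ring_vector)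
    moreover have "e = elt i ` orbit_poly {k} ?v"
      using e(1) by (simp add: edge_image[OF elt(1)] elt_nb)
    ultimately show "e \<in> ?R" using elt(1) by (auto simp only: edge_of_orbit_poly[OF v])
  next
    fix e assume "e \<in> ?R"
    then obtain w k where w: "w \<in> W" "simple_root k \<bullet> ?v \<noteq> 0" "e = w ` orbit_poly {k} ?v"
      unfolding edge_of_orbit_poly[OF v] by blast
    obtain i where i: "elt i = w" using elt_surj[OF w(1)] by blast
    have "e = closed_segment (?\<Psi> i) (?\<Psi> (nb k i))"
      using w i by (simp add: edge_image elt_nb)
    moreover have "mirror k ?v \<noteq> ?v"
      using dist_mirror[of ?v k] w(2) by (metis abs_eq_0 dist_self mult_eq_0_iff zero_neq_numeral)
    then have "?\<Psi> i \<noteq> ?\<Psi> (nb k i)"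
      using group_inj[OF w(1)] i by (auto simp: elt_nb inj_eq)
    ultimately show "e \<in> ?L" by (auto simp: adjacent_iff)
  qed
  ultimately show ?thesis
    unfolding realises_solid_def using assms(2) by blast
qed

lemma realises_solids:
  assumes "0 < a"
  shows "realises_solid [3, 3, 3, 3, 3] (\<lambda>i. elt i (a *\<^sub>R ring_vector {1}))"
    and "realises_solid [5, 5, 5] (\<lambda>i. elt i (a *\<^sub>R ring_vector {2}))"
    and "realises_solid [3, 5, 3, 5] (\<lambda>i. elt i (a *\<^sub>R ring_vector {3}))"
    and "realises_solid [3, 10, 10] (\<lambda>i. elt i (a *\<^sub>R ring_vector {2, 3}))"
    and "realises_solid [5, 6, 6] (\<lambda>i. elt i (a *\<^sub>R ring_vector {1, 3}))"
    and "realises_solid [3, 4, 5, 4] (\<lambda>i. elt i (a *\<^sub>R ring_vector {1, 2}))"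
  by (rule realises_orbit_poly[OF assms archimedean_orbit_poly[OF assms]];
      use assms in \<open>auto intro: icosahedron dodecahedron icosidodecahedron truncated_dodecahedron
        truncated_icosahedron rhombicosidodecahedron\<close>)+

section \<open>The dihedral inequality\<close>

locale involution_pair =
  fixes S T :: "'a::real_inner \<Rightarrow> 'a"
  assumes linear_S: "linear S" and linear_T: "linear T"
    and SS: "S (S x) = x" and TT: "T (T x) = x"
    and adj_S: "S x \<bullet> y = x \<bullet> S y" and adj_T: "T x \<bullet> y = x \<bullet> T y"

text \<open>Here \<open>c\<close> plays the role of cos (\<pi> / m). Off the fixed space of the
  rotation ST, the eigenvalues of 2 + ST + TS are 2 + 2 cos (2 \<pi> j / m) = 4 cos^2 (\<pi> j / m)
  with j not divisible by m, hence at most 4 c^2.\<close>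

locale dihedral_pair = involution_pair S T for S T :: "'a::real_inner \<Rightarrow> 'a" +
  fixes m :: nat and c :: real
  assumes order: "((\<lambda>x. S (T x)) ^^ m) x = x" and m_pos: "0 < m" and c_nonneg: "0 \<le> c"
    and bound: "(\<Sum>k<m. ((\<lambda>x. S (T x)) ^^ k) y) = 0 \<Longrightarrow>
      (2 *\<^sub>R y + S (T y) + T (S y)) \<bullet> y \<le> 4 * c\<^sup>2 * (y \<bullet> y)"
begin

definition "U = (\<lambda>x. S (T x))"
definition "V = (\<lambda>x. T (S x))"
text \<open>The average over the powers of the rotation: the orthogonal projection onto its fixed
  space, which commutes with both involutions. On that space the involutions coincide, and so do
  \<open>p\<close> and \<open>q\<close>.\<close>

definition "E x = (1 / real m) *\<^sub>R (\<Sum>k<m. (U ^^ k) x)"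
definition "p x = (1 / 2) *\<^sub>R (x - S x)"
definition "q x = (1 / 2) *\<^sub>R (x - T x)"

lemma UV [simp]: "U (V x) = x" "V (U x) = x"
  by (simp_all add: U_def V_def SS TT)

lemma linear_U: "linear U" and linear_V: "linear V"
  using linear_compose[OF linear_T linear_S] linear_compose[OF linear_S linear_T]
  by (simp_all add: U_def V_def o_def)

lemma linear_funpow: "linear f \<Longrightarrow> linear (f ^^ k)" for f :: "'a \<Rightarrow> 'a"
  by (induction k) (auto intro: linear_compose linear_id)

lemma order_U: "(U ^^ m) x = x"
  using order by (simp add: U_def)

lemma VU_funpow: "(V ^^ k) ((U ^^ k) x) = x"
proof (induction k arbitrary: x)
  case (Suc k)
  have "(V ^^ Suc k) ((U ^^ Suc k) x) = (V ^^ k) (V (U ((U ^^ k) x)))"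
    by (simp only: funpow_Suc_right o_apply funpow.simps(2) funpow_swap1)
  then show ?case using Suc by simp
qed simp

lemma V_funpow: "k \<le> m \<Longrightarrow> (V ^^ k) x = (U ^^ (m - k)) x"
proof -
  assume "k \<le> m"
  then have "(U ^^ k) ((U ^^ (m - k)) x) = x"
    using order_U[of x] by (simp add: funpow_add[symmetric, THEN fun_cong, unfolded o_apply])
  then show ?thesis using VU_funpow[of k "(U ^^ (m - k)) x"] by simp
qed

lemma shift_sum: "(\<Sum>k<m. (U ^^ Suc k) x) = (\<Sum>k<m. (U ^^ k) x)"
proof -
  have "(\<Sum>k<Suc m. (U ^^ k) x) = x + (\<Sum>k<m. (U ^^ Suc k) x)"
    by (subst sum.lessThan_Suc_shift) simp
  then show ?thesis using order_U[of x] by (simp del: funpow.simps)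
qed

lemma E_V: "E x = (1 / real m) *\<^sub>R (\<Sum>k<m. (V ^^ k) x)"
proof -
  have "(\<Sum>k<m. (V ^^ k) x) = (\<Sum>k<m. (U ^^ Suc (m - Suc k)) x)"
    by (intro sum.cong refl) (simp del: funpow.simps add: V_funpow Suc_diff_Suc)
  also have "\<dots> = (\<Sum>k<m. (U ^^ Suc k) x)"
    by (rule sum.nat_diff_reindex)
  finally show ?thesis by (simp add: E_def shift_sum del: funpow.simps)
qed

lemma linear_E: "linear E"
proof -
  have "E = (\<lambda>x. (1 / real m) *\<^sub>R (\<Sum>k<m. (U ^^ k) x))" by (rule ext) (rule E_def)
  then show ?thesis
    by (auto intro!: linear_compose_scale_right linear_compose_sum linear_funpow linear_U)
qed

lemma U_E: "U (E x) = E x"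
proof -
  have "U (E x) = (1 / real m) *\<^sub>R (\<Sum>k<m. (U ^^ Suc k) x)"
    by (simp add: E_def linear_cmul[OF linear_U] linear_sum[OF linear_U])
  then show ?thesis by (simp add: E_def shift_sum del: funpow.simps)
qed

lemma E_E: "E (E x) = E x"
proof -
  have "(U ^^ k) (E x) = E x" for k by (induction k) (simp_all add: U_E)
  then have "E (E x) = (1 / real m) *\<^sub>R (\<Sum>k<m. E x)" by (subst E_def) simp
  then show ?thesis using m_pos by (simp add: sum_constant_scaleR)
qed

lemma adj_E: "E x \<bullet> y = x \<bullet> E y"
proof -
  have "(U ^^ k) x \<bullet> y = x \<bullet> (V ^^ k) y" for k x y
  proof (induction k arbitrary: y)
    case (Suc k)
    have "U ((U ^^ k) x) \<bullet> y = (U ^^ k) x \<bullet> V y" by (simp add: U_def V_def adj_S adj_T)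
    then show ?case using Suc[of "V y"] by (simp add: funpow_swap1)
  qed simp
  then have "E x \<bullet> y = x \<bullet> ((1 / real m) *\<^sub>R (\<Sum>k<m. (V ^^ k) y))"
    by (simp add: E_def inner_sum_left inner_sum_right)
  then show ?thesis by (simp add: E_V)
qed

lemma S_E: "S (E x) = E (S x)" and T_E: "T (E x) = E (T x)"
proof -
  have "S (U y) = V (S y)" "T (U y) = V (T y)" for y by (simp_all add: U_def V_def SS)
  then have S: "S ((U ^^ k) x) = (V ^^ k) (S x)" and T: "T ((U ^^ k) x) = (V ^^ k) (T x)" for k
    by (induction k) simp_all
  show "S (E x) = E (S x)"
    by (subst E_def, subst E_V) (simp add: linear_cmul[OF linear_S] linear_sum[OF linear_S] S)
  show "T (E x) = E (T x)"
    by (subst E_def, subst E_V) (simp add: linear_cmul[OF linear_T] linear_sum[OF linear_T] T)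
qed

lemma ST_E: "S (E x) = T (E x)"
  using U_E[of x] SS[of "T (E x)"] by (metis U_def)

lemma linear_p: "linear p"
  unfolding p_def by (intro linear_compose_scale_right linear_compose_sub linear_ident linear_S)

lemma S_p: "S (p x) = - p x"
  by (simp add: p_def linear_cmul[OF linear_S] linear_diff[OF linear_S] SS scaleR_right_diff_distrib)

lemma p_p: "p (p x) = p x"
  by (subst p_def) (simp add: S_p)

lemma adj_p: "p x \<bullet> y = x \<bullet> p y"
  by (simp add: p_def inner_diff_left inner_diff_right adj_S)

lemma T_q: "T (q x) = - q x"
  by (simp add: q_def linear_cmul[OF linear_T] linear_diff[OF linear_T] TT scaleR_right_diff_distrib)

lemma E_p: "E (p x) = p (E x)"
  by (simp add: p_def linear_cmul[OF linear_E] linear_diff[OF linear_E] S_E)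

lemma E_p_q: "E (p x) = E (q x)"
  by (simp add: p_def q_def linear_cmul[OF linear_E] linear_diff[OF linear_E] S_E[symmetric]
      T_E[symmetric] ST_E)

text \<open>For T b = - b the form in \<open>bound\<close> is 2 (b . b) - 2 (S b . b), which is four
  times the squared norm of \<open>p b\<close>.\<close>

lemma norm_p_le:
  assumes "T b = - b" "E b = 0"
  shows "norm (p b) \<le> c * norm b"
proof -
  have "(1 / real m) *\<^sub>R (\<Sum>k<m. (U ^^ k) b) = 0" using assms(2) by (simp add: E_def)
  then have "(\<Sum>k<m. (U ^^ k) b) = 0" using m_pos by simp
  then have le: "(2 *\<^sub>R b + S (T b) + T (S b)) \<bullet> b \<le> 4 * c\<^sup>2 * (b \<bullet> b)"
    using bound by (simp add: U_def)
  have "S (T b) \<bullet> b = - (S b \<bullet> b)" "T (S b) \<bullet> b = - (S b \<bullet> b)"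
    using assms(1) by (simp_all add: adj_T linear_neg[OF linear_S])
  then have "p b \<bullet> b \<le> c\<^sup>2 * (b \<bullet> b)"
    using le by (simp add: p_def inner_diff_left inner_add_left)
  moreover have "p b \<bullet> p b = p b \<bullet> b" by (simp add: adj_p p_p)
  ultimately have "(norm (p b))\<^sup>2 \<le> (c * norm b)\<^sup>2"
    by (simp add: power2_norm_eq_inner power_mult_distrib)
  then show ?thesis by (rule power2_le_imp_le) (simp add: c_nonneg)
qed

text \<open>Both projections share the component in the fixed space of the rotation, which
  contributes a square to their product. In the rest, \<open>b0\<close> may be replaced by
  \<open>p b0\<close>, since \<open>p\<close> is symmetric and fixes \<open>a0\<close>.\<close>

lemma dihedral_decomposition:
  assumes a_def: "a = p x" and b_def: "b = q x"
  obtains a0 b0 where "a0 = a - E a" "b0 = b - E b" "a \<bullet> b = E a \<bullet> E a + a0 \<bullet> p b0" "norm (p b0) \<le> c * norm b0"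
    "(norm a)\<^sup>2 = (norm (E a))\<^sup>2 + (norm a0)\<^sup>2" "(norm b)\<^sup>2 = (norm (E a))\<^sup>2 + (norm b0)\<^sup>2"
proof
  define a0 b0 where "a0 = a - E a" and "b0 = b - E b"
  have Eab: "E b = E a" by (simp add: a_def b_def E_p_q)
  have E0: "E a0 = 0" "E b0 = 0" by (simp_all add: a0_def b0_def linear_diff[OF linear_E] E_E)
  have orth: "E y \<bullet> a0 = 0" "E y \<bullet> b0 = 0" "a0 \<bullet> E y = 0" "b0 \<bullet> E y = 0" for y
    using E0 by (simp_all add: adj_E) (simp_all add: adj_E[symmetric])
  have "p a0 = a0"
    by (simp add: a0_def linear_diff[OF linear_p] a_def p_p E_p)
  then have pa0: "a0 \<bullet> p b0 = a0 \<bullet> b0" by (metis adj_p)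
  have dec: "a = E a + a0" "b = E a + b0" by (simp_all add: a0_def b0_def Eab)
  have "a \<bullet> b = (E a + a0) \<bullet> (E a + b0)" using dec by simp
  then show "a \<bullet> b = E a \<bullet> E a + a0 \<bullet> p b0"
    by (simp add: inner_add_left inner_add_right orth pa0)
  have "(norm (E a + a0))\<^sup>2 = (norm (E a))\<^sup>2 + (norm a0)\<^sup>2" "(norm (E a + b0))\<^sup>2 = (norm (E a))\<^sup>2 + (norm b0)\<^sup>2"
    by (simp_all add: power2_norm_eq_inner inner_add_left inner_add_right orth)
  then show "(norm a)\<^sup>2 = (norm (E a))\<^sup>2 + (norm a0)\<^sup>2" "(norm b)\<^sup>2 = (norm (E a))\<^sup>2 + (norm b0)\<^sup>2"
    using dec by simp_all
  have "T b0 = - b0"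
    by (simp add: b0_def b_def linear_diff[OF linear_T] T_E T_q linear_neg[OF linear_E])
  then show "norm (p b0) \<le> c * norm b0" by (rule norm_p_le[OF _ E0(2)])
qed (use a_def b_def in auto)

lemma norm_le_of_sum: "(norm a)\<^sup>2 = s\<^sup>2 + (norm b)\<^sup>2 \<Longrightarrow> norm b \<le> norm a" for a b :: 'a
  by (rule power2_le_imp_le) auto

text \<open>Only the components off the fixed space can make the product negative, and there
  Cauchy-Schwarz is combined with the contraction by \<open>c\<close>. Equality kills the common
  component and makes Cauchy-Schwarz sharp, which forces \<open>p (q x)\<close> to be opposite to
  \<open>p x\<close>.\<close>

lemma dihedral_inequality: "- c * norm (p x) * norm (q x) \<le> p x \<bullet> q x"
  and dihedral_equality: "p x \<bullet> q x = - c * norm (p x) * norm (q x) \<Longrightarrow>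
    norm (p x) *\<^sub>R p (q x) = (- c * norm (q x)) *\<^sub>R p x"
proof -
  define a b where a_def: "a = p x" and b_def: "b = q x"
  obtain a0 b0 where ab: "a0 = a - E a" "b0 = b - E b" "a \<bullet> b = E a \<bullet> E a + a0 \<bullet> p b0"
    "norm (p b0) \<le> c * norm b0"
    "(norm a)\<^sup>2 = (norm (E a))\<^sup>2 + (norm a0)\<^sup>2" "(norm b)\<^sup>2 = (norm (E a))\<^sup>2 + (norm b0)\<^sup>2"
    by (rule dihedral_decomposition[OF a_def b_def])
  have le: "norm a0 \<le> norm a" "norm b0 \<le> norm b" using ab(5,6) norm_le_of_sum by blast+
  have "\<bar>a0 \<bullet> p b0\<bar> \<le> norm a0 * norm (p b0)" by (rule Cauchy_Schwarz_ineq2)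
  also have "\<dots> \<le> norm a * (c * norm b)"
    using le ab(4) c_nonneg by (intro mult_mono order_trans[OF ab(4)] mult_left_mono) auto
  finally have cs: "- (c * norm a * norm b) \<le> a0 \<bullet> p b0" by (simp add: mult_ac)
  then have "- c * norm a * norm b \<le> a \<bullet> b" unfolding ab(3) by (smt (verit) inner_ge_zero minus_mult_left)
  then show "- c * norm (p x) * norm (q x) \<le> p x \<bullet> q x" by (simp add: a_def b_def)
  assume "p x \<bullet> q x = - c * norm (p x) * norm (q x)"
  then have eq: "a \<bullet> b = - (c * norm a * norm b)" by (simp add: a_def b_def)
  then have "E a \<bullet> E a \<le> 0" using ab(3) cs by linarith
  then have "E a = 0" by (metis inner_ge_zero inner_eq_zero_iff order_antisym)
  then have 0: "a0 = a" "b0 = b" using ab(1,2) E_p_q[of x] by (simp_all add: a_def b_def)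
  then have eq': "a \<bullet> p b = - (c * norm a * norm b)" using ab(3) eq \<open>E a = 0\<close> by simp
  have sq: "(norm (y + z))\<^sup>2 = (norm y)\<^sup>2 + (norm z)\<^sup>2 + 2 * (y \<bullet> z)" for y z :: 'a
    by (simp add: power2_norm_eq_inner inner_add_left inner_add_right inner_commute)
  \<comment> \<open>Once the value of a . p b is inserted, the square collapses to |a|^2 (|p b|^2 -
    c^2 |b|^2), which is at most 0.\<close>
  have "(norm (norm a *\<^sub>R p b + (c * norm b) *\<^sub>R a))\<^sup>2 =
      (norm a)\<^sup>2 * (norm (p b))\<^sup>2 + 2 * (norm a * (c * norm b)) * (a \<bullet> p b) + (c * norm b)\<^sup>2 * (norm a)\<^sup>2"
    unfolding sq by (simp add: inner_commute[of "p b" a] c_nonneg power_mult_distrib)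
  also have "\<dots> = (norm a)\<^sup>2 * ((norm (p b))\<^sup>2 - (c * norm b)\<^sup>2)"
    unfolding eq' by (simp add: power2_eq_square algebra_simps)
  also have "\<dots> \<le> 0"
    using power_mono[OF ab(4), of 2] 0 by (intro mult_nonneg_nonpos) auto
  finally have "norm a *\<^sub>R p b + (c * norm b) *\<^sub>R a = 0" by simp
  then show "norm (p x) *\<^sub>R p (q x) = (- c * norm (q x)) *\<^sub>R p x"
    by (simp add: a_def b_def add_eq_0_iff2)
qed

end

context involution_pair
begin

lemma linear_ST: "linear (\<lambda>x. S (T x))"
  using linear_compose[OF linear_T linear_S] by (simp add: o_def)

lemma dihedral_pair_2:
  assumes order: "\<And>x. S (T (S (T x))) = x"
  shows "dihedral_pair S T 2 0"
proof unfold_locales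
  show "((\<lambda>x. S (T x)) ^^ 2) x = x" for x by (simp add: eval_nat_numeral order)
  fix y assume "(\<Sum>k<2. ((\<lambda>x. S (T x)) ^^ k) y) = 0"
  then have U: "S (T y) = - y" by (simp add: eval_nat_numeral add_eq_0_iff)
  have "T (S y) = S (T y)" by (metis order SS TT)
  then have "2 *\<^sub>R y + S (T y) + T (S y) = 0" using U by (simp add: scaleR_2)
  then show "(2 *\<^sub>R y + S (T y) + T (S y)) \<bullet> y \<le> 4 * 0\<^sup>2 * (y \<bullet> y)" by simp
qed auto

lemma dihedral_pair_3:
  assumes order: "\<And>x. S (T (S (T (S (T x))))) = x"
  shows "dihedral_pair S T 3 (1 / 2)"
proof unfold_locales
  show "((\<lambda>x. S (T x)) ^^ 3) x = x" for x by (simp add: eval_nat_numeral order)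
  fix y assume "(\<Sum>k<3. ((\<lambda>x. S (T x)) ^^ k) y) = 0"
  then have U: "y + S (T y) + S (T (S (T y))) = 0" by (simp add: eval_nat_numeral)
  have "T (S y) = S (T (S (T y)))" by (metis order SS TT)
  then have "2 *\<^sub>R y + S (T y) + T (S y) = y" using U by (simp add: scaleR_2 add_ac)
  then show "(2 *\<^sub>R y + S (T y) + T (S y)) \<bullet> y \<le> 4 * (1 / 2)\<^sup>2 * (y \<bullet> y)"
    by (simp add: power2_eq_square)
qed auto

text \<open>Off the fixed space, R = ST + TS satisfies R^2 + R = 1, whose roots are golden - 1 and -
  golden. The larger root gives the bound 2 + (golden - 1) = golden^2 = 4 (golden / 2)^2.\<close>

lemma dihedral_pair_5:
  assumes order: "\<And>x. S (T (S (T (S (T (S (T (S (T x))))))))) = x"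
  shows "dihedral_pair S T 5 (golden / 2)"
proof unfold_locales
  show "((\<lambda>x. S (T x)) ^^ 5) x = x" for x by (simp add: eval_nat_numeral order)
  show "0 \<le> golden / 2" using golden_pos by simp
  define R where "R = (\<lambda>x. S (T x) + T (S x))"
  have TS: "T (S x) = S (T (S (T (S (T (S (T x)))))))" for x by (metis order SS TT)
  have linear_R: "linear R"
    unfolding R_def using linear_compose_add[OF linear_ST linear_compose[OF linear_S linear_T]]
    by (simp add: o_def)
  have adj_R: "R x \<bullet> z = x \<bullet> R z" for x z
    by (simp add: R_def inner_add_left inner_add_right adj_S adj_T add.commute)
  fix y assume "(\<Sum>k<5. ((\<lambda>x. S (T x)) ^^ k) y) = 0"
  then have U: "y + S (T y) + S (T (S (T y))) + S (T (S (T (S (T y))))) + S (T (S (T (S (T (S (T y))))))) = 0"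
    by (simp add: eval_nat_numeral)
  have "R (R y) = S (T (S (T y))) + T (S (T (S y))) + 2 *\<^sub>R y"
    by (simp add: R_def linear_add[OF linear_S] linear_add[OF linear_T] SS TT scaleR_2)
  moreover have "T (S (T (S y))) = S (T (S (T (S (T y)))))" by (metis order SS TT)
  ultimately have RR: "R (R y) + R y = y" using U TS[of y]
    by (simp add: R_def scaleR_2 add_eq_0_iff algebra_simps)
  define \<alpha> where "\<alpha> = golden - 1"
  have \<alpha>: "\<alpha> * golden = 1" "\<alpha> + golden > 0" "\<alpha> = golden - 1"
    using golden_lower by (simp_all add: \<alpha>_def golden_simps algebra_simps)
  \<comment> \<open>Up to the factor \<alpha> + golden, these are the components of \<open>y\<close>
    in the two eigenspaces of \<open>R\<close>, \<open>u\<close> for - golden and \<open>z\<close>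
    for \<alpha>; they are orthogonal because \<open>R\<close> is symmetric.\<close>
  define u z where "u = \<alpha> *\<^sub>R y - R y" and "z = golden *\<^sub>R y + R y"
  have RRy: "R (R y) = y - R y" using RR by (simp add: algebra_simps)
  have "R u = \<alpha> *\<^sub>R R y - y + R y"
    by (simp add: u_def linear_diff[OF linear_R] linear_cmul[OF linear_R] RRy)
  also have "\<dots> = - golden *\<^sub>R u"
    using \<alpha>(1) by (simp add: u_def scaleR_diff_right \<alpha>(3) mult.commute scaleR_diff_left algebra_simps)
  finally have Ru: "R u = - golden *\<^sub>R u" .
  have "R z = golden *\<^sub>R R y + y - R y"
    by (simp add: z_def linear_add[OF linear_R] linear_cmul[OF linear_R] RRy)
  also have "\<dots> = \<alpha> *\<^sub>R z"
    using \<alpha>(1) by (simp add: z_def scaleR_add_right \<alpha>(3) scaleR_diff_left algebra_simps)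
  finally have Rz: "R z = \<alpha> *\<^sub>R z" .
  have "\<alpha> * (z \<bullet> u) = - golden * (z \<bullet> u)" using adj_R[of z u] by (simp add: Ru Rz)
  then have "(\<alpha> + golden) * (z \<bullet> u) = 0" by (simp add: algebra_simps)
  then have zu: "z \<bullet> u = 0" using \<alpha>(2) by simp
  have "(\<alpha> + golden) *\<^sub>R y = z + u" by (simp add: u_def z_def scaleR_add_left)
  then have "(\<alpha> + golden) * (y \<bullet> u) = u \<bullet> u"
    using zu by (metis add_0 inner_add_left inner_scaleR_left)
  then have "0 \<le> y \<bullet> u" using \<alpha>(2) by (metis inner_ge_zero zero_le_mult_iff not_le)
  then have "R y \<bullet> y \<le> \<alpha> * (y \<bullet> y)" by (simp add: u_def inner_diff_right inner_commute)
  then have "(2 *\<^sub>R y + R y) \<bullet> y \<le> (\<alpha> + 2) * (y \<bullet> y)" by (simp add: inner_add_left algebra_simps)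
  also have "\<alpha> + 2 = 4 * (golden / 2)\<^sup>2" by (simp add: \<alpha>(3) power2_eq_square golden_simps)
  finally show "(2 *\<^sub>R y + S (T y) + T (S y)) \<bullet> y \<le> 4 * (golden / 2)\<^sup>2 * (y \<bullet> y)"
    by (simp add: R_def add.assoc)
qed auto

end

section \<open>The involutions on functions over the vertices\<close>

definition shift :: "3 \<Rightarrow> real^vertex \<Rightarrow> real^vertex" where
  "shift k f = (\<chi> i. f $ nb k i)"

definition proj :: "3 \<Rightarrow> real^vertex \<Rightarrow> real^vertex" where
  "proj k f = (1 / 2) *\<^sub>R (f - shift k f)"

lemma linear_shift: "linear (shift k)"
  by (rule linearI) (simp_all add: shift_def vec_eq_iff)

lemma shift_shift: "shift k (shift k f) = f"
  by (simp add: shift_def vec_eq_iff)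

lemma bij_nb: "bij (nb k)"
  by (rule involuntory_imp_bij) simp

lemma adj_shift: "shift k f \<bullet> g = f \<bullet> shift k g"
proof -
  have "shift k f \<bullet> g = (\<Sum>i\<in>UNIV. f $ nb k i * g $ i)" by (simp add: inner_vec_def shift_def)
  also have "\<dots> = (\<Sum>i\<in>UNIV. f $ nb k (nb k i) * g $ nb k i)"
    by (rule sum.reindex_bij_betw[symmetric, of "nb k"]) (rule bij_nb)
  finally show ?thesis by (simp add: inner_vec_def shift_def)
qed

lemma mirror_braid:
  "mirror 1 (mirror 2 x) = mirror 2 (mirror 1 x)"
  "mirror 1 (mirror 3 (mirror 1 x)) = mirror 3 (mirror 1 (mirror 3 x))"
  "mirror 2 (mirror 3 (mirror 2 (mirror 3 (mirror 2 x)))) =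
    mirror 3 (mirror 2 (mirror 3 (mirror 2 (mirror 3 x))))"
  by (rule eq_by_weights; use exhaust_3 in \<open>auto simp: mirror_def inner_diff_right
    gram_simps[unfolded gram_def] algebra_simps golden_simps\<close>)+

lemma nb_braid:
  "nb 1 (nb 2 i) = nb 2 (nb 1 i)"
  "nb 1 (nb 3 (nb 1 i)) = nb 3 (nb 1 (nb 3 i))"
  "nb 2 (nb 3 (nb 2 (nb 3 (nb 2 i)))) = nb 3 (nb 2 (nb 3 (nb 2 (nb 3 i))))"
  by (rule inj_elt; simp add: elt_nb mirror_braid)+

lemma shift_braid:
  "shift 1 (shift 2 f) = shift 2 (shift 1 f)"
  "shift 1 (shift 3 (shift 1 f)) = shift 3 (shift 1 (shift 3 f))"
  "shift 2 (shift 3 (shift 2 (shift 3 (shift 2 f)))) = shift 3 (shift 2 (shift 3 (shift 2 (shift 3 f))))"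
  by (simp_all add: shift_def nb_braid)

lemma shift_dihedral:
  assumes "k \<noteq> l"
  shows "\<exists>m. dihedral_pair (shift k) (shift l) m (- gram k l)"
proof -
  have kl: "k = 1 \<and> l = 2 \<or> k = 2 \<and> l = 1 \<or> k = 1 \<and> l = 3 \<or> k = 3 \<and> l = 1 \<or>
      k = 2 \<and> l = 3 \<or> k = 3 \<and> l = 2"
    using assms exhaust_3[of k] exhaust_3[of l] by (elim disjE) simp_all
  interpret involution_pair "shift k" "shift l" for k l
    by (intro involution_pair.intro linear_shift shift_shift adj_shift)
  have 2: "dihedral_pair (shift 1) (shift 2) 2 0" "dihedral_pair (shift 2) (shift 1) 2 0"
    by (rule dihedral_pair_2; metis shift_braid(1) shift_shift)+
  have 3: "dihedral_pair (shift 1) (shift 3) 3 (1 / 2)" "dihedral_pair (shift 3) (shift 1) 3 (1 / 2)"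
    by (rule dihedral_pair_3; metis shift_braid(2) shift_shift)+
  have 5: "dihedral_pair (shift 2) (shift 3) 5 (golden / 2)" "dihedral_pair (shift 3) (shift 2) 5 (golden / 2)"
    by (rule dihedral_pair_5; metis shift_braid(3) shift_shift)+
  have g: "- gram 1 2 = 0" "- gram 2 1 = 0" "- gram 1 3 = 1 / 2" "- gram 3 1 = 1 / 2"
    "- gram 2 3 = golden / 2" "- gram 3 2 = golden / 2"
    by (simp_all add: gram_simps)
  from kl show ?thesis
    using 2 3 5 by (elim disjE conjE; simp only: g; blast)
qed

lemma proj_inequality:
  assumes "k \<noteq> l"
  shows "gram k l * norm (proj k f) * norm (proj l f) \<le> proj k f \<bullet> proj l f"
proof -
  obtain m where "dihedral_pair (shift k) (shift l) m (- gram k l)" using shift_dihedral[OF assms] ..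
  then interpret dihedral_pair "shift k" "shift l" m "- gram k l" .
  show ?thesis using dihedral_inequality[of f] by (simp add: p_def q_def proj_def)
qed

lemma proj_equality:
  assumes "k \<noteq> l" "proj k f \<bullet> proj l f = gram k l * norm (proj k f) * norm (proj l f)"
  shows "norm (proj k f) *\<^sub>R proj k (proj l f) = (gram k l * norm (proj l f)) *\<^sub>R proj k f"
proof -
  obtain m where "dihedral_pair (shift k) (shift l) m (- gram k l)" using shift_dihedral[OF assms(1)] ..
  then interpret dihedral_pair "shift k" "shift l" m "- gram k l" .
  have pq: "p = proj k" "q = proj l" by (rule ext, simp add: p_def q_def proj_def)+
  show ?thesis using dihedral_equality[of f] assms(2) by (simp add: pq)
qed

section \<open>The spectral gap\<close>

definition chamber_point :: "real^3 \<Rightarrow> real^3" where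
  "chamber_point b = (\<Sum>k\<in>UNIV. b $ k *\<^sub>R weight k)"

lemma root_chamber_point [simp]: "simple_root k \<bullet> chamber_point b = b $ k"
  using exhaust_3[of k] by (auto simp: chamber_point_def inner_add_right sum_3)

lemma chamber_point_nonzero: "b $ k \<noteq> 0 \<Longrightarrow> chamber_point b \<noteq> 0"
  by (metis inner_zero_right root_chamber_point)

lemma eq_by_roots: "(\<And>k. simple_root k \<bullet> x = simple_root k \<bullet> y) \<Longrightarrow> x = y"
  using weight_expansion[of x] weight_expansion[of y] by simp

text \<open>A positive eigenvector of the Gram matrix times the diagonal matrix of \<open>X\<close>.
  As the off-diagonal Gram entries are at most 0, positivity singles out the least eigenvalue. The
  entries of \<open>b\<close> will be the distances of the orbit point from the mirrors.\<close>

definition perron :: "real^3 \<Rightarrow> real^3 \<Rightarrow> real \<Rightarrow> bool" where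
  "perron X b \<mu> \<longleftrightarrow> (\<forall>k. 0 < X $ k) \<and> (\<Sum>k\<in>UNIV. X $ k) = 1 \<and> (\<forall>k. 0 < b $ k) \<and> 0 < \<mu> \<and>
    (\<forall>l. (\<Sum>k\<in>UNIV. gram l k * (X $ k * b $ k)) = \<mu> * b $ l)"

text \<open>Pairing with the simple roots packs the three scalar equations into one: the steps from
  the point to its mirror images, weighted by \<open>X\<close>, add up to a multiple of the point
  itself.\<close>

lemma perron_chamber:
  assumes "perron X b \<mu>"
  shows "(\<Sum>k\<in>UNIV. (X $ k * b $ k) *\<^sub>R simple_root k) = \<mu> *\<^sub>R chamber_point b"
proof (rule eq_by_roots)
  fix l
  have "(\<Sum>k\<in>UNIV. gram l k * (X $ k * b $ k)) = \<mu> * b $ l" using assms by (simp add: perron_def)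
  then show "simple_root l \<bullet> (\<Sum>k\<in>UNIV. (X $ k * b $ k) *\<^sub>R simple_root k) =
      simple_root l \<bullet> (\<mu> *\<^sub>R chamber_point b)"
    by (simp add: inner_sum_right gram_def mult_ac)
qed

definition energy :: "real^3 \<Rightarrow> (3 \<Rightarrow> real) \<Rightarrow> real" where
  "energy X a = (\<Sum>k\<in>UNIV. \<Sum>l\<in>UNIV. X $ k * X $ l * (gram k l * a k * a l))"

text \<open>Dividing \<open>a\<close> by the positive eigenvector \<open>b\<close> removes the
  diagonal terms. There remains one squared difference of the quotients for each edge of the Coxeter
  diagram, with a positive coefficient.\<close>

lemma energy_identity:
  assumes "perron X b \<mu>"
  shows "energy X a - \<mu> * (\<Sum>k\<in>UNIV. X $ k * (a k)\<^sup>2) =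
    X $ 1 * b $ 1 * (X $ 3 * b $ 3) / 2 * (a 1 / b $ 1 - a 3 / b $ 3)\<^sup>2 +
    golden * (X $ 2 * b $ 2 * (X $ 3 * b $ 3)) / 2 * (a 2 / b $ 2 - a 3 / b $ 3)\<^sup>2"
proof -
  have b: "b $ 1 > 0" "b $ 2 > 0" "b $ 3 > 0" using assms by (auto simp: perron_def)
  define r where "r k = a k / b $ k" for k
  have a: "a 1 = r 1 * b $ 1" "a 2 = r 2 * b $ 2" "a 3 = r 3 * b $ 3" using b by (simp_all add: r_def)
  define y where "y k = X $ k * b $ k" for k
  have "(\<Sum>k\<in>UNIV. gram l k * (X $ k * b $ k)) = \<mu> * b $ l" for l
    using assms by (simp add: perron_def)
  from this[of 1] this[of 2] this[of 3] have eq: "\<mu> * b $ 1 = y 1 - y 3 / 2" "\<mu> * b $ 2 = y 2 - golden * y 3 / 2"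
    "\<mu> * b $ 3 = y 3 - y 1 / 2 - golden * y 2 / 2"
    by (simp_all add: sum_3 gram_simps y_def algebra_simps)
  have "\<mu> * (\<Sum>k\<in>UNIV. X $ k * (a k)\<^sup>2) =
      (\<mu> * b $ 1) * (y 1 * (r 1)\<^sup>2) + (\<mu> * b $ 2) * (y 2 * (r 2)\<^sup>2) + (\<mu> * b $ 3) * (y 3 * (r 3)\<^sup>2)"
    by (simp add: sum_3 a y_def power2_eq_square algebra_simps)
  moreover have "energy X a = (y 1 * r 1)\<^sup>2 + (y 2 * r 2)\<^sup>2 + (y 3 * r 3)\<^sup>2
      - y 1 * y 3 * r 1 * r 3 - golden * y 2 * y 3 * r 2 * r 3"
    by (simp add: energy_def sum_3 gram_simps a y_def power2_eq_square algebra_simps)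
  ultimately show ?thesis
    unfolding eq r_def[symmetric] y_def[symmetric] by (simp add: power2_eq_square algebra_simps)
qed

lemma energy_ge: "perron X b \<mu> \<Longrightarrow> \<mu> * (\<Sum>k\<in>UNIV. X $ k * (a k)\<^sup>2) \<le> energy X a"
proof -
  assume p: "perron X b \<mu>"
  then have "0 < X $ k" "0 < b $ k" for k by (auto simp: perron_def)
  then have "0 \<le> energy X a - \<mu> * (\<Sum>k\<in>UNIV. X $ k * (a k)\<^sup>2)"
    unfolding energy_identity[OF p] using golden_pos
    by (intro add_nonneg_nonneg mult_nonneg_nonneg divide_nonneg_pos) (auto simp: less_imp_le)
  then show ?thesis by simp
qed

lemma energy_eq:
  assumes p: "perron X b \<mu>" and eq: "energy X a = \<mu> * (\<Sum>k\<in>UNIV. X $ k * (a k)\<^sup>2)"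
  shows "a k / b $ k = a l / b $ l"
proof -
  have pos: "0 < X $ k" "0 < b $ k" for k using p by (auto simp: perron_def)
  define s t where "s = X $ 1 * b $ 1 * (X $ 3 * b $ 3) / 2" and "t = golden * (X $ 2 * b $ 2 * (X $ 3 * b $ 3)) / 2"
  have "0 < s" "0 < t" using pos golden_pos by (auto simp: s_def t_def intro!: mult_pos_pos divide_pos_pos)
  moreover have "s * (a 1 / b $ 1 - a 3 / b $ 3)\<^sup>2 + t * (a 2 / b $ 2 - a 3 / b $ 3)\<^sup>2 = 0"
    using energy_identity[OF p, of a] eq by (simp add: s_def t_def)
  ultimately have "s * (a 1 / b $ 1 - a 3 / b $ 3)\<^sup>2 = 0" "t * (a 2 / b $ 2 - a 3 / b $ 3)\<^sup>2 = 0"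
    by (smt (verit) mult_nonneg_nonneg zero_le_power2)+
  then have "a 1 / b $ 1 = a 3 / b $ 3" "a 2 / b $ 2 = a 3 / b $ 3" using \<open>0 < s\<close> \<open>0 < t\<close> by auto
  then show ?thesis using exhaust_3[of k] exhaust_3[of l] by auto
qed

lemma energy_perron:
  assumes "perron X b \<mu>"
  shows "energy X (($) b) = \<mu> * (\<Sum>k\<in>UNIV. X $ k * (b $ k)\<^sup>2)"
proof -
  have "energy X (($) b) = (\<Sum>k\<in>UNIV. X $ k * b $ k * (\<Sum>l\<in>UNIV. gram k l * (X $ l * b $ l)))"
    by (simp add: energy_def sum_distrib_left mult_ac)
  also have "\<dots> = (\<Sum>k\<in>UNIV. X $ k * b $ k * (\<mu> * b $ k))"
    using assms by (simp add: perron_def)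
  finally show ?thesis by (simp add: sum_distrib_left power2_eq_square mult_ac)
qed

text \<open>Testing each eigenvector in the form of the other gives \<mu> \<le> \<mu>' and the
  converse; proportionality is then the equality case of \<open>energy_ge\<close>.\<close>

lemma perron_unique:
  assumes "perron X b \<mu>" "perron X b' \<mu>'"
  shows "\<mu> = \<mu>'" "b $ k * b' $ l = b $ l * b' $ k"
proof -
  have pos: "0 < (\<Sum>k\<in>UNIV. X $ k * (c $ k)\<^sup>2)" if "perron X c \<nu>" for c \<nu>
    using that by (intro sum_pos) (auto simp: perron_def intro!: mult_pos_pos zero_less_power)
  have le: "\<nu> \<le> \<nu>'" if "perron X c \<nu>" "perron X c' \<nu>'" for c c' \<nu> \<nu>'
    using energy_ge[OF that(1), of "($) c'"] energy_perron[OF that(2)] pos[OF that(2)] by simp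
  show eq: "\<mu> = \<mu>'" using le assms by (meson antisym)
  have "b' $ k / b $ k = b' $ l / b $ l"
    by (rule energy_eq[OF assms(1)]) (simp add: energy_perron[OF assms(2)] eq)
  moreover have "b $ k > 0" "b $ l > 0" using assms by (auto simp: perron_def)
  ultimately show "b $ k * b' $ l = b $ l * b' $ k" by (simp add: field_simps)
qed

abbreviation laplacian :: "real^3 \<Rightarrow> real^vertex \<Rightarrow> real^vertex" where
  "laplacian X f \<equiv> \<Sum>k\<in>UNIV. X $ k *\<^sub>R proj k f"

lemma linear_proj: "linear (proj k)"
  unfolding proj_def by (intro linear_compose_scale_right linear_compose_sub linear_ident linear_shift)

lemma shift_proj: "shift k f = f - 2 *\<^sub>R proj k f"
  by (simp add: proj_def)

lemma proj_proj: "proj k (proj k f) = proj k f"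
  by (simp add: proj_def linear_cmul[OF linear_shift] linear_diff[OF linear_shift] shift_shift
      vec_eq_iff field_simps)

lemma adj_proj: "proj k f \<bullet> g = f \<bullet> proj k g"
  by (simp add: proj_def inner_diff_left inner_diff_right adj_shift)

lemma transition_shift: "transition X *v f = (\<Sum>k\<in>UNIV. X $ k *\<^sub>R shift k f)"
  by (simp add: vec_eq_iff transition_mult shift_def)

lemma transition_proj:
  assumes "(\<Sum>k\<in>UNIV. X $ k) = 1"
  shows "transition X *v f = f - 2 *\<^sub>R laplacian X f"
proof -
  have "transition X *v f = (\<Sum>k\<in>UNIV. X $ k *\<^sub>R f - 2 *\<^sub>R (X $ k *\<^sub>R proj k f))"
    unfolding transition_shift by (intro sum.cong refl) (simp add: shift_proj scaleR_diff_right)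
  also have "\<dots> = (\<Sum>k\<in>UNIV. X $ k) *\<^sub>R f - 2 *\<^sub>R laplacian X f"
    by (simp add: sum_subtractf scaleR_sum_left scaleR_sum_right)
  finally show ?thesis using assms by simp
qed

lemma adj_transition: "(transition X *v f) \<bullet> g = f \<bullet> (transition X *v g)"
  by (simp add: transition_shift inner_sum_left inner_sum_right adj_shift)

text \<open>The difference of the two sides is a double sum of dihedral defects, zero on the
  diagonal and nonnegative elsewhere. Equality makes each defect vanish.\<close>

lemma energy_le_norm:
  assumes "\<And>k. 0 \<le> X $ k"
  shows "energy X (\<lambda>k. norm (proj k f)) \<le> (norm (laplacian X f))\<^sup>2"
    and "energy X (\<lambda>k. norm (proj k f)) = (norm (laplacian X f))\<^sup>2 \<Longrightarrow>
      0 < X $ k \<Longrightarrow> 0 < X $ l \<Longrightarrow> k \<noteq> l \<Longrightarrow>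
      proj k f \<bullet> proj l f = gram k l * norm (proj k f) * norm (proj l f)"
proof -
  define d where "d k l = X $ k * X $ l *
    (proj k f \<bullet> proj l f - gram k l * norm (proj k f) * norm (proj l f))" for k l
  have d: "0 \<le> d k l" for k l
  proof (cases "k = l")
    case True
    then show ?thesis by (simp add: d_def power2_norm_eq_inner[symmetric] power2_eq_square)
  next
    case False
    then show ?thesis using proj_inequality[OF False, of f] assms by (simp add: d_def)
  qed
  have "(norm (laplacian X f))\<^sup>2 - energy X (\<lambda>k. norm (proj k f)) = (\<Sum>k\<in>UNIV. \<Sum>l\<in>UNIV. d k l)"
    unfolding power2_norm_eq_inner energy_def d_def
    by (simp add: inner_sum_left inner_sum_right sum_subtractf right_diff_distrib sum_distrib_left
        mult_ac inner_commute)
  moreover have "0 \<le> (\<Sum>k\<in>UNIV. \<Sum>l\<in>UNIV. d k l)" using d by (intro sum_nonneg) auto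
  ultimately show "energy X (\<lambda>k. norm (proj k f)) \<le> (norm (laplacian X f))\<^sup>2"
    by simp
  assume "energy X (\<lambda>k. norm (proj k f)) = (norm (laplacian X f))\<^sup>2"
    and pos: "0 < X $ k" "0 < X $ l"
  then have "(\<Sum>k\<in>UNIV. \<Sum>l\<in>UNIV. d k l) = 0"
    using \<open>(norm _)\<^sup>2 - _ = _\<close> by simp
  then have "(\<Sum>l\<in>UNIV. d k l) = 0"
    using d by (subst (asm) sum_nonneg_eq_0_iff) (auto intro: sum_nonneg)
  then have "d k l = 0" using d by (subst (asm) sum_nonneg_eq_0_iff) auto
  then show "proj k f \<bullet> proj l f = gram k l * norm (proj k f) * norm (proj l f)"
    using pos by (simp add: d_def)
qed

lemma eigen_inner:
  assumes "laplacian X f = \<delta> *\<^sub>R f"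
  shows "(\<Sum>k\<in>UNIV. X $ k * (norm (proj k f))\<^sup>2) = \<delta> * (norm f)\<^sup>2"
proof -
  have "\<delta> * (norm f)\<^sup>2 = laplacian X f \<bullet> f"
    by (simp add: assms power2_norm_eq_inner)
  also have "\<dots> = (\<Sum>k\<in>UNIV. X $ k * (proj k f \<bullet> f))" by (simp add: inner_sum_left)
  also have "\<dots> = (\<Sum>k\<in>UNIV. X $ k * (norm (proj k f))\<^sup>2)"
    by (intro sum.cong refl) (metis adj_proj power2_norm_eq_inner proj_proj)
  finally show ?thesis by simp
qed

text \<open>The energy of the norms of the projections lies between \<mu> \<delta> |f|^2 and
  |\<delta> f|^2; cancelling \<delta> |f|^2, which is positive, gives the claim.\<close>

lemma spectral_gap:
  assumes p: "perron X b \<mu>" and f: "f \<noteq> 0"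
    and eig: "laplacian X f = \<delta> *\<^sub>R f" and "\<delta> \<noteq> 0"
  shows "\<mu> \<le> \<delta>"
proof -
  have X: "0 \<le> X $ k" for k using p by (auto simp: perron_def less_imp_le)
  have nf: "0 < (norm f)\<^sup>2" using f by simp
  have "0 \<le> (\<Sum>k\<in>UNIV. X $ k * (norm (proj k f))\<^sup>2)" using X by (intro sum_nonneg) auto
  then have "0 \<le> \<delta> * (norm f)\<^sup>2" by (simp only: eigen_inner[OF eig])
  then have "0 \<le> \<delta>" using nf by (metis mult_less_0_iff not_less)
  then have "0 < \<delta>" using \<open>\<delta> \<noteq> 0\<close> by simp
  have "\<mu> * (\<delta> * (norm f)\<^sup>2) \<le> (norm (\<delta> *\<^sub>R f))\<^sup>2"
    using order_trans[OF energy_ge[OF p] energy_le_norm(1)[OF X, of f]]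
    by (simp only: eigen_inner[OF eig] eig)
  then have "\<mu> * (\<delta> * (norm f)\<^sup>2) \<le> \<delta> * (\<delta> * (norm f)\<^sup>2)" by (simp add: power2_eq_square mult_ac)
  then show ?thesis using \<open>0 < \<delta>\<close> nf by simp
qed

lemma vertex_root: "\<exists>i0. elt i0 = (\<lambda>x. x)"
  by (rule elt_surj[OF refl_id])

text \<open>Connectedness of the graph: the mirrors generate the group.\<close>

lemma vertex_induct:
  assumes "elt i0 = (\<lambda>x. x)" "P i0" "\<And>i k. P i \<Longrightarrow> P (nb k i)"
  shows "P i"
proof -
  have "\<forall>i. elt i = w \<longrightarrow> P i" if "w \<in> W" for w
    using that
  proof (induction rule: group_right_induct)
    case id
    then show ?case using assms(1,2) inj_elt by metis
  next
    case (step w k)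
    show ?case
    proof (intro allI impI)
      fix i assume "elt i = (\<lambda>x. w (mirror k x))"
      then have "elt (nb k i) = w" by (simp add: elt_nb)
      then have "P (nb k (nb k i))" using step.IH assms(3) by blast
      then show "P i" by simp
    qed
  qed
  then show ?thesis using elt(1) by blast
qed

lemma proj_zero_const:
  assumes "\<And>k. proj k f = 0"
  shows "\<exists>c. f = (\<chi> i. c)"
proof -
  obtain i0 where i0: "elt i0 = (\<lambda>x. x)" using vertex_root by blast
  have "shift k f = f" for k using assms[of k] by (simp add: shift_proj)
  then have "f $ nb k i = f $ i" for k i by (simp add: shift_def vec_eq_iff)
  then have "f $ i = f $ i0" for i by (induction i rule: vertex_induct[OF i0]) auto
  then show ?thesis by (auto simp: vec_eq_iff)
qed

definition coordinate :: "real^3 \<Rightarrow> real^3 \<Rightarrow> real^vertex" where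
  "coordinate v u = (\<chi> i. u \<bullet> elt i v)"

lemma linear_coordinate: "linear (coordinate v)"
  by (rule linearI) (simp_all add: coordinate_def vec_eq_iff inner_add_left)

text \<open>The mean of the mirror images of the chamber point, weighted by \<open>X\<close>, is 1 -
  2 \<mu> times that point, and each element of the group carries this relation to its
  vertex.\<close>

lemma coordinate_eigen:
  assumes p: "perron X b \<mu>"
  shows "transition X *v coordinate (chamber_point b) u = (1 - 2 * \<mu>) *\<^sub>R coordinate (chamber_point b) u"
proof -
  let ?v = "chamber_point b"
  have "(\<Sum>k\<in>UNIV. X $ k *\<^sub>R mirror k ?v) = (\<Sum>k\<in>UNIV. X $ k) *\<^sub>R ?v -
      2 *\<^sub>R (\<Sum>k\<in>UNIV. (X $ k * b $ k) *\<^sub>R simple_root k)"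
    by (simp add: mirror_def scaleR_diff_right sum_subtractf scaleR_sum_left scaleR_sum_right mult_ac)
  then have s: "(\<Sum>k\<in>UNIV. X $ k *\<^sub>R mirror k ?v) = (1 - 2 * \<mu>) *\<^sub>R ?v"
    using p by (simp add: perron_chamber[OF p] perron_def scaleR_diff_left)
  have "(\<Sum>k\<in>UNIV. X $ k * (u \<bullet> elt i (mirror k ?v))) = u \<bullet> elt i (\<Sum>k\<in>UNIV. X $ k *\<^sub>R mirror k ?v)" for i
    by (simp add: elt_linear inner_sum_right)
  then show ?thesis
    by (simp add: vec_eq_iff transition_mult coordinate_def elt_nb s elt_linear)
qed

text \<open>At \<delta> = \<mu> the two estimates behind the gap are equalities: the form estimate
  fixes the ratios of the norms of the projections, and the dihedral one fixes how each projection
  acts on the others.\<close>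

lemma gap_eigenvector:
  assumes p: "perron X b \<mu>" and eig: "laplacian X f = \<mu> *\<^sub>R f"
  shows "\<exists>u. f = coordinate (chamber_point b) u"
proof -
  have X: "0 < X $ k" and b: "0 < b $ k" for k using p by (auto simp: perron_def)
  have X': "0 \<le> X $ k" for k using X[of k] by simp
  have mu: "0 < \<mu>" using p by (simp add: perron_def)
  have "\<mu> * (\<mu> * (norm f)\<^sup>2) \<le> energy X (\<lambda>k. norm (proj k f))"
    using energy_ge[OF p] by (simp only: eigen_inner[OF eig, symmetric])
  moreover have "energy X (\<lambda>k. norm (proj k f)) \<le> \<mu> * (\<mu> * (norm f)\<^sup>2)"
    using energy_le_norm(1)[OF X', of f] by (simp add: eig power2_eq_square mult_ac)
  ultimately have energy: "energy X (\<lambda>k. norm (proj k f)) = \<mu> * (\<mu> * (norm f)\<^sup>2)" by simp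
  then have e1: "energy X (\<lambda>k. norm (proj k f)) = (norm (laplacian X f))\<^sup>2"
    by (simp add: eig power2_eq_square mult_ac)
  have e2: "energy X (\<lambda>k. norm (proj k f)) = \<mu> * (\<Sum>k\<in>UNIV. X $ k * (norm (proj k f))\<^sup>2)"
    by (simp add: energy eigen_inner[OF eig])
  define t where "t = norm (proj 1 f) / b $ 1"
  have norms: "norm (proj k f) = t * b $ k" for k
    using energy_eq[OF p e2, of k 1] b[of k] by (simp add: t_def field_simps)
  \<comment> \<open>Rescaled in this way, the projections obey p_k N_l = \<open>gram k l\<close>
    N_k, the rule by which mirror \<open>k\<close> acts on the simple roots. If t = 0, all of them
    vanish.\<close>
  define N where "N k = (1 / b $ k) *\<^sub>R proj k f" for k
  have projN: "proj k (N l) = gram k l *\<^sub>R N k" for k l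
  proof (cases "k = l \<or> t = 0")
    case True
    moreover have "proj k f = 0" "proj l f = 0" if "t = 0" using norms[of k] norms[of l] that by simp_all
    ultimately show ?thesis
      by (auto simp: N_def linear_cmul[OF linear_proj] proj_proj linear_0[OF linear_proj])
  next
    case False
    then have "(t * b $ k) *\<^sub>R proj k (proj l f) = (gram k l * (t * b $ l)) *\<^sub>R proj k f"
      using proj_equality[of k l f] energy_le_norm(2)[OF X' e1 X X, of k l] norms by simp
    then have "t *\<^sub>R (b $ k *\<^sub>R proj k (proj l f)) = t *\<^sub>R ((gram k l * b $ l) *\<^sub>R proj k f)"
      by (simp add: mult_ac)
    then have "t = 0 \<or> b $ k *\<^sub>R proj k (proj l f) = (gram k l * b $ l) *\<^sub>R proj k f"
      unfolding scaleR_cancel_left by blast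
    then have "b $ k *\<^sub>R proj k (proj l f) = (gram k l * b $ l) *\<^sub>R proj k f" using False by blast
    then have "(1 / (b $ k * b $ l)) *\<^sub>R (b $ k *\<^sub>R proj k (proj l f)) =
        (1 / (b $ k * b $ l)) *\<^sub>R ((gram k l * b $ l) *\<^sub>R proj k f)" by simp
    then show ?thesis
      using b[of k] b[of l] by (simp add: N_def linear_cmul[OF linear_proj])
  qed
  obtain i0 where i0: "elt i0 = (\<lambda>x. x)" using vertex_root by blast
  \<comment> \<open>The vector is chosen so that its products with the simple roots are the values
    of the N_l at the base vertex; the reflection rule then carries the formula to every
    vertex.\<close>
  define u where "u = (\<Sum>l\<in>UNIV. N l $ i0 *\<^sub>R weight l)"
  have root: "N l $ i = u \<bullet> elt i (simple_root l)" for i l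
  proof (induction i arbitrary: l rule: vertex_induct[OF i0])
    case 1
    show ?case using exhaust_3[of l] by (auto simp: u_def i0 sum_3 inner_add_left)
  next
    case (2 i k)
    have "N l $ nb k i = shift k (N l) $ i" by (simp add: shift_def)
    also have "\<dots> = N l $ i - 2 * gram k l * N k $ i" by (simp add: shift_proj projN)
    also have "\<dots> = u \<bullet> elt i (mirror k (simple_root l))"
      by (simp add: 2 mirror_root elt_linear inner_diff_right)
    finally show ?case by (simp add: elt_nb)
  qed
  have "\<mu> * f $ i = \<mu> * (u \<bullet> elt i (chamber_point b))" for i
  proof -
    have "\<mu> *\<^sub>R f = (\<Sum>k\<in>UNIV. (X $ k * b $ k) *\<^sub>R N k)"
      unfolding eig[symmetric] using b by (intro sum.cong refl) (simp add: N_def less_imp_neq[symmetric])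
    then have "\<mu> * f $ i = (\<Sum>k\<in>UNIV. (X $ k * b $ k) *\<^sub>R N k) $ i"
      by (metis vector_scaleR_component real_scaleR_def)
    also have "\<dots> = (\<Sum>k\<in>UNIV. X $ k * b $ k * (u \<bullet> elt i (simple_root k)))"
      by (simp add: root)
    also have "\<dots> = u \<bullet> elt i (\<Sum>k\<in>UNIV. (X $ k * b $ k) *\<^sub>R simple_root k)"
      by (simp add: elt_linear
          inner_sum_right)
    finally show ?thesis
      by (simp add: perron_chamber[OF p] elt_linear)
  qed
  then show ?thesis using mu by (intro exI[of _ u]) (simp add: coordinate_def vec_eq_iff)
qed

lemma eigen_transition:
  assumes "(\<Sum>k\<in>UNIV. X $ k) = 1"
  shows "transition X *v f = (1 - 2 * \<delta>) *\<^sub>R f \<longleftrightarrow> laplacian X f = \<delta> *\<^sub>R f"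
proof -
  have "transition X *v f = (1 - 2 * \<delta>) *\<^sub>R f \<longleftrightarrow>
      2 *\<^sub>R laplacian X f = 2 *\<^sub>R (\<delta> *\<^sub>R f)"
    by (simp add: transition_proj[OF assms] scaleR_diff_left)
  then show ?thesis by (simp only: scaleR_cancel_left) simp
qed

lemma eigenspace_gap:
  assumes p: "perron X b \<mu>"
  shows "eigenspace (transition X) (1 - 2 * \<mu>) = range (coordinate (chamber_point b))"
  using gap_eigenvector[OF p] coordinate_eigen[OF p] eigen_transition[of X] p
  unfolding eigenspace_def by (auto simp: perron_def)

text \<open>Eigenvectors for distinct eigenvalues are orthogonal by symmetry, and a pairwise
  orthogonal set is finite.\<close>

lemma finite_eigenvalues: "finite (eigenvalues (transition X))"
proof -
  let ?E = "eigenvalues (transition X)"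
  have "\<forall>\<nu>\<in>?E. \<exists>f. f \<noteq> 0 \<and> transition X *v f = \<nu> *\<^sub>R f" by (simp add: eigenvalues_def)
  then obtain g where g: "\<And>\<nu>. \<nu> \<in> ?E \<Longrightarrow> g \<nu> \<noteq> 0 \<and> transition X *v g \<nu> = \<nu> *\<^sub>R g \<nu>"
    by metis
  have orth: "g \<nu> \<bullet> g \<nu>' = 0" if "\<nu> \<in> ?E" "\<nu>' \<in> ?E" "\<nu> \<noteq> \<nu>'" for \<nu> \<nu>'
  proof -
    have "\<nu> * (g \<nu> \<bullet> g \<nu>') = \<nu>' * (g \<nu> \<bullet> g \<nu>')"
      using adj_transition[of X "g \<nu>" "g \<nu>'"] g[OF that(1)] g[OF that(2)] by simp
    then show ?thesis using that(3) by simp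
  qed
  have "inj_on g ?E"
    using orth g by (intro inj_onI) (metis inner_eq_zero_iff)
  moreover have "finite (g ` ?E)"
    by (rule pairwise_orthogonal_imp_finite) (auto simp: pairwise_def orthogonal_def intro!: orth)
  ultimately show ?thesis by (rule finite_imageD[rotated])
qed

lemma lambda1_perron:
  assumes p: "perron X b \<mu>"
  shows "lambda1 X = 1 - 2 * \<mu>"
proof -
  let ?A = "transition X" and ?L = "1 - 2 * \<mu>"
  let ?E = "eigenvalues ?A"
  have sum1: "(\<Sum>k\<in>UNIV. X $ k) = 1" and mu: "0 < \<mu>" and X: "\<And>k. 0 < X $ k" using p by (auto simp: perron_def)
  have gap: "\<nu> = 1 \<or> \<nu> \<le> ?L" if "\<nu> \<in> ?E" for \<nu>
  proof -
    obtain f where f: "f \<noteq> 0" "?A *v f = \<nu> *\<^sub>R f" using \<open>\<nu> \<in> ?E\<close> by (auto simp: eigenvalues_def)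
    define \<delta> where "\<delta> = (1 - \<nu>) / 2"
    have nu: "\<nu> = 1 - 2 * \<delta>" by (simp add: \<delta>_def field_simps)
    have "laplacian X f = \<delta> *\<^sub>R f"
      using f(2) unfolding nu eigen_transition[OF sum1] .
    from spectral_gap[OF p f(1) this] show ?thesis unfolding nu by fastforce
  qed
  have space1: "eigenspace ?A 1 = span {\<chi> i. 1}"
  proof (intro equalityI subsetI)
    fix f assume "f \<in> eigenspace ?A 1"
    then have eig: "laplacian X f = 0 *\<^sub>R f"
      unfolding eigen_transition[OF sum1, symmetric] by (simp add: eigenspace_def)
    have "(\<Sum>k\<in>UNIV. X $ k * (norm (proj k f))\<^sup>2) = 0" using eigen_inner[OF eig] by simp
    then have "X $ k * (norm (proj k f))\<^sup>2 = 0" for k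
      using X by (subst (asm) sum_nonneg_eq_0_iff) (auto simp: less_imp_le)
    then have "proj k f = 0" for k using X[of k] by (metis less_irrefl mult_eq_0_iff norm_eq_zero power_eq_0_iff)
    then obtain c where "f = (\<chi> i. c)" using proj_zero_const by blast
    then have "f = c *\<^sub>R (\<chi> i. 1)" by (simp add: vec_eq_iff)
    then show "f \<in> span {\<chi> i. 1}" by (simp add: span_scale span_base)
  next
    fix f :: "real^vertex" assume "f \<in> span {\<chi> i. 1}"
    then obtain c where "f = c *\<^sub>R (\<chi> i. 1)" by (auto simp: span_singleton)
    then have "proj k f = 0" for k by (simp add: proj_def shift_def vec_eq_iff)
    then show "f \<in> eigenspace ?A 1" by (simp add: eigenspace_def transition_proj[OF sum1])
  qed
  have one_ne: "(\<chi> i. 1) \<noteq> (0 :: real^vertex)" by (simp add: vec_eq_iff)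
  have dim1: "dim (eigenspace ?A 1) = 1" using one_ne by (simp add: space1 dim_singleton)
  have one: "1 \<in> ?E"
    using one_ne space1 span_base[of "\<chi> i. 1" "{\<chi> i. 1 :: real^vertex}"] unfolding eigenvalues_def eigenspace_def
    by (metis (mono_tags, lifting) insertI1 mem_Collect_eq span_base)
  obtain i0 where i0: "elt i0 = (\<lambda>x. x)" using vertex_root by blast
  let ?v = "chamber_point b"
  have "0 < b $ 1" using p by (simp add: perron_def)
  then have "?v \<noteq> 0" by (intro chamber_point_nonzero[of b 1]) simp
  then have ne: "coordinate ?v ?v \<noteq> 0" using i0 by (metis coordinate_def inner_eq_zero_iff vec_lambda_beta zero_index)
  have "coordinate ?v ?v \<in> eigenspace ?A ?L" by (simp add: eigenspace_gap[OF p])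
  then have lam: "?L \<in> ?E" using ne by (auto simp: eigenvalues_def eigenspace_def)
  have "\<not> eigenspace ?A ?L \<subseteq> {0}" using ne \<open>coordinate ?v ?v \<in> _\<close> by blast
  then have dim_lam: "0 < dim (eigenspace ?A ?L)" using dim_eq_0 by blast
  define M where "M = {\<mu> \<in> ?E. 1 < (\<Sum>\<nu> \<in> {\<nu> \<in> ?E. \<mu> \<le> \<nu>}. dim (eigenspace ?A \<nu>))}"
  have finM: "finite M" unfolding M_def using finite_eigenvalues by simp
  \<comment> \<open>The value 1 is excluded because only the simple eigenvalue 1 reaches it, while
    more than one eigenvalue, counted with multiplicity, is required.\<close>
  have "{\<nu> \<in> ?E. 1 \<le> \<nu>} = {1}" using one gap mu by fastforce
  then have "1 \<notin> M" by (simp add: M_def dim1)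
  then have le: "\<nu> \<le> ?L" if "\<nu> \<in> M" for \<nu> using gap that by (auto simp: M_def)
  have "dim (eigenspace ?A 1) + dim (eigenspace ?A ?L) = (\<Sum>\<nu> \<in> {1, ?L}. dim (eigenspace ?A \<nu>))"
    using mu by simp
  also have "\<dots> \<le> (\<Sum>\<nu> \<in> {\<nu> \<in> ?E. ?L \<le> \<nu>}. dim (eigenspace ?A \<nu>))"
    using one lam mu finite_eigenvalues by (intro sum_mono2) auto
  finally have "?L \<in> M" using lam dim1 dim_lam by (simp add: M_def)
  then have "Max M = ?L" using le finM by (intro Max_eqI) auto
  then show ?thesis by (simp add: lambda1_def kth_eigenvalue_def M_def)
qed

section \<open>Spectral representations and their limits\<close>

lemma sum_elt: "(\<Sum>i\<in>UNIV. F (elt i)) = (\<Sum>w\<in>W. F w)"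
proof -
  have "bij_betw elt UNIV W" by (simp add: bij_betw_def range_elt inj_on_def inj_elt)
  then show ?thesis by (rule sum.reindex_bij_betw)
qed

lemma sum_left_mirror: "(\<Sum>w\<in>W. F (\<lambda>x. mirror k (w x))) = (\<Sum>w\<in>W. F w)"
  by (rule sum.reindex_bij_witness[of _ "\<lambda>w x. mirror k (w x)" "\<lambda>w x. mirror k (w x)"])
    (auto intro: refl_step)

text \<open>A hands-on form of Schur's lemma: the frame operator of the orbit, summed over the whole
  group, commutes with the mirrors and is therefore scalar.\<close>

lemma coordinate_inner:
  "coordinate v u \<bullet> coordinate v u' = real CARD(vertex) * (v \<bullet> v) / 3 * (u \<bullet> u')"
proof -
  define M where "M x = (\<Sum>w\<in>W. (x \<bullet> w v) *\<^sub>R w v)" for x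
  have linear_M: "linear M"
    by (rule linearI) (simp_all add: M_def inner_add_left scaleR_add_left sum.distrib scaleR_sum_right)
  have inner_M: "x \<bullet> M y = (\<Sum>w\<in>W. (x \<bullet> w v) * (y \<bullet> w v))" for x y
    by (simp add: M_def inner_sum_right mult.commute)
  then have adj_M: "x \<bullet> M y = M x \<bullet> y" for x y by (simp add: inner_commute[of "M x"] mult.commute)
  have mirror_M: "mirror k (M x) = M (mirror k x)" for k x
  proof -
    have "mirror k (M x) = (\<Sum>w\<in>W. (mirror k x \<bullet> mirror k (w v)) *\<^sub>R mirror k (w v))"
      by (simp add: M_def linear_sum[OF linear_mirror] linear_cmul[OF linear_mirror] inner_mirror)
    also have "\<dots> = M (mirror k x)"
      unfolding M_def by (rule sum_left_mirror[of "\<lambda>w. (mirror k x \<bullet> w v) *\<^sub>R w v"])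
    finally show ?thesis .
  qed
  define \<tau> where "\<tau> k = simple_root k \<bullet> M (simple_root k)" for k
  \<comment> \<open>\<open>M\<close> preserves the line on which mirror \<open>k\<close> acts as
    -1.\<close>
  have M_root: "M (simple_root k) = \<tau> k *\<^sub>R simple_root k" for k
  proof -
    have "mirror k (simple_root k) = - simple_root k" by (simp add: mirror_def scaleR_2)
    then have "mirror k (M (simple_root k)) = - M (simple_root k)"
      using mirror_M[of k "simple_root k"] by (simp add: linear_neg[OF linear_M])
    then have "2 *\<^sub>R M (simple_root k) = 2 *\<^sub>R (\<tau> k *\<^sub>R simple_root k)"
      by (simp add: mirror_def \<tau>_def scaleR_2 algebra_simps)
    then show ?thesis unfolding scaleR_cancel_left by simp
  qed
  \<comment> \<open>Since \<open>M\<close> is symmetric, non-orthogonal roots share their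
    eigenvalue, and node 3 is joined to both others.\<close>
  have "\<tau> k = \<tau> l" if "gram k l \<noteq> 0" for k l
    using adj_M[of "simple_root k" "simple_root l"] that by (simp add: M_root gram_def)
  then have "\<tau> 1 = \<tau> 3" "\<tau> 2 = \<tau> 3" using gram_nonzero by blast+
  then have \<tau>: "\<tau> k = \<tau> 3" for k using exhaust_3[of k] by auto
  have M_root': "M (simple_root k) = \<tau> 3 *\<^sub>R simple_root k" for k by (metis M_root \<tau>)
  have M: "M x = \<tau> 3 *\<^sub>R x" for x
  proof -
    have "M x = M (\<Sum>k\<in>UNIV. (weight k \<bullet> x) *\<^sub>R simple_root k)" using root_expansion[of x] by simp
    also have "\<dots> = \<tau> 3 *\<^sub>R (\<Sum>k\<in>UNIV. (weight k \<bullet> x) *\<^sub>R simple_root k)"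
      by (simp add: linear_sum[OF linear_M] linear_cmul[OF linear_M] M_root' scaleR_sum_right mult.commute)
    finally show ?thesis using root_expansion[of x] by simp
  qed
  \<comment> \<open>The scalar is found from the trace, which is the sum of the squared norms of the
    orbit points.\<close>
  have "3 * \<tau> 3 = (\<Sum>k\<in>UNIV. axis k 1 \<bullet> M (axis k 1))"
    by (simp add: M inner_axis_axis)
  also have "\<dots> = (\<Sum>w\<in>W. \<Sum>k\<in>UNIV. (axis k 1 \<bullet> w v) * (axis k 1 \<bullet> w v))"
    unfolding inner_M by (rule sum.swap)
  also have "\<dots> = (\<Sum>w\<in>W. w v \<bullet> w v)" by (simp add: inner_axis') (simp add: inner_vec_def)
  also have "\<dots> = (\<Sum>w\<in>W. v \<bullet> v)" by (intro sum.cong refl) (rule group_inner)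
  also have "\<dots> = (\<Sum>i\<in>(UNIV :: vertex set). v \<bullet> v)" by (rule sum_elt[symmetric])
  finally have "\<tau> 3 = real CARD(vertex) * (v \<bullet> v) / 3" by simp
  moreover have "coordinate v u \<bullet> coordinate v u' = (\<Sum>i\<in>UNIV. (u \<bullet> elt i v) * (u' \<bullet> elt i v))"
    by (simp add: coordinate_def inner_vec_def)
  moreover have "\<dots> = u \<bullet> M u'"
    unfolding inner_M by (rule sum_elt)
  ultimately show ?thesis by (simp add: M)
qed

text \<open>The factor that makes the three coordinate functions of the orbit orthonormal.\<close>

definition orbit_scale :: "real^3 \<Rightarrow> real" where
  "orbit_scale v = sqrt (3 / real CARD(vertex)) / norm v"

lemma orbit_scale_pos: "v \<noteq> 0 \<Longrightarrow> 0 < orbit_scale v"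
  by (simp add: orbit_scale_def)

lemma orbit_scale_square: "v \<noteq> 0 \<Longrightarrow> real CARD(vertex) * (v \<bullet> v) / 3 * (orbit_scale v)\<^sup>2 = 1"
  by (simp add: orbit_scale_def power_divide power2_norm_eq_inner)

lemma perron_nonzero: "perron X b \<mu> \<Longrightarrow> chamber_point b \<noteq> 0"
  by (rule chamber_point_nonzero[of b 1]) (auto simp: perron_def dest: spec[of _ 1])

lemma spectral_representation_orbit:
  assumes p: "perron X b \<mu>"
  shows "spectral_representation X (\<lambda>i. elt i (orbit_scale (chamber_point b) *\<^sub>R chamber_point b))"
proof -
  let ?v = "chamber_point b"
  let ?s = "orbit_scale ?v"
  define \<phi> where "\<phi> k = coordinate ?v (?s *\<^sub>R axis k 1)" for k :: 3
  have s: "?s \<noteq> 0" using orbit_scale_pos[OF perron_nonzero[OF p]] by simp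
  have "\<phi> k \<bullet> \<phi> l = (if k = l then 1 else 0)" for k l
    using orbit_scale_square[OF perron_nonzero[OF p]]
    by (simp add: \<phi>_def coordinate_inner inner_axis_axis power2_eq_square)
  moreover have "span (range \<phi>) = eigenspace (transition X) (lambda1 X)"
    unfolding lambda1_perron[OF p] eigenspace_gap[OF p]
  proof (intro equalityI span_minimal)
    show "range \<phi> \<subseteq> range (coordinate ?v)" by (auto simp: \<phi>_def)
    show "subspace (range (coordinate ?v))"
      by (intro linear_subspace_image linear_coordinate subspace_UNIV)
    show "range (coordinate ?v) \<subseteq> span (range \<phi>)"
    proof
      fix f assume "f \<in> range (coordinate ?v)"
      then obtain u where u: "f = coordinate ?v u" by blast
      have "u = (\<Sum>k\<in>UNIV. (u $ k / ?s) *\<^sub>R (?s *\<^sub>R axis k 1))"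
        using s by (simp add: vec_eq_iff axis_def if_distrib cong: if_cong)
      then have "f = (\<Sum>k\<in>UNIV. (u $ k / ?s) *\<^sub>R \<phi> k)"
        unfolding u \<phi>_def
        by (metis (no_types, lifting) linear_cmul[OF linear_coordinate] linear_sum[OF linear_coordinate] sum.cong)
      then show "f \<in> span (range \<phi>)"
        by (simp only:) (intro span_sum span_scale span_base rangeI)
    qed
  qed
  moreover have "(\<lambda>i. elt i (?s *\<^sub>R ?v)) = (\<lambda>i. \<chi> k. \<phi> k $ i)"
    by (rule ext) (simp add: vec_eq_iff \<phi>_def coordinate_def inner_axis' group_scaleR[OF elt(1)])
  ultimately show ?thesis unfolding spectral_representation_def by blast
qed

lemma parseval:
  fixes a :: "3 \<Rightarrow> real^3"
  assumes "\<And>k l. a k \<bullet> a l = (if k = l then 1 else 0)"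
  shows "(\<Sum>k\<in>UNIV. (a k \<bullet> d)\<^sup>2) = d \<bullet> d"
proof -
  define A :: "real^3^3" where "A = (\<chi> k. a k)"
  have "A ** transpose A = mat 1"
    using assms by (simp add: vec_eq_iff A_def matrix_matrix_mult_def transpose_def mat_def inner_vec_def)
  then have "transpose A ** A = mat 1" using matrix_left_right_inverse by blast
  then have "orthogonal_matrix A" by (simp add: orthogonal_matrix)
  then have "orthogonal_transformation ((*v) A)" by (simp add: orthogonal_transformation_matrix)
  then have "(A *v d) \<bullet> (A *v d) = d \<bullet> d" by (simp add: orthogonal_transformation_def)
  moreover have "(A *v d) $ k = a k \<bullet> d" for k
    by (simp add: A_def matrix_vector_mult_def inner_vec_def)
  ultimately show ?thesis by (simp add: inner_vec_def[of "A *v d"] power2_eq_square)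
qed

text \<open>Any orthonormal basis of the eigenspace comes from an orthogonal triple in R^3 of common
  length 1 / sqrt \<tau>, so by Parseval every spectral representation has edges of squared length
  (2 b_k)^2 / \<tau> in class \<open>k\<close>.\<close>

lemma same_length_perron:
  assumes p: "perron X b \<mu>" and rep: "spectral_representation X \<Phi>" and eq: "b $ k = b $ l"
  shows "same_length \<Phi> k l"
proof -
  let ?v = "chamber_point b"
  obtain \<phi> :: "3 \<Rightarrow> real^vertex" where \<phi>: "\<forall>k l. \<phi> k \<bullet> \<phi> l = (if k = l then 1 else 0)"
    "span (range \<phi>) = eigenspace (transition X) (lambda1 X)" "\<Phi> = (\<lambda>i. \<chi> k. \<phi> k $ i)"
    using rep by (auto simp: spectral_representation_def)
  have "\<phi> k \<in> range (coordinate ?v)" for k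
    using \<phi>(2) span_base[of "\<phi> k" "range \<phi>"] unfolding lambda1_perron[OF p] eigenspace_gap[OF p] by blast
  then obtain u where u: "\<And>k. \<phi> k = coordinate ?v (u k)" unfolding image_iff by metis
  define \<tau> where "\<tau> = real CARD(vertex) * (?v \<bullet> ?v) / 3"
  have \<tau>: "0 < \<tau>" using perron_nonzero[OF p] by (simp add: \<tau>_def)
  define a where "a k = sqrt \<tau> *\<^sub>R u k" for k
  have "a k \<bullet> a l = (if k = l then 1 else 0)" for k l
  proof -
    have "a k \<bullet> a l = \<tau> * (u k \<bullet> u l)" using \<tau> by (simp add: a_def)
    also have "\<dots> = \<phi> k \<bullet> \<phi> l" by (simp add: u coordinate_inner \<tau>_def)
    finally show ?thesis using \<phi>(1) by simp
  qed
  note parseval = parseval[of a, OF this]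
  have norm_vec: "(norm (\<chi> k. g k))\<^sup>2 = (\<Sum>k\<in>UNIV. (g k)\<^sup>2)" for g :: "3 \<Rightarrow> real"
    unfolding power2_norm_eq_inner by (simp add: inner_vec_def power2_eq_square)
  have len: "\<tau> * (dist (\<Phi> i) (\<Phi> (nb k i)))\<^sup>2 = (2 * b $ k)\<^sup>2" for i k
  proof -
    define d where "d = elt i ?v - elt (nb k i) ?v"
    have "\<Phi> i - \<Phi> (nb k i) = (\<chi> k. u k \<bullet> d)"
      by (simp add: vec_eq_iff \<phi>(3) u coordinate_def d_def inner_diff_right)
    then have "(dist (\<Phi> i) (\<Phi> (nb k i)))\<^sup>2 = (\<Sum>k\<in>UNIV. (u k \<bullet> d)\<^sup>2)"
      by (simp add: dist_norm norm_vec)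
    then have "\<tau> * (dist (\<Phi> i) (\<Phi> (nb k i)))\<^sup>2 = (\<Sum>k\<in>UNIV. (a k \<bullet> d)\<^sup>2)"
      using \<tau> by (simp add: a_def power_mult_distrib sum_distrib_left)
    also have "\<dots> = (dist (elt i ?v) (elt i (mirror k ?v)))\<^sup>2"
      by (simp add: parseval d_def dist_norm power2_norm_eq_inner elt_nb)
    finally show ?thesis by (simp add: dist_group[OF elt(1)] dist_mirror power_mult_distrib)
  qed
  show ?thesis
    unfolding same_length_def edge_in_class_iff
  proof clarify
    fix i i'
    have "\<tau> * (dist (\<Phi> i) (\<Phi> (nb k i)))\<^sup>2 = \<tau> * (dist (\<Phi> i') (\<Phi> (nb l i')))\<^sup>2"
      by (simp add: len eq)
    then show "dist (\<Phi> i) (\<Phi> (nb k i)) = dist (\<Phi> i') (\<Phi> (nb l i'))"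
      using \<tau> by (simp add: power2_eq_iff_nonneg)
  qed
qed

text \<open>With the third entry of \<open>b\<close> set to 1, the first two equations express the
  other entries through \<mu>. The third equation becomes h \<mu> = 0 and is solved by the
  intermediate value theorem below both \<open>x\<close> and \<open>y\<close>, where all entries are
  positive.\<close>

lemma perron_exists:
  assumes "X \<in> int_Delta"
  shows "\<exists>b \<mu>. perron X b \<mu>"
proof -
  define x y z where "x = X $ 1" and "y = X $ 2" and "z = X $ 3"
  have pos: "0 < x" "0 < y" "0 < z" using assms by (auto simp: int_Delta_def x_def y_def z_def)
  \<comment> \<open>At three quarters of the smaller of \<open>x\<close> and \<open>y\<close>, the
    corresponding fraction in \<open>h\<close> is already at least \<open>z\<close>, so
    \<open>h\<close> is at most 0 there. At 0 it equals z (2 - golden) / 4, which is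
    positive.\<close>
  define s where "s = 3 / 4 * min x y"
  have s: "0 < s" "s < x" "s < y" using pos by (auto simp: s_def min_def)
  define h where "h t = z - t - x * z / (4 * (x - t)) - (golden + 1) * (y * z) / (4 * (y - t))" for t
  have h0: "0 < h 0"
  proof -
    have "h 0 = z * ((2 - golden) / 4)" using pos by (simp add: h_def field_simps)
    moreover have "0 < z * ((2 - golden) / 4)" using pos golden_upper by (intro mult_pos_pos) auto
    ultimately show ?thesis by (simp only:)
  qed
  have "x * z / (4 * (x - s)) \<ge> z \<or> (golden + 1) * (y * z) / (4 * (y - s)) \<ge> z"
  proof (cases "x \<le> y")
    case True
    then have eq: "4 * (x - s) = x" by (simp add: s_def min_def)
    show ?thesis unfolding eq using pos by simp
  next
    case False
    then have eq: "4 * (y - s) = y" by (simp add: s_def min_def)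
    have "z \<le> (golden + 1) * z" using pos golden_pos by (simp add: algebra_simps)
    also have "\<dots> = (golden + 1) * (y * z) / (4 * (y - s))" unfolding eq using pos by simp
    finally show ?thesis ..
  qed
  moreover have "0 \<le> x * z / (4 * (x - s))" "0 \<le> (golden + 1) * (y * z) / (4 * (y - s))"
    using pos s golden_pos by (auto intro!: divide_nonneg_nonneg mult_nonneg_nonneg)
  ultimately have hs: "h s \<le> 0" using s by (auto simp: h_def)
  have "continuous_on {0..s} h"
    unfolding h_def using s by (intro continuous_intros) auto
  then obtain \<mu> where \<mu>: "0 \<le> \<mu>" "\<mu> \<le> s" "h \<mu> = 0"
    using IVT2'[of h s 0 0] h0 hs s by auto
  then have "0 < \<mu>" using h0 by (cases "\<mu> = 0") auto
  have \<mu>_less: "\<mu> < x" "\<mu> < y" using \<mu> s by auto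
  define b :: "real^3" where "b = vector [z / (2 * (x - \<mu>)), golden * z / (2 * (y - \<mu>)), 1]"
  have "0 < b $ k" for k
    using exhaust_3[of k] pos \<mu>_less golden_pos by (auto simp: b_def vector_3)
  moreover have "(\<Sum>k\<in>UNIV. gram l k * (X $ k * b $ k)) = \<mu> * b $ l" for l
  proof -
    have "h \<mu> = z - \<mu> - x * b $ 1 / 2 - golden * (y * b $ 2) / 2"
      using \<mu>_less by (simp add: h_def b_def vector_3 golden_simps field_simps)
    then have 3: "z - x * b $ 1 / 2 - golden * (y * b $ 2) / 2 = \<mu>" using \<mu>(3) by simp
    have 1: "x * b $ 1 - z / 2 = \<mu> * b $ 1"
      using \<mu>_less by (simp add: b_def vector_3 field_simps)
    have 2: "y * b $ 2 - golden * z / 2 = \<mu> * b $ 2"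
      using \<mu>_less by (simp add: b_def vector_3 field_simps)
    have "b $ 3 = 1" by (simp add: b_def vector_3)
    then show ?thesis
      using exhaust_3[of l] 1 2 3 by (auto simp: sum_3 gram_simps x_def y_def z_def)
  qed
  ultimately have "perron X b \<mu>"
    using assms \<open>0 < \<mu>\<close> by (simp add: perron_def int_Delta_def Delta_def)
  then show ?thesis by blast
qed

lemma perron_scaleR: "perron X b \<mu> \<Longrightarrow> 0 < c \<Longrightarrow> perron X (c *\<^sub>R b) \<mu>"
  by (auto simp: perron_def mult.left_commute[of _ c] sum_distrib_left[symmetric])

text \<open>Crude bounds for the entries of the inverse Gram matrix; their quotient supplies the
  constant 20 below.\<close>

lemma weight_inner_bounds: "1 \<le> weight k \<bullet> weight l" "weight k \<bullet> weight l \<le> 20"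
  using exhaust_3[of k] exhaust_3[of l] golden_lower golden_upper
  by (auto simp: weight_def inner_3 vector_3 golden_simps algebra_simps)

text \<open>By duality, \<open>X $ l * b $ l\<close> is \<mu> times the product of
  \<open>weight l\<close> with the chamber point. These products differ at most by the factor 20,
  uniformly in \<open>X\<close>, which controls \<open>b\<close> as \<open>X\<close> tends to the
  boundary.\<close>

lemma perron_ratio:
  assumes p: "perron X b \<mu>"
  shows "X $ l * b $ l \<le> 20 * (X $ i * b $ i)"
proof -
  have eq: "X $ l * b $ l = \<mu> * (weight l \<bullet> chamber_point b)" for l
  proof -
    have "weight l \<bullet> (\<Sum>k\<in>UNIV. (X $ k * b $ k) *\<^sub>R simple_root k) = X $ l * b $ l"
      using exhaust_3[of l] by (auto simp: sum_3 inner_add_right)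
    then show ?thesis by (simp add: perron_chamber[OF p])
  qed
  have "weight l \<bullet> chamber_point b = (\<Sum>m\<in>UNIV. b $ m * (weight l \<bullet> weight m))" for l
    by (simp add: chamber_point_def inner_sum_right)
  moreover have "(\<Sum>m\<in>UNIV. b $ m * (weight l \<bullet> weight m)) \<le> (\<Sum>m\<in>UNIV. 20 * (b $ m * (weight i \<bullet> weight m)))"
  proof (rule sum_mono)
    fix m
    have "0 < b $ m" using p by (simp add: perron_def)
    moreover have "weight l \<bullet> weight m \<le> 20 * (weight i \<bullet> weight m)"
      using weight_inner_bounds[of l m] weight_inner_bounds[of i m] by linarith
    ultimately show "b $ m * (weight l \<bullet> weight m) \<le> 20 * (b $ m * (weight i \<bullet> weight m))"
      by (simp add: mult.left_commute[of 20])
  qed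
  ultimately have "weight l \<bullet> chamber_point b \<le> 20 * (weight i \<bullet> chamber_point b)"
    by (simp add: sum_distrib_left)
  then show ?thesis
    using p unfolding eq by (simp add: perron_def mult.left_commute[of 20])
qed

lemma ring_vector_chamber: "ring_vector R = chamber_point (\<chi> k. if k \<in> R then 1 else 0)"
  by (rule eq_by_roots) simp

lemma spectral_limit:
  assumes p: "\<And>n. perron (X n) (b n) (\<mu> n)" and lim: "b \<longlonglongrightarrow> (\<chi> k. if k \<in> R then 1 else 0)" and "k \<in> R"
  shows "\<exists>a>0. spectral_representations_converge_to X (\<lambda>i. elt i (a *\<^sub>R ring_vector R))"
proof -
  let ?v = "ring_vector R"
  have ne: "?v \<noteq> 0" using ring_vector_nonzero[of 1 k R] assms(3) by simp
  have "(\<lambda>n. b n $ l) \<longlonglongrightarrow> (if l \<in> R then 1 else 0)" for l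
    using tendsto_vec_nth[OF lim, of l] by simp
  then have v: "(\<lambda>n. chamber_point (b n)) \<longlonglongrightarrow> ?v"
    unfolding ring_vector_chamber chamber_point_def by (auto intro!: tendsto_intros)
  have "(\<lambda>n. orbit_scale (chamber_point (b n)) *\<^sub>R chamber_point (b n)) \<longlonglongrightarrow> orbit_scale ?v *\<^sub>R ?v"
    unfolding orbit_scale_def using ne by (intro tendsto_intros v) auto
  then have elt_lim: "(\<lambda>n. elt i (orbit_scale (chamber_point (b n)) *\<^sub>R chamber_point (b n))) \<longlonglongrightarrow>
      elt i (orbit_scale ?v *\<^sub>R ?v)" for i
    using group_linear[OF elt(1)[of i]] bounded_linear.tendsto linear_conv_bounded_linear by blast
  have "spectral_representations_converge_to X (\<lambda>i. elt i (orbit_scale ?v *\<^sub>R ?v))"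
    unfolding spectral_representations_converge_to_def
    by (rule exI[of _ "\<lambda>n i. elt i (orbit_scale (chamber_point (b n)) *\<^sub>R chamber_point (b n))"])
      (use spectral_representation_orbit[OF p] elt_lim in auto)
  then show ?thesis using orbit_scale_pos[OF ne] by blast
qed

section \<open>The curves and the two kinds of limits\<close>

definition curve_lengths :: "3 \<Rightarrow> real \<Rightarrow> real^3" where
  "curve_lengths k t = (\<chi> l. if l = k then t else 1)"

lemma curve_weights_pos: "0 < t \<Longrightarrow> 0 < curve_weights k t $ l"
  using exhaust_3[of k] exhaust_3[of l] golden_lower golden_upper
  by (auto simp: curve_weights_def vector_3 intro!: add_pos_pos divide_pos_pos mult_pos_pos)

text \<open>The products of weights and lengths are the entries of M a, where \<open>M\<close> is 2
  - golden times the inverse of the Gram matrix.\<close>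

lemma curve_weights_gram:
  assumes "0 < t"
  shows "(\<Sum>m\<in>UNIV. gram l m * (curve_weights k t $ m * curve_lengths k t $ m)) =
    (2 - golden) * curve_lengths k t $ l"
  using exhaust_3[of k] exhaust_3[of l] assms
  by (auto simp: curve_weights_def curve_lengths_def vector_3 sum_3 gram_simps golden_simps
      golden_numeral field_simps)

lemma perron_curve:
  assumes "0 < t"
  shows "\<exists>\<mu>. perron (curve_param k t) (curve_lengths k t) \<mu>"
proof -
  define s where "s = (\<Sum>l\<in>UNIV. curve_weights k t $ l)"
  have s: "0 < s" unfolding s_def using curve_weights_pos[OF assms] by (intro sum_pos) auto
  have param: "curve_param k t $ l = curve_weights k t $ l / s" for l
    by (simp add: curve_param_def s_def)
  have "(\<Sum>m\<in>UNIV. gram l m * (curve_param k t $ m * curve_lengths k t $ m)) =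
      (\<Sum>m\<in>UNIV. gram l m * (curve_weights k t $ m * curve_lengths k t $ m)) / s" for l
    by (simp add: param sum_divide_distrib)
  moreover have "(\<Sum>l\<in>UNIV. curve_param k t $ l) = 1"
    using s by (simp add: param sum_divide_distrib[symmetric] s_def[symmetric])
  ultimately have "perron (curve_param k t) (curve_lengths k t) ((2 - golden) / s)"
    using s curve_weights_pos[OF assms] golden_upper assms
    by (simp add: perron_def param curve_weights_gram[OF assms]) (simp add: curve_lengths_def)
  then show ?thesis ..
qed

lemma other_indices: "\<exists>k l. k \<noteq> l \<and> k \<noteq> i \<and> l \<noteq> (i :: 3)"
  using exhaust_3[of i] distinct_indices by metis

text \<open>A point of the simplex determines its Perron vector up to scale, so distinct parameters
  on one curve give distinct points, and different curves can meet only where all three lengths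
  agree.\<close>

lemma curve_lengths_eq:
  assumes "perron X (curve_lengths k t) \<mu>" "perron X (curve_lengths k' t') \<mu>'" "k \<noteq> k' \<or> t \<noteq> t'"
  shows "k \<noteq> k' \<and> t = 1 \<and> t' = 1"
proof -
  note cross = perron_unique(2)[OF assms(1,2)]
  show ?thesis
  proof (cases "k = k'")
    case True
    obtain l where "l \<noteq> k" using other_indices by metis
    then show ?thesis using cross[of k l] assms(3) True by (simp add: curve_lengths_def)
  next
    case False
    obtain l where l: "l \<noteq> k" "l \<noteq> k'"
      using exhaust_3[of k] exhaust_3[of k'] distinct_indices by metis
    show ?thesis using cross[of k l] cross[of k' l] False l by (auto simp: curve_lengths_def)
  qed
qed

lemma curve_param_1: "curve_param k 1 = X0"
proof -
  have "curve_weights k 1 = vector [5, 3 + 3 * golden, 6 + 2 * golden]"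
    using exhaust_3[of k] by (auto simp: curve_weights_def vec_eq_iff forall_3 vector_3)
  then show ?thesis by (simp add: curve_param_def X0_def sum_3 vector_3)
qed

lemma continuous_curve: "continuous_on {0<..} (curve_param k)"
proof -
  have w: "continuous_on {0<..} (\<lambda>t. curve_weights k t $ l)" for l
    using exhaust_3[of k] exhaust_3[of l]
    by (elim disjE; simp add: curve_weights_def vector_3; intro continuous_intros; simp)
  have "(\<Sum>l\<in>UNIV. curve_weights k t $ l) \<noteq> 0" if "0 < t" for t
    using sum_pos[of UNIV "\<lambda>l. curve_weights k t $ l"] curve_weights_pos[OF that, of k] by auto
  then have "continuous_on {0<..} (\<lambda>t. \<chi> l. (1 / (\<Sum>l\<in>UNIV. curve_weights k t $ l)) * curve_weights k t $ l)"
    by (intro continuous_intros w) auto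
  moreover have "curve_param k = (\<lambda>t. \<chi> l. (1 / (\<Sum>l\<in>UNIV. curve_weights k t $ l)) * curve_weights k t $ l)"
    by (rule ext) (simp add: curve_param_def vec_eq_iff)
  ultimately show ?thesis by simp
qed

lemma curve_cases:
  assumes "X \<in> Curve k"
  obtains t \<mu> where "0 < t" "X = curve_param k t" "perron X (curve_lengths k t) \<mu>"
  using assms perron_curve unfolding Curve_def by (metis greaterThan_iff imageE)

lemma curve_subset_Delta: "Curve k \<subseteq> Delta"
proof
  fix X assume "X \<in> Curve k"
  then obtain t \<mu> where "perron X (curve_lengths k t) \<mu>" by (rule curve_cases)
  then show "X \<in> Delta" by (simp add: perron_def Delta_def less_imp_le)
qed

lemma perron_sum:
  assumes "perron X b \<mu>"
  shows "X $ l = 1 - (\<Sum>m\<in>-{l}. X $ m)" "0 < X $ l" "X $ l \<le> 1"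
proof -
  have X: "0 < X $ m" for m using assms by (simp add: perron_def)
  have "(\<Sum>m\<in>UNIV. X $ m) = X $ l + (\<Sum>m\<in>-{l}. X $ m)"
    by (simp add: sum.remove[of UNIV l] Compl_eq_Diff_UNIV)
  then show eq: "X $ l = 1 - (\<Sum>m\<in>-{l}. X $ m)" using assms by (simp add: perron_def)
  show "0 < X $ l" by (rule X)
  have "0 \<le> (\<Sum>m\<in>-{l}. X $ m)" using X by (intro sum_nonneg) (auto simp: less_imp_le)
  then show "X $ l \<le> 1" using eq by simp
qed

text \<open>As t tends to 0, the ratio bound gives \<open>X $ l\<close> \<le> 20 t for every other
  index, so the whole mass moves to coordinate \<open>k\<close>.\<close>

lemma corner_in_closure: "corner k \<in> closure (Curve k)"
proof -
  define t where "t n = 1 / real (Suc n)" for n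
  define X where "X n = curve_param k (t n)" for n
  have t: "0 < t n" for n by (simp add: t_def)
  have t0: "t \<longlonglongrightarrow> 0" unfolding t_def by (rule LIMSEQ_Suc[OF lim_1_over_n])
  have p: "\<exists>\<mu>. perron (X n) (curve_lengths k (t n)) \<mu>" for n
    unfolding X_def by (rule perron_curve[OF t])
  have zero: "(\<lambda>n. X n $ l) \<longlonglongrightarrow> 0" if "l \<noteq> k" for l
  proof (rule tendsto_sandwich[OF always_eventually always_eventually tendsto_const])
    show "\<forall>n. X n $ l \<le> 20 * t n"
    proof
      fix n
      obtain \<mu> where \<mu>: "perron (X n) (curve_lengths k (t n)) \<mu>" using p by blast
      have "X n $ l \<le> 20 * (X n $ k * t n)"
        using perron_ratio[OF \<mu>, of l k] that by (simp add: curve_lengths_def)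
      also have "\<dots> \<le> 20 * t n"
        using perron_sum(3)[OF \<mu>, of k] t[of n] mult_right_mono[of "X n $ k" 1 "t n"] by simp
      finally show "X n $ l \<le> 20 * t n" .
    qed
    show "\<forall>n. 0 \<le> X n $ l" using p perron_sum(2) less_imp_le by blast
    show "(\<lambda>n. 20 * t n) \<longlonglongrightarrow> 0" using tendsto_mult_right[OF t0, of 20] by simp
  qed
  have one: "(\<lambda>n. X n $ k) \<longlonglongrightarrow> 1"
  proof -
    have "(\<lambda>n. 1 - (\<Sum>m\<in>-{k}. X n $ m)) \<longlonglongrightarrow> 1 - (\<Sum>m\<in>-{k}. 0)"
      by (intro tendsto_intros zero) auto
    moreover have "X n $ k = 1 - (\<Sum>m\<in>-{k}. X n $ m)" for n using p perron_sum(1) by blast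
    ultimately show ?thesis by simp
  qed
  have "X \<longlonglongrightarrow> corner k"
    using zero one by (intro vec_tendstoI) (auto simp: corner_def axis_def)
  moreover have "X n \<in> Curve k" for n unfolding X_def Curve_def using t by auto
  ultimately show ?thesis unfolding closure_sequential by blast
qed

text \<open>Conversely, convergence to the corner forces t to 0, since the ratio bound gives t \<le>
  20 \<open>X $ l\<close> / \<open>X $ k\<close>. In the limit the edges of class \<open>k\<close>
  vanish and the other two classes keep equal length.\<close>

lemma curve_limit:
  assumes X: "\<And>n. X n \<in> Curve k" and lim: "X \<longlonglongrightarrow> corner k"
  shows "\<exists>a>0. spectral_representations_converge_to X (\<lambda>i. elt i (a *\<^sub>R ring_vector (-{k})))"
proof -
  have "\<exists>t \<mu>. 0 < t \<and> perron (X n) (curve_lengths k t) \<mu>" for n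
    using curve_cases[OF X[of n]] by metis
  then obtain t \<mu> where t: "\<And>n. 0 < t n" and p: "\<And>n. perron (X n) (curve_lengths k (t n)) (\<mu> n)"
    by metis
  obtain l where l: "l \<noteq> k" using other_indices by metis
  have X_lim: "(\<lambda>n. X n $ l) \<longlonglongrightarrow> 0" "(\<lambda>n. X n $ k) \<longlonglongrightarrow> 1"
    using tendsto_vec_nth[OF lim, of l] tendsto_vec_nth[OF lim, of k] l
    by (simp_all add: corner_def axis_def)
  have t0: "t \<longlonglongrightarrow> 0"
  proof (rule tendsto_sandwich[OF always_eventually always_eventually tendsto_const])
    show "\<forall>n. 0 \<le> t n" using t less_imp_le by blast
    show "\<forall>n. t n \<le> 20 * (X n $ l / X n $ k)"
    proof
      fix n
      have "X n $ k * t n \<le> 20 * X n $ l"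
        using perron_ratio[OF p[of n], of k l] l by (simp add: curve_lengths_def)
      then show "t n \<le> 20 * (X n $ l / X n $ k)"
        using perron_sum(2)[OF p[of n], of k] by (simp add: field_simps)
    qed
    have "(\<lambda>n. 20 * (X n $ l / X n $ k)) \<longlonglongrightarrow> 20 * (0 / 1)"
      by (intro tendsto_intros X_lim) auto
    then show "(\<lambda>n. 20 * (X n $ l / X n $ k)) \<longlonglongrightarrow> 0" by simp
  qed
  have "(\<lambda>n. curve_lengths k (t n)) \<longlonglongrightarrow> (\<chi> l. if l \<in> -{k} then 1 else 0)"
    using t0 by (intro vec_tendstoI) (auto simp: curve_lengths_def)
  then show ?thesis using spectral_limit[where R = "-{k}" and k = l, OF p] l by simp
qed

text \<open>With \<open>b\<close> normalised to sum 1, the ratio bound gives \<open>b $ l\<close>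
  \<le> 20 \<open>X $ k\<close> / \<open>X $ l\<close>, which tends to 0 for l different from the
  vanishing coordinate \<open>k\<close>. Only the edges of class \<open>k\<close> survive.\<close>

lemma boundary_limit:
  assumes X: "\<And>n. X n \<in> int_Delta" and Y: "Y $ k = 0" "\<And>l. l \<noteq> k \<Longrightarrow> 0 < Y $ l" and lim: "X \<longlonglongrightarrow> Y"
  shows "\<exists>a>0. spectral_representations_converge_to X (\<lambda>i. elt i (a *\<^sub>R ring_vector {k}))"
proof -
  have "\<exists>b \<mu>. perron (X n) b \<mu> \<and> (\<Sum>l\<in>UNIV. b $ l) = 1" for n
  proof -
    obtain b \<mu> where p: "perron (X n) b \<mu>" using perron_exists[OF X[of n]] by blast
    then have s: "0 < (\<Sum>l\<in>UNIV. b $ l)" by (intro sum_pos) (auto simp: perron_def)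
    then have "(\<Sum>l\<in>UNIV. ((1 / (\<Sum>l\<in>UNIV. b $ l)) *\<^sub>R b) $ l) = 1"
      by (simp add: sum_divide_distrib[symmetric])
    then show ?thesis using perron_scaleR[OF p, of "1 / (\<Sum>l\<in>UNIV. b $ l)"] s by auto
  qed
  then obtain b \<mu> where p: "\<And>n. perron (X n) (b n) (\<mu> n)" and sum1: "\<And>n. (\<Sum>l\<in>UNIV. b n $ l) = 1"
    by metis
  have b: "0 < b n $ l" for n l using p by (simp add: perron_def)
  have split: "b n $ k = 1 - (\<Sum>m\<in>-{k}. b n $ m)" for n
    using sum1[of n] by (simp add: sum.remove[of UNIV k] Compl_eq_Diff_UNIV)
  have le1: "b n $ k \<le> 1" for n
  proof -
    have "0 \<le> (\<Sum>m\<in>-{k}. b n $ m)" using b by (intro sum_nonneg) (simp add: less_imp_le)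
    then show ?thesis using split[of n] by simp
  qed
  have zero: "(\<lambda>n. b n $ l) \<longlonglongrightarrow> 0" if l: "l \<noteq> k" for l
  proof (rule tendsto_sandwich[OF always_eventually always_eventually tendsto_const])
    show "\<forall>n. 0 \<le> b n $ l" using b less_imp_le by blast
    show "\<forall>n. b n $ l \<le> 20 * (X n $ k / X n $ l)"
    proof
      fix n
      have Xp: "0 < X n $ m" for m using p[of n] by (simp add: perron_def)
      have "X n $ l * b n $ l \<le> 20 * (X n $ k * b n $ k)" by (rule perron_ratio[OF p])
      also have "\<dots> \<le> 20 * X n $ k" using le1[of n] Xp[of k] mult_left_mono[of "b n $ k" 1 "X n $ k"] by simp
      finally show "b n $ l \<le> 20 * (X n $ k / X n $ l)" using Xp[of l] by (simp add: field_simps)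
    qed
    have "(\<lambda>n. 20 * (X n $ k / X n $ l)) \<longlonglongrightarrow> 20 * (Y $ k / Y $ l)"
      using Y(2)[OF l] by (intro tendsto_intros tendsto_vec_nth[OF lim]) auto
    then show "(\<lambda>n. 20 * (X n $ k / X n $ l)) \<longlonglongrightarrow> 0" by (simp add: Y(1))
  qed
  have "(\<lambda>n. 1 - (\<Sum>m\<in>-{k}. b n $ m)) \<longlonglongrightarrow> 1 - (\<Sum>m\<in>-{k}. 0)"
    by (intro tendsto_intros zero) auto
  then have "(\<lambda>n. b n $ k) \<longlonglongrightarrow> 1" by (simp add: split)
  then have "b \<longlonglongrightarrow> (\<chi> l. if l \<in> {k} then 1 else 0)"
    using zero by (intro vec_tendstoI) auto
  then show ?thesis using spectral_limit[where R = "{k}" and k = k, OF p] by simp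
qed

theorem theorem1p14:
  shows
    "(\<forall>i. Curve i \<subseteq> Delta \<and> continuous_on {0<..} (curve_param i) \<and> inj_on (curve_param i) {0<..}) \<and>
     (\<Inter>i. Curve i) = {X0} \<and>
     (\<forall>i. \<exists>k l. k \<noteq> l \<and>
        (\<forall>X \<in> Curve i. \<forall>\<Phi>. spectral_representation X \<Phi> \<longrightarrow> same_length \<Phi> k l)) \<and>
     (\<forall>i. corner i \<in> closure (Curve i) \<and>
        (\<forall>X. (\<forall>n. X n \<in> Curve i) \<and> X \<longlonglongrightarrow> corner i \<longrightarrow>
          (\<exists>\<Psi>. spectral_representations_converge_to X \<Psi> \<and> realises_solid (limit_solid i) \<Psi>))) \<and>
     (\<forall>X Y. (\<forall>n. X n \<in> int_Delta) \<and> Y \<in> boundary_edge_interior \<and> X \<longlonglongrightarrow> Y \<longrightarrow>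
        (\<exists>\<Psi>. spectral_representations_converge_to X \<Psi> \<and>
          (\<exists>c \<in> {[3, 3, 3, 3, 3], [5, 5, 5], [3, 5, 3, 5]}. realises_solid c \<Psi>)))"
proof (intro conjI allI impI)
  fix i
  show "Curve i \<subseteq> Delta" by (rule curve_subset_Delta)
  show "continuous_on {0<..} (curve_param i)" by (rule continuous_curve)
  show "inj_on (curve_param i) {0<..}"
  proof (rule inj_onI)
    fix s t :: real assume "s \<in> {0<..}" "t \<in> {0<..}" "curve_param i s = curve_param i t"
    then show "s = t"
      using perron_curve[of s i] perron_curve[of t i] curve_lengths_eq[of _ i s _ i t] by auto
  qed
  show "corner i \<in> closure (Curve i)" by (rule corner_in_closure)
  \<comment> \<open>These are the two classes whose entries in \<open>curve_lengths i t\<close> are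
    the constant 1.\<close>
  obtain k l where kl: "k \<noteq> l" "k \<noteq> i" "l \<noteq> i" using other_indices by metis
  have "same_length \<Phi> k l" if X: "X \<in> Curve i" "spectral_representation X \<Phi>" for X \<Phi>
  proof -
    obtain t \<mu> where "perron X (curve_lengths i t) \<mu>" using X(1) by (rule curve_cases)
    then show ?thesis using X(2) kl by (intro same_length_perron) (auto simp: curve_lengths_def)
  qed
  then show "\<exists>k l. k \<noteq> l \<and> (\<forall>X \<in> Curve i. \<forall>\<Phi>. spectral_representation X \<Phi> \<longrightarrow> same_length \<Phi> k l)"
    using kl(1) by blast
next
  show "(\<Inter>i. Curve i) = {X0}"
  proof (intro equalityI subsetI)
    fix X assume "X \<in> (\<Inter>i. Curve i)"
    then have "X \<in> Curve 1" "X \<in> Curve 2" by auto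
    then obtain s \<mu> t \<nu> where s: "X = curve_param 1 s" "perron X (curve_lengths 1 s) \<mu>"
      and t: "perron X (curve_lengths 2 t) \<nu>"
      by (metis curve_cases)
    have "s = 1" using curve_lengths_eq[OF s(2) t] by simp
    then show "X \<in> {X0}" using s(1) curve_param_1 by simp
  next
    fix X assume "X \<in> {X0}"
    then have "X = curve_param i 1" for i by (simp add: curve_param_1)
    then show "X \<in> (\<Inter>i. Curve i)" unfolding Curve_def by (metis INT_I greaterThan_iff imageI zero_less_one)
  qed
next
  fix i X assume X: "(\<forall>n. X n \<in> Curve i) \<and> X \<longlonglongrightarrow> corner i"
  then obtain a where a: "0 < a"
    "spectral_representations_converge_to X (\<lambda>j. elt j (a *\<^sub>R ring_vector (-{i})))"
    using curve_limit by blast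
  have "realises_solid (limit_solid i) (\<lambda>j. elt j (a *\<^sub>R ring_vector (-{i})))"
    using exhaust_3[of i] realises_solids(4-6)[OF a(1)] by (auto simp: limit_solid_def compl_index)
  then show "\<exists>\<Psi>. spectral_representations_converge_to X \<Psi> \<and> realises_solid (limit_solid i) \<Psi>"
    using a(2) by blast
next
  fix X Y assume XY: "(\<forall>n. X n \<in> int_Delta) \<and> Y \<in> boundary_edge_interior \<and> X \<longlonglongrightarrow> Y"
  then obtain k where "Y $ k = 0" "\<forall>l. l \<noteq> k \<longrightarrow> 0 < Y $ l" by (auto simp: boundary_edge_interior_def)
  then obtain a where a: "0 < a"
    "spectral_representations_converge_to X (\<lambda>j. elt j (a *\<^sub>R ring_vector {k}))"
    using boundary_limit[of X Y k] XY by blast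
  have "\<exists>c \<in> {[3, 3, 3, 3, 3], [5, 5, 5], [3, 5, 3, 5]}.
      realises_solid c (\<lambda>j. elt j (a *\<^sub>R ring_vector {k}))"
    using exhaust_3[of k] realises_solids(1-3)[OF a(1)] by auto
  then show "\<exists>\<Psi>. spectral_representations_converge_to X \<Psi> \<and>
      (\<exists>c \<in> {[3, 3, 3, 3, 3], [5, 5, 5], [3, 5, 3, 5]}. realises_solid c \<Psi>)"
    using a(2) by blast
qed

end
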